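(* If $\Omega\subset\mathbb{R}^2$ is a non-empty, open and simply connected set with finite measure, then $$\Phi_{1,2}(\Omega)\le\Bigg(1-\frac{3^4}{12801\cdot 2^{31}\Big(1+\frac{\pi+\pi^2}{16}\Big)^4}\Bigg)^{\frac12},\qquad\text{where}\qquad \Phi_{1,2}(\Omega)=\frac{1}{|\Omega|^{1/2}}\frac{\|w_{\Omega}\|_1}{\|w_{\Omega}\|_2}.$$
   Context: For a non-empty open set $\Omega\subset\mathbb{R}^2$ of finite Lebesgue measure $|\Omega|$, $w_\Omega$ is the torsion function, i.e. the unique weak solution of $-\Delta w=1$, $w\in H^1_0(\Omega)$; $\|\cdot\|_p$ is the $L^p(\Omega)$ norm. $\Phi_{1,2}(\Omega)$ is called the $L^1$–$L^2$ participation ratio of the torsion function. *)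

theory Defs
  imports "HOL-Analysis.Analysis"
begin

fun C_k :: "nat \<Rightarrow> ('a::euclidean_space \<Rightarrow> real) \<Rightarrow> bool" where
  "C_k 0 f \<longleftrightarrow> continuous_on UNIV f"
| "C_k (Suc k) f \<longleftrightarrow> f differentiable_on UNIV \<and>
     (\<forall>b\<in>Basis. C_k k (\<lambda>x. frechet_derivative f (at x) b))"

text \<open>Elements of \<open>C\<^sub>c\<^sup>\<infinity>(\<Omega>)\<close> are represented by their extensions by zero to the whole space.\<close>

definition test_function :: "'a::euclidean_space set \<Rightarrow> ('a \<Rightarrow> real) \<Rightarrow> bool" where
  "test_function \<Omega> \<phi> \<longleftrightarrow> (\<forall>k. C_k k \<phi>) \<and>
     compact (closure {x. \<phi> x \<noteq> 0}) \<and> closure {x. \<phi> x \<noteq> 0} \<subseteq> \<Omega>"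

text \<open>Elements of the spaces \<open>L\<^sup>2(\<Omega>)\<close>, \<open>H\<^sup>1(\<Omega>)\<close>, \<open>H\<^sub>0\<^sup>1(\<Omega>)\<close> are represented by functions
  on the whole type, of which only the values on \<open>\<Omega>\<close> matter, up to null sets.\<close>

definition square_integrable ::
    "'a::euclidean_space set \<Rightarrow> ('a \<Rightarrow> 'b::euclidean_space) \<Rightarrow> bool" where
  "square_integrable \<Omega> u \<longleftrightarrow> u \<in> borel_measurable (lebesgue_on \<Omega>) \<and>
     integrable (lebesgue_on \<Omega>) (\<lambda>x. (norm (u x))\<^sup>2)"

text \<open>Square integrability is part of the following notion, so that both integrals exist.\<close>

definition has_weak_gradient ::
    "'a::euclidean_space set \<Rightarrow> ('a \<Rightarrow> real) \<Rightarrow> ('a \<Rightarrow> 'a) \<Rightarrow> bool" where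
  "has_weak_gradient \<Omega> u g \<longleftrightarrow> square_integrable \<Omega> u \<and> square_integrable \<Omega> g \<and>
     (\<forall>\<phi>. test_function \<Omega> \<phi> \<longrightarrow>
        (\<forall>b\<in>Basis. (LINT x|lebesgue_on \<Omega>. u x * frechet_derivative \<phi> (at x) b)
                  = - (LINT x|lebesgue_on \<Omega>. (g x \<bullet> b) * \<phi> x)))"

definition H1 :: "'a::euclidean_space set \<Rightarrow> ('a \<Rightarrow> real) set" where
  "H1 \<Omega> = {u. \<exists>g. has_weak_gradient \<Omega> u g}"

text \<open>For open \<open>\<Omega>\<close> and \<open>u \<in> H\<^sup>1(\<Omega>)\<close>, the weak gradient is unique up to null sets;
  the choice selects a representative.\<close>

definition weak_gradient :: "'a::euclidean_space set \<Rightarrow> ('a \<Rightarrow> real) \<Rightarrow> 'a \<Rightarrow> 'a" where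
  "weak_gradient \<Omega> u = (SOME g. has_weak_gradient \<Omega> u g)"

definition H1_norm :: "'a::euclidean_space set \<Rightarrow> ('a \<Rightarrow> real) \<Rightarrow> real" where
  "H1_norm \<Omega> u = sqrt ((LINT x|lebesgue_on \<Omega>. (u x)\<^sup>2) +
     (LINT x|lebesgue_on \<Omega>. (norm (weak_gradient \<Omega> u x))\<^sup>2))"

definition H10 :: "'a::euclidean_space set \<Rightarrow> ('a \<Rightarrow> real) set" where
  "H10 \<Omega> = {u \<in> H1 \<Omega>. \<exists>\<phi>. (\<forall>n::nat. test_function \<Omega> (\<phi> n)) \<and>
     (\<lambda>n. H1_norm \<Omega> (\<lambda>x. \<phi> n x - u x)) \<longlonglongrightarrow> 0}"

text \<open>Weak solutions of \<open>-\<Delta>w = 1\<close>, \<open>w \<in> H\<^sub>0\<^sup>1(\<Omega>)\<close>.\<close>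

definition torsion_solution :: "'a::euclidean_space set \<Rightarrow> ('a \<Rightarrow> real) \<Rightarrow> bool" where
  "torsion_solution \<Omega> w \<longleftrightarrow> w \<in> H10 \<Omega> \<and>
     (\<forall>v\<in>H10 \<Omega>. (LINT x|lebesgue_on \<Omega>. weak_gradient \<Omega> w x \<bullet> weak_gradient \<Omega> v x)
                = (LINT x|lebesgue_on \<Omega>. v x))"

text \<open>For open \<open>\<Omega>\<close> of finite measure a weak solution exists and is unique up to null sets;
  the choice again selects a representative.\<close>

definition torsion_function :: "'a::euclidean_space set \<Rightarrow> 'a \<Rightarrow> real" where
  "torsion_function \<Omega> = (SOME w. torsion_solution \<Omega> w)"

definition Lp_norm :: "real \<Rightarrow> 'a::euclidean_space set \<Rightarrow> ('a \<Rightarrow> real) \<Rightarrow> real" where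
  "Lp_norm p \<Omega> u = (LINT x|lebesgue_on \<Omega>. \<bar>u x\<bar> powr p) powr (1 / p)"

definition participation_ratio_1_2 :: "'a::euclidean_space set \<Rightarrow> real" where
  "participation_ratio_1_2 \<Omega> =
     1 / measure lebesgue \<Omega> powr (1 / 2) *
     (Lp_norm 1 \<Omega> (torsion_function \<Omega>) / Lp_norm 2 \<Omega> (torsion_function \<Omega>))"

end

theory Submission
  imports Defs "HOL-Complex_Analysis.Cauchy_Integral_Formula"
begin

text \<open>In the plane a single missing point has capacity zero, so a point of the complement
  alone gives no control of \<open>w\<close> near it. Simple connectedness forces the complement to
  reach out from \<open>z\<close> through all scales, and this is what the local inequality
  consumes. As \<open>w\<close> is only a class modulo null sets, its zeros have no meaning: the
  inequality is proved for test functions and passed to the limit. The torsion function is given by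
  a choice, so a weak solution must be produced first; the Poincare inequality for this is the same
  local one, at a scale so large that no square fits into \<open>\<Omega>\<close>. The sign of
  \<open>w\<close> enters through \<open>\<integral>|w| = \<integral>w\<close>, which follows from
  Young's inequality applied to a smooth substitute for \<open>|\<phi>|\<close>. A large
  \<open>s\<close> favours the bump estimate, but the averaged gradient term, relative to
  \<open>m^2 A\<close>, grows like \<open>s^2 / m\<close>; at \<open>s^2 = m / 768\<close> it is
  exactly one half. The outcome \<open>V \<ge> m^2 A / (7 * 10^11)\<close> suffices because the
  squared ratio is \<open>m^2 A / (V + m^2 A)\<close> and the claimed deficit is at most
  \<open>10^(-12)\<close>.\<close>

text \<open>
  Let \<open>A\<close> be the area of \<open>\<Omega>\<close>, \<open>w\<close> the torsion function, \<open>m\<close> its mean and \<open>V = \<integral>(w - m)\<^sup>2\<close>. It suffices to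
  bound \<open>V / (m\<^sup>2 A)\<close> from below, and this is done at the single length scale \<open>s\<close> given by
  \<open>s\<^sup>2 = m / 768\<close>, on the squares \<open>Q(c, s)\<close> with centre \<open>c\<close> and half side \<open>s\<close>.

  If \<open>Q(c, s) \<subseteq> \<Omega>\<close>, testing \<open>-\<Delta>w = 1\<close> against a bump \<open>\<beta>\<close> gives \<open>\<integral>(m - w) \<Delta>\<beta> = \<integral>\<beta>\<close>, whence
  \<open>\<integral>\<^bsub>Q(c, s)\<^esub> (w - m)\<^sup>2\<close> is at least a multiple of \<open>s\<^sup>6\<close>, that is, of \<open>m\<^sup>2 s\<^sup>2\<close>.
  Otherwise \<open>Q(c, s)\<close> contains a point \<open>z\<close> of the complement. As \<open>\<Omega>\<close> is simply connected, the
  boundary of every square centred at \<open>z\<close> meets the complement, so that \<open>w\<close> vanishes somewhere on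
  it; joining these zeros to the points of \<open>Q(c, s)\<close> by segments parallel to the axes yields
  \<open>\<integral>\<^bsub>Q(c, s)\<^esub> w\<^sup>2 \<le> 48 s\<^sup>2 \<integral>\<^bsub>Q(c, 2s)\<^esub> |\<nabla>w|\<^sup>2\<close>. Integrating both estimates over \<open>c\<close> and using
  \<open>\<integral>|\<nabla>w|\<^sup>2 = \<integral>w = m A\<close>, the gradient term is absorbed into the left-hand side.
\<close>

section \<open>Smooth functions and test functions\<close>

definition smooth :: "('a::euclidean_space \<Rightarrow> real) \<Rightarrow> bool" where
  "smooth f \<longleftrightarrow> (\<forall>k. C_k k f)"

definition partial :: "'a::euclidean_space \<Rightarrow> ('a \<Rightarrow> real) \<Rightarrow> 'a \<Rightarrow> real" where
  "partial b f x = frechet_derivative f (at x) b"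

definition grad :: "('a::euclidean_space \<Rightarrow> real) \<Rightarrow> 'a \<Rightarrow> 'a" where
  "grad f x = (\<Sum>b\<in>Basis. partial b f x *\<^sub>R b)"

lemma C_k_Suc: "C_k (Suc k) f \<longleftrightarrow> f differentiable_on UNIV \<and> (\<forall>b\<in>Basis. C_k k (partial b f))"
  by (simp add: partial_def[abs_def])

declare C_k.simps(2) [simp del]

lemma C_k_partial: "C_k (Suc k) f \<Longrightarrow> b \<in> Basis \<Longrightarrow> C_k k (partial b f)"
  by (simp add: C_k_Suc)

lemma smoothD:
  assumes "smooth f"
  shows "f differentiable_on UNIV" "b \<in> Basis \<Longrightarrow> smooth (partial b f)"
  using assms unfolding smooth_def by (metis C_k_Suc)+

lemma smooth_imp_has_derivative:
  assumes "smooth f"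
  shows "(f has_derivative frechet_derivative f (at x)) (at x)"
  using smoothD(1)[OF assms] by (simp add: differentiable_on_def frechet_derivative_works)

lemma smooth_imp_continuous: "smooth f \<Longrightarrow> continuous_on UNIV f"
  using differentiable_imp_continuous_on smoothD(1) by blast

lemma partial_eqI:
  assumes "(f has_derivative f') (at x)"
  shows "partial b f x = f' b"
  using frechet_derivative_at[OF assms, symmetric] by (simp add: partial_def)

section \<open>Closure of smooth functions under algebra and composition\<close>

lemma C_k_mono_Suc: "C_k (Suc k) f \<Longrightarrow> C_k k f"
proof (induction k arbitrary: f)
  case 0
  then show ?case by (simp add: C_k_Suc differentiable_imp_continuous_on)
next
  case (Suc k)
  \<comment> \<open>The order drops on the partial derivatives. This is what later lets the product
    and chain rules, which leave undifferentiated factors, run through an induction on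
    \<open>k\<close>.\<close>
  then show ?case by (subst C_k_Suc) (use Suc C_k_Suc in blast)
qed

lemma C_k_differentiable:
  assumes "C_k (Suc k) f"
  shows "(f has_derivative frechet_derivative f (at x)) (at x)"
  using assms by (simp add: C_k_Suc differentiable_on_def frechet_derivative_works)

lemma C_k_const: "C_k k (\<lambda>x::'a::euclidean_space. c)"
proof (induction k arbitrary: c)
  case (Suc k)
  have "partial b (\<lambda>x::'a. c) = (\<lambda>x. 0)" for b
    by (rule ext, subst partial_eqI) (rule has_derivative_const, simp)
  then show ?case using Suc by (simp add: C_k_Suc)
qed simp

lemma C_k_add: "C_k k f \<Longrightarrow> C_k k g \<Longrightarrow> C_k k (\<lambda>x. f x + g x)"
proof (induction k arbitrary: f g)
  case (Suc k)
  have "partial b (\<lambda>x. f x + g x) = (\<lambda>x. partial b f x + partial b g x)" for b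
    by (rule ext, subst partial_eqI)
      (rule has_derivative_add[OF C_k_differentiable[OF Suc.prems(1)] C_k_differentiable[OF Suc.prems(2)]],
       simp add: partial_def)
  then show ?case using Suc by (simp add: C_k_Suc differentiable_on_add)
qed (simp add: continuous_on_add)

lemma partial_mult:
  assumes "(f has_derivative frechet_derivative f (at x)) (at x)"
    and "(g has_derivative frechet_derivative g (at x)) (at x)"
  shows "partial b (\<lambda>x. f x * g x) x = f x * partial b g x + partial b f x * g x"
  by (subst partial_eqI[OF has_derivative_mult[OF assms]]) (simp add: partial_def)

lemma C_k_mult: "C_k k f \<Longrightarrow> C_k k g \<Longrightarrow> C_k k (\<lambda>x. f x * g x)"
proof (induction k arbitrary: f g)
  case (Suc k)
  have "partial b (\<lambda>x. f x * g x) = (\<lambda>x. f x * partial b g x + partial b f x * g x)" for b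
    by (intro ext partial_mult C_k_differentiable[OF Suc.prems(1)] C_k_differentiable[OF Suc.prems(2)])
  moreover have "C_k k (\<lambda>x. f x * partial b g x + partial b f x * g x)" if "b \<in> Basis" for b
    by (intro C_k_add Suc.IH C_k_mono_Suc[OF Suc.prems(1)] C_k_mono_Suc[OF Suc.prems(2)]
        C_k_partial[OF Suc.prems(1) that] C_k_partial[OF Suc.prems(2) that])
  ultimately show ?case using Suc.prems by (simp add: C_k_Suc differentiable_on_mult)
qed (simp add: continuous_on_mult)

lemma partial_compose:
  assumes "(f has_real_derivative d) (at (g x))"
    and "(g has_derivative frechet_derivative g (at x)) (at x)"
  shows "partial b (\<lambda>x. f (g x)) x = d * partial b g x"
  by (subst partial_eqI[OF has_derivative_compose[OF assms(2) assms(1)[unfolded has_field_derivative_def]]])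
    (simp add: partial_def)

text \<open>The chain rule produces the derivative of the outer function, to which the induction
  hypothesis must apply again. Hence the outer function ranges over a family closed under
  differentiation.\<close>

lemma C_k_compose:
  assumes F: "\<And>f. f \<in> F \<Longrightarrow> \<exists>f'\<in>F. \<forall>t. (f has_real_derivative f' t) (at t)"
  shows "C_k k g \<Longrightarrow> f \<in> F \<Longrightarrow> C_k k (\<lambda>x. f (g x))"
proof (induction k arbitrary: f)
  case 0
  obtain f' where "\<forall>t. (f has_real_derivative f' t) (at t)" using F[OF 0(2)] by blast
  then have "continuous_on UNIV f"
    by (meson DERIV_isCont continuous_at_imp_continuous_on)
  with 0 show ?case using continuous_on_compose2[of UNIV f UNIV g] by simp
next
  case (Suc k)
  obtain f' where f': "f' \<in> F" "\<And>t. (f has_real_derivative f' t) (at t)" using F[OF Suc.prems(2)] by blast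
  have "partial b (\<lambda>x. f (g x)) = (\<lambda>x. f' (g x) * partial b g x)" for b
    by (rule ext, rule partial_compose[OF f'(2) C_k_differentiable[OF Suc.prems(1)]])
  moreover have "C_k k (\<lambda>x. f' (g x) * partial b g x)" if "b \<in> Basis" for b
    by (rule C_k_mult[OF Suc.IH[OF C_k_mono_Suc[OF Suc.prems(1)] f'(1)] C_k_partial[OF Suc.prems(1) that]])
  moreover have "(\<lambda>x. f (g x)) differentiable_on UNIV"
    unfolding differentiable_on_def
    using has_derivative_compose[OF C_k_differentiable[OF Suc.prems(1)] f'(2)[unfolded has_field_derivative_def]]
    by (blast intro: differentiableI)
  ultimately show ?case by (simp add: C_k_Suc)
qed

lemma smooth_const: "smooth (\<lambda>x. c)"
  by (simp add: smooth_def C_k_const)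

lemma smooth_add: "smooth f \<Longrightarrow> smooth g \<Longrightarrow> smooth (\<lambda>x. f x + g x)"
  by (simp add: smooth_def C_k_add)

lemma smooth_mult: "smooth f \<Longrightarrow> smooth g \<Longrightarrow> smooth (\<lambda>x. f x * g x)"
  by (simp add: smooth_def C_k_mult)

lemma smooth_diff: "smooth f \<Longrightarrow> smooth g \<Longrightarrow> smooth (\<lambda>x. f x - g x)"
  using smooth_add[of f "\<lambda>x. (-1) * g x"] smooth_mult[OF smooth_const[of "-1"], of g] by simp

lemma smooth_sum: "(\<And>i. i \<in> I \<Longrightarrow> smooth (f i)) \<Longrightarrow> smooth (\<lambda>x. \<Sum>i\<in>I. f i x)"
  by (induction I rule: infinite_finite_induct) (auto intro: smooth_const smooth_add)

lemma smooth_compose: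
  assumes "\<And>f. f \<in> F \<Longrightarrow> \<exists>f'\<in>F. \<forall>t. (f has_real_derivative f' t) (at t)" "smooth g" "f \<in> F"
  shows "smooth (\<lambda>x. f (g x))"
  using assms C_k_compose[of F] unfolding smooth_def by blast

lemma smooth_inner: "smooth (\<lambda>x. x \<bullet> c)"
proof -
  have d: "((\<lambda>x. x \<bullet> c) has_derivative (\<lambda>h. h \<bullet> c)) (at x)" for x :: 'a
    by (rule bounded_linear_imp_has_derivative) (rule bounded_linear_inner_left)
  have "partial b (\<lambda>x. x \<bullet> c) = (\<lambda>x. b \<bullet> c)" for b
    by (rule ext, rule partial_eqI[OF d])
  then have "C_k (Suc k) (\<lambda>x. x \<bullet> c)" for k
    using d by (auto simp: C_k_Suc C_k_const differentiable_on_def differentiable_def)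
  then show ?thesis unfolding smooth_def using C_k_mono_Suc by blast
qed

lemma smooth_norm2: "smooth (\<lambda>x. (norm (x - a))\<^sup>2)"
proof -
  have "(norm (x - a))\<^sup>2 = (\<Sum>b\<in>Basis. (x \<bullet> b - a \<bullet> b) * (x \<bullet> b - a \<bullet> b))" for x
    unfolding power2_norm_eq_inner
    by (subst euclidean_inner) (simp add: inner_diff_left)
  then show ?thesis
    by (simp only:) (intro smooth_sum smooth_mult smooth_diff smooth_inner smooth_const)
qed

lemma smooth_exp: "smooth g \<Longrightarrow> smooth (\<lambda>x. exp (g x))"
  by (rule smooth_compose[of "{exp}"]) (auto intro: DERIV_exp)

text \<open>The functions \<open>p (1/t) exp (-1/t)\<close> form a family that is closed under differentiation.\<close>

definition bump_poly :: "real poly \<Rightarrow> real \<Rightarrow> real" where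
  "bump_poly p t = (if t > 0 then poly p (1 / t) * exp (- (1 / t)) else 0)"

lemma bump_poly_tendsto_0: "(bump_poly p \<longlongrightarrow> 0) (at_right 0)"
proof -
  have 1: "((\<lambda>t. (1/t)^k * exp (- (1 / t))) \<longlongrightarrow> 0) (at_right (0::real))" for k :: nat
  proof -
    have "((\<lambda>x. x^k / exp x) \<longlongrightarrow> 0) (at_top :: real filter)" by (rule tendsto_power_div_exp_0)
    from filterlim_compose[OF this filterlim_inverse_at_top_right]
    show ?thesis by (simp add: exp_minus field_simps)
  qed
  have "((\<lambda>t. \<Sum>i\<le>degree p. coeff p i * ((1/t)^i * exp (- (1 / t)))) \<longlongrightarrow> (\<Sum>i\<le>degree p. coeff p i * 0)) (at_right (0::real))"
    by (intro tendsto_intros 1)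
  moreover have "\<forall>\<^sub>F t in at_right 0. (\<Sum>i\<le>degree p. coeff p i * ((1/t)^i * exp (- (1 / t)))) = bump_poly p t"
    unfolding eventually_at_right_field
    by (rule exI[of _ 1]) (auto simp: bump_poly_def poly_altdef sum_distrib_right mult.assoc)
  ultimately show ?thesis using Lim_transform_eventually by fastforce
qed

text \<open>For \<open>t > 0\<close> the derivative of \<open>p (1/t) exp (-1/t)\<close> is
  \<open>(1/t)^2 (p - p') (1/t) exp (-1/t)\<close>, which explains the polynomial. At 0 the
  exponential beats every power of \<open>1/t\<close>.\<close>

lemma bump_poly_DERIV:
  "(bump_poly p has_real_derivative bump_poly (monom 1 2 * (p - pderiv p)) t) (at t)"
proof -
  consider "t < 0" | "t > 0" | "t = 0" by linarith
  then show ?thesis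
  proof cases
    case 1
    have "((\<lambda>t. 0) has_real_derivative 0) (at t)" by simp
    then have "(bump_poly p has_real_derivative 0) (at t)"
      by (rule has_field_derivative_transform_within_open[of _ _ _ "{..<0}"]) (use 1 in \<open>auto simp: bump_poly_def\<close>)
    with 1 show ?thesis by (simp add: bump_poly_def)
  next
    case 2
    have "((\<lambda>t. poly p (1 / t) * exp (- (1 / t))) has_real_derivative
        poly (monom 1 2 * (p - pderiv p)) (1 / t) * exp (- (1 / t))) (at t)"
      by (rule derivative_eq_intros poly_DERIV[THEN DERIV_chain2] refl | use 2 in force)+
         (use 2 in \<open>simp add: poly_monom power2_eq_square field_simps\<close>)
    then have "(bump_poly p has_real_derivative poly (monom 1 2 * (p - pderiv p)) (1 / t) * exp (- (1 / t))) (at t)"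
      by (rule has_field_derivative_transform_within_open[of _ _ _ "{0<..}"]) (use 2 in \<open>auto simp: bump_poly_def\<close>)
    with 2 show ?thesis by (simp add: bump_poly_def)
  next
    case 3
    have "((\<lambda>h. (bump_poly p (0 + h) - bump_poly p 0) / h) \<longlongrightarrow> 0) (at 0)"
    proof (rule filterlim_split_at)
      have "\<forall>\<^sub>F h in at_left 0. 0 = (bump_poly p (0 + h) - bump_poly p 0) / h"
        unfolding eventually_at_left_field by (rule exI[of _ "-1"]) (auto simp: bump_poly_def)
      then show "((\<lambda>h. (bump_poly p (0 + h) - bump_poly p 0) / h) \<longlongrightarrow> 0) (at_left 0)"
        by (rule Lim_transform_eventually[OF tendsto_const])
      \<comment> \<open>Division by \<open>h\<close> multiplies a polynomial in \<open>1/h\<close>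
        by its variable, so the difference quotient is again of the form already known to tend to
        0.\<close>
      have "\<forall>\<^sub>F h in at_right 0. bump_poly (pCons 0 p) h = (bump_poly p (0 + h) - bump_poly p 0) / h"
        unfolding eventually_at_right_field by (rule exI[of _ "1"]) (auto simp: bump_poly_def)
      then show "((\<lambda>h. (bump_poly p (0 + h) - bump_poly p 0) / h) \<longlongrightarrow> 0) (at_right 0)"
        by (rule Lim_transform_eventually[OF bump_poly_tendsto_0])
    qed
    with 3 show ?thesis by (simp add: DERIV_def bump_poly_def)
  qed
qed

lemma smooth_bump_poly: "smooth g \<Longrightarrow> smooth (\<lambda>x. bump_poly p (g x))"
  by (rule smooth_compose[of "range bump_poly"]) (use bump_poly_DERIV in blast)+

text \<open>With \<open>S t = sqrt (t^2 + e^2)\<close>, the functions \<open>p(t) / S(t)^k\<close>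
  are closed under differentiation because \<open>S' = t / S\<close>, and \<open>S\<close> itself is
  \<open>(t^2 + e^2) / S\<close>. The result supplies a smooth substitute for the absolute
  value.\<close>

lemma smooth_sqrt:
  assumes "smooth g" "e > 0"
  shows "smooth (\<lambda>x. sqrt ((g x)\<^sup>2 + e\<^sup>2))"
proof -
  define S where "S t = sqrt (t\<^sup>2 + e\<^sup>2)" for t
  have pos: "t\<^sup>2 + e\<^sup>2 > 0" for t
    using assms(2) by (simp add: add_nonneg_pos)
  then have S: "S t > 0" "S t * S t = t\<^sup>2 + e\<^sup>2" for t
    by (simp_all add: S_def pos less_imp_le)
  have dS: "(S has_real_derivative t * inverse (S t)) (at t)" for t
    unfolding S_def[abs_def] using pos[of t]
    by (auto intro!: derivative_eq_intros simp: field_simps)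
  define F where "F = (\<lambda>(p, k::nat) t. poly p t * inverse (S t) ^ k)"
  have dF: "((\<lambda>t. poly p t * inverse (S t) ^ k) has_real_derivative
      poly (pderiv p * [:e\<^sup>2, 0, 1:] - smult (of_nat k) (p * [:0, 1:])) t * inverse (S t) ^ (k + 2)) (at t)" for p k t
  proof -
    define I where "I = inverse (S t)"
    have "((\<lambda>t. poly p t * inverse (S t) ^ k) has_real_derivative
      poly (pderiv p) t * I ^ k + poly p t * (of_nat k * I ^ (k - 1) * (- (I * (t * I) * I)))) (at t)"
      unfolding I_def by (rule derivative_eq_intros dS refl | use S(1)[of t] in force)+
    moreover have "poly (pderiv p) t * I ^ k + poly p t * (of_nat k * I ^ (k - 1) * (- (I * (t * I) * I)))
       = poly (pderiv p * [:e\<^sup>2, 0, 1:] - smult (of_nat k) (p * [:0, 1:])) t * I ^ (k + 2)"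
    proof -
      have 1: "(t\<^sup>2 + e\<^sup>2) * I ^ (k + 2) = I ^ k"
        using S(1)[of t] unfolding S(2)[symmetric] by (simp add: I_def field_simps)
      have 2: "of_nat k * I ^ (k - 1) * (- (I * (t * I) * I)) = - (of_nat k * t * I ^ (k + 2))"
        by (cases k) (simp_all add: algebra_simps)
      have "poly (pderiv p * [:e\<^sup>2, 0, 1:] - smult (of_nat k) (p * [:0, 1:])) t * I ^ (k + 2)
        = poly (pderiv p) t * ((t\<^sup>2 + e\<^sup>2) * I ^ (k + 2)) - of_nat k * t * poly p t * I ^ (k + 2)"
        by (simp add: algebra_simps power2_eq_square)
      then show ?thesis unfolding 1 2 by (simp add: algebra_simps)
    qed
    ultimately show ?thesis unfolding I_def by (rule DERIV_cong)
  qed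
  have "smooth (\<lambda>x. F ([:e\<^sup>2, 0, 1:], 1) (g x))"
  proof (rule smooth_compose[of "range F", OF _ assms(1) rangeI])
    fix f assume "f \<in> range F"
    then obtain p k where f: "f = F (p, k)" by auto
    have "(f has_real_derivative F (pderiv p * [:e\<^sup>2, 0, 1:] - smult (of_nat k) (p * [:0, 1:]), k + 2) t) (at t)" for t
      unfolding f F_def prod.case by (rule dF)
    then show "\<exists>f'\<in>range F. \<forall>t. (f has_real_derivative f' t) (at t)" by blast
  qed
  moreover have "F ([:e\<^sup>2, 0, 1:], 1) t = S t" for t
    using S[of t] by (simp add: F_def field_simps power2_eq_square)
  ultimately show ?thesis by (simp add: S_def)
qed

section \<open>Test functions and integration by parts\<close>

lemma test_functionD:
  assumes "test_function \<Omega> \<phi>"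
  shows "smooth \<phi>" "compact (closure {x. \<phi> x \<noteq> 0})" "closure {x. \<phi> x \<noteq> 0} \<subseteq> \<Omega>"
    "x \<notin> \<Omega> \<Longrightarrow> \<phi> x = 0"
proof -
  show 1: "smooth \<phi>" "compact (closure {x. \<phi> x \<noteq> 0})" "closure {x. \<phi> x \<noteq> 0} \<subseteq> \<Omega>"
    using assms by (auto simp: test_function_def smooth_def)
  show "x \<notin> \<Omega> \<Longrightarrow> \<phi> x = 0"
    using 1(3) closure_subset[of "{x. \<phi> x \<noteq> 0}"] by auto
qed

lemma test_functionI:
  assumes "smooth \<phi>" "compact K" "K \<subseteq> \<Omega>" "\<And>x. x \<notin> K \<Longrightarrow> \<phi> x = 0"
  shows "test_function \<Omega> \<phi>"
proof -
  have "closure {x. \<phi> x \<noteq> 0} \<subseteq> K"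
    by (rule closure_minimal) (use assms compact_imp_closed in auto)
  then show ?thesis
    using assms closed_Int_compact[of "closure {x. \<phi> x \<noteq> 0}" K] unfolding test_function_def smooth_def
    by (metis closed_closure inf.absorb1 order_trans)
qed

lemma partial_zero_outside:
  assumes "x \<notin> closure {x. \<phi> x \<noteq> 0}"
  shows "partial b \<phi> x = 0"
proof -
  have "((\<lambda>x. 0) has_derivative (\<lambda>x. 0)) (at x)" by simp
  then have "(\<phi> has_derivative (\<lambda>x. 0)) (at x)"
  proof (rule has_derivative_transform_within_open)
    show "open (- closure {x. \<phi> x \<noteq> 0})" "x \<in> - closure {x. \<phi> x \<noteq> 0}" using assms by auto
    show "0 = \<phi> y" if "y \<in> - closure {x. \<phi> x \<noteq> 0}" for y
      using that closure_subset[of "{x. \<phi> x \<noteq> 0}"] by auto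
  qed
  then show ?thesis by (rule partial_eqI)
qed

lemma zero_outside_support: "x \<notin> closure {x. \<phi> x \<noteq> 0} \<Longrightarrow> \<phi> x = 0"
  using closure_subset[of "{x. \<phi> x \<noteq> 0}"] by auto

lemma test_function_partial: "test_function \<Omega> \<phi> \<Longrightarrow> b \<in> Basis \<Longrightarrow> test_function \<Omega> (partial b \<phi>)"
  by (rule test_functionI[OF smoothD(2)[OF test_functionD(1)] test_functionD(2) test_functionD(3)
        partial_zero_outside])

lemma test_function_mult:
  assumes "test_function \<Omega> \<phi>" "smooth \<psi>"
  shows "test_function \<Omega> (\<lambda>x. \<psi> x * \<phi> x)"
  by (rule test_functionI[of _ "closure {x. \<phi> x \<noteq> 0}"])
    (use assms test_functionD[OF assms(1)] closure_subset[of "{x. \<phi> x \<noteq> 0}"] in \<open>auto intro: smooth_mult\<close>)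

lemma test_function_scale: "test_function \<Omega> \<phi> \<Longrightarrow> test_function \<Omega> (\<lambda>x. c * \<phi> x)"
  by (rule test_function_mult[OF _ smooth_const])

lemma test_function_add:
  assumes "test_function \<Omega> \<phi>" "test_function \<Omega> \<psi>"
  shows "test_function \<Omega> (\<lambda>x. \<phi> x + \<psi> x)"
proof (rule test_functionI[of _ "closure {x. \<phi> x \<noteq> 0} \<union> closure {x. \<psi> x \<noteq> 0}"])
  show "smooth (\<lambda>x. \<phi> x + \<psi> x)"
    by (rule smooth_add) (rule test_functionD(1), fact)+
  show "compact (closure {x. \<phi> x \<noteq> 0} \<union> closure {x. \<psi> x \<noteq> 0})"
    by (rule compact_Un) (rule test_functionD(2), fact)+
  show "closure {x. \<phi> x \<noteq> 0} \<union> closure {x. \<psi> x \<noteq> 0} \<subseteq> \<Omega>"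
    by (rule Un_least) (rule test_functionD(3), fact)+
  show "\<phi> x + \<psi> x = 0" if "x \<notin> closure {x. \<phi> x \<noteq> 0} \<union> closure {x. \<psi> x \<noteq> 0}" for x
    using that zero_outside_support[of x \<phi>] zero_outside_support[of x \<psi>] by simp
qed

lemma test_function_diff:
  assumes "test_function \<Omega> \<phi>" "test_function \<Omega> \<psi>"
  shows "test_function \<Omega> (\<lambda>x. \<phi> x - \<psi> x)"
  using test_function_add[OF assms(1) test_function_scale[OF assms(2), of "-1"]] by simp

lemma test_function_0: "test_function \<Omega> (\<lambda>x. 0)"
  by (rule test_functionI[of _ "{}"]) (auto intro: smooth_const)

lemma test_function_sum:
  "(\<And>i. i \<in> I \<Longrightarrow> test_function \<Omega> (f i)) \<Longrightarrow> test_function \<Omega> (\<lambda>x. \<Sum>i\<in>I. f i x)"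
  by (induction I rule: infinite_finite_induct) (auto intro: test_function_0 test_function_add)

lemma test_function_bounded:
  assumes "test_function \<Omega> \<phi>"
  obtains B where "B > 0" "\<And>x. \<bar>\<phi> x\<bar> \<le> B"
proof -
  let ?K = "closure {x. \<phi> x \<noteq> 0}"
  have "compact (\<phi> ` ?K)"
    by (rule compact_continuous_image)
      (rule test_functionD(2)[OF assms] continuous_on_subset[OF smooth_imp_continuous[OF test_functionD(1)[OF assms]] subset_UNIV])+
  from compact_imp_bounded[OF this] obtain B where B: "B > 0" "\<And>y. y \<in> \<phi> ` ?K \<Longrightarrow> norm y \<le> B"
    unfolding bounded_pos by blast
  have "\<bar>\<phi> x\<bar> \<le> B" for x
    using B zero_outside_support[of x \<phi>] by (cases "x \<in> ?K") auto
  with B show ?thesis using that by blast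
qed

lemma test_function_measurable: "test_function \<Omega> \<phi> \<Longrightarrow> \<phi> \<in> borel_measurable borel"
  by (rule borel_measurable_continuous_onI[OF smooth_imp_continuous[OF test_functionD(1)]])

lemma test_function_integrable:
  assumes "test_function \<Omega> \<phi>"
  shows "integrable lborel \<phi>"
proof -
  let ?K = "closure {x. \<phi> x \<noteq> 0}"
  have "integrable lborel (\<lambda>x. indicator ?K x *\<^sub>R \<phi> x)"
    by (rule borel_integrable_compact)
      (rule test_functionD(2)[OF assms] continuous_on_subset[OF smooth_imp_continuous[OF test_functionD(1)[OF assms]] subset_UNIV])+
  moreover have "(\<lambda>x. indicator ?K x *\<^sub>R \<phi> x) = \<phi>"
  proof
    fix x show "indicator ?K x *\<^sub>R \<phi> x = \<phi> x"
      by (cases "x \<in> ?K") (use zero_outside_support[of x \<phi>] in simp_all)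
  qed
  ultimately show ?thesis by (simp only:)
qed

lemma smooth_line_deriv:
  assumes "smooth \<phi>"
  shows "((\<lambda>t. \<phi> (x + t *\<^sub>R b)) has_real_derivative partial b \<phi> (x + t *\<^sub>R b)) (at t)"
proof -
  have "((\<lambda>t. \<phi> (x + t *\<^sub>R b)) has_derivative (\<lambda>h. frechet_derivative \<phi> (at (x + t *\<^sub>R b)) (h *\<^sub>R b))) (at t)"
    by (rule has_derivative_compose[OF _ smooth_imp_has_derivative[OF assms]]) (auto intro!: derivative_eq_intros)
  moreover have "(\<lambda>h. frechet_derivative \<phi> (at (x + t *\<^sub>R b)) (h *\<^sub>R b)) = (*) (partial b \<phi> (x + t *\<^sub>R b))"
    using linear_cmul[OF has_derivative_linear[OF smooth_imp_has_derivative[OF assms]]]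
    by (simp add: partial_def fun_eq_iff)
  ultimately show ?thesis by (simp add: has_field_derivative_def)
qed

text \<open>Translation invariance makes the integral of every difference quotient vanish, and
  dominated convergence carries this over to the derivative.\<close>

lemma integral_partial_test_function:
  assumes "test_function \<Omega> \<phi>" and b: "b \<in> Basis"
  shows "(LINT x|lborel. partial b \<phi> x) = 0"
proof -
  let ?K = "closure {x. \<phi> x \<noteq> 0}"
  obtain B where B: "B > 0" "\<And>x. \<bar>partial b \<phi> x\<bar> \<le> B"
    using test_function_bounded[OF test_function_partial[OF assms]] by blast
  obtain R where R: "\<And>x. x \<in> ?K \<Longrightarrow> norm x \<le> R"
    using compact_imp_bounded[OF test_functionD(2)[OF assms(1)]] by (auto simp: bounded_iff)
  define q where "q n x = (\<phi> (x + (1 / Suc n) *\<^sub>R b) - \<phi> x) * Suc n" for n x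
  have meas: "\<phi> \<in> borel_measurable borel" using test_function_measurable[OF assms(1)] .
  have int: "integrable lborel (\<lambda>x. \<phi> (x + c))" "(LINT x|lborel. \<phi> (x + c)) = (LINT x|lborel. \<phi> x)" for c
  proof -
    have *: "integrable (distr lborel borel ((+) c)) \<phi>" "(LINT x|distr lborel borel ((+) c). \<phi> x) = (LINT x|lborel. \<phi> x)"
      using test_function_integrable[OF assms(1)] by (simp_all add: lborel_distr_plus)
    from * show "integrable lborel (\<lambda>x. \<phi> (x + c))" "(LINT x|lborel. \<phi> (x + c)) = (LINT x|lborel. \<phi> x)"
      using meas by (simp_all add: integrable_distr_eq integral_distr add.commute)
  qed
  have "(\<lambda>n. LINT x|lborel. q n x) \<longlonglongrightarrow> (LINT x|lborel. partial b \<phi> x)"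
  proof (rule integral_dominated_convergence)
    show "partial b \<phi> \<in> borel_measurable lborel" "q n \<in> borel_measurable lborel" for n
      using test_function_measurable[OF test_function_partial[OF assms]] meas unfolding q_def by measurable
    \<comment> \<open>The increments are at most 1, so every difference quotient vanishes outside
      the ball of radius \<open>R + 1\<close>; inside it the mean value theorem bounds it by
      \<open>B\<close>.\<close>
    show "integrable lborel (\<lambda>x. indicator (cball 0 (R + 1)) x * B)"
      by (intro integrable_mult_left impI integrable_real_indicator) (use emeasure_bounded_finite[OF bounded_cball] in auto)
    show "AE x in lborel. (\<lambda>n. q n x) \<longlonglongrightarrow> partial b \<phi> x"
    proof (rule AE_I2)
      fix x
      have "((\<lambda>h. (\<phi> (x + (0 + h) *\<^sub>R b) - \<phi> (x + 0 *\<^sub>R b)) / h) \<longlongrightarrow> partial b \<phi> (x + 0 *\<^sub>R b)) (at 0)"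
        using smooth_line_deriv[OF test_functionD(1)[OF assms(1)], of x b 0] unfolding DERIV_def .
      then have "(\<lambda>n. (\<phi> (x + (0 + 1 / real (Suc n)) *\<^sub>R b) - \<phi> (x + 0 *\<^sub>R b)) / (1 / real (Suc n))) \<longlonglongrightarrow> partial b \<phi> (x + 0 *\<^sub>R b)"
        by (rule filterlim_compose) (use LIMSEQ_Suc[OF lim_1_over_n] in \<open>simp add: filterlim_at\<close>)
      then show "(\<lambda>n. q n x) \<longlonglongrightarrow> partial b \<phi> x" by (simp add: q_def)
    qed
    show "AE x in lborel. norm (q n x) \<le> indicator (cball 0 (R + 1)) x * B" for n
    proof (rule AE_I2)
      fix x
      define h where "h = 1 / real (Suc n)"
      have h: "h > 0" "h \<le> 1" "q n x = (\<phi> (x + h *\<^sub>R b) - \<phi> x) / h" by (simp_all add: h_def q_def)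
      show "norm (q n x) \<le> indicator (cball 0 (R + 1)) x * B"
      proof (cases "norm x \<le> R + 1")
        case True
        have "\<exists>z. 0 < z \<and> z < h \<and> \<phi> (x + h *\<^sub>R b) - \<phi> (x + 0 *\<^sub>R b) = (h - 0) * partial b \<phi> (x + z *\<^sub>R b)"
          by (rule MVT2[of 0 h "\<lambda>t. \<phi> (x + t *\<^sub>R b)" "\<lambda>t. partial b \<phi> (x + t *\<^sub>R b)",
            OF h(1) smooth_line_deriv[OF test_functionD(1)[OF assms(1)]]])
        then obtain z where "\<phi> (x + h *\<^sub>R b) - \<phi> (x + 0 *\<^sub>R b) = (h - 0) * partial b \<phi> (x + z *\<^sub>R b)" by blast
        then have "q n x = partial b \<phi> (x + z *\<^sub>R b)" using h by simp
        with True B(2) show ?thesis by simp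
      next
        case False
        have "norm x \<le> norm (x + h *\<^sub>R b) + norm (h *\<^sub>R b)"
          by (metis add_diff_cancel_right' norm_triangle_ineq4)
        moreover have "norm (h *\<^sub>R b) \<le> 1" using b h by simp
        ultimately have 1: "norm (x + h *\<^sub>R b) > R" "norm x > R" using False by linarith+
        then have "\<phi> (x + h *\<^sub>R b) = 0" "\<phi> x = 0"
          using R zero_outside_support[of _ \<phi>] by (meson not_le)+
        then show ?thesis using B by (simp add: h)
      qed
    qed
  qed
  moreover have "(LINT x|lborel. q n x) = 0" for n
    using int[of "(1 / Suc n) *\<^sub>R b"] test_function_integrable[OF assms(1)] by (simp add: q_def)
  ultimately show ?thesis by (simp add: LIMSEQ_const_iff)
qed

lemma smooth_partial_mult:
  "smooth f \<Longrightarrow> smooth g \<Longrightarrow> partial b (\<lambda>x. f x * g x) x = f x * partial b g x + partial b f x * g x"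
  by (rule partial_mult[OF smooth_imp_has_derivative smooth_imp_has_derivative])

lemma integral_by_parts_test_function:
  assumes "test_function \<Omega> \<phi>" "smooth \<psi>" "b \<in> Basis"
  shows "(LINT x|lborel. \<psi> x * partial b \<phi> x) = - (LINT x|lborel. partial b \<psi> x * \<phi> x)"
proof -
  note s = test_functionD(1)[OF assms(1)]
  have "integrable lborel (\<lambda>x. \<psi> x * partial b \<phi> x)" "integrable lborel (\<lambda>x. partial b \<psi> x * \<phi> x)"
    using test_function_integrable[OF test_function_mult[OF test_function_partial[OF assms(1,3)] assms(2)]]
      test_function_integrable[OF test_function_mult[OF assms(1) smoothD(2)[OF assms(2,3)]]] by simp_all
  moreover have "(LINT x|lborel. \<psi> x * partial b \<phi> x + partial b \<psi> x * \<phi> x) = 0"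
    using integral_partial_test_function[OF test_function_mult[OF assms(1,2)] assms(3)]
    unfolding smooth_partial_mult[OF assms(2) s] .
  ultimately show ?thesis by simp
qed

section \<open>Rules for the classical gradient\<close>

lemma partial_add: "smooth f \<Longrightarrow> smooth g \<Longrightarrow> partial b (\<lambda>x. f x + g x) x = partial b f x + partial b g x"
  by (subst partial_eqI[OF has_derivative_add[OF smooth_imp_has_derivative smooth_imp_has_derivative]])
    (simp_all add: partial_def)

lemma partial_const: "partial b (\<lambda>x. c) x = 0"
  by (rule partial_eqI[OF has_derivative_const])

lemma partial_scale: "smooth f \<Longrightarrow> partial b (\<lambda>x. c * f x) x = c * partial b f x"
  by (simp only: smooth_partial_mult[OF smooth_const] partial_const mult_zero_left add_0_right)

lemma grad_add: "smooth f \<Longrightarrow> smooth g \<Longrightarrow> grad (\<lambda>x. f x + g x) x = grad f x + grad g x"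
  by (simp add: grad_def partial_add scaleR_add_left sum.distrib)

lemma grad_scale: "smooth f \<Longrightarrow> grad (\<lambda>x. c * f x) x = c *\<^sub>R grad f x"
  by (simp add: grad_def partial_scale scaleR_sum_right)

lemma grad_diff: "smooth f \<Longrightarrow> smooth g \<Longrightarrow> grad (\<lambda>x. f x - g x) x = grad f x - grad g x"
  using grad_add[OF _ smooth_mult[OF smooth_const[of "-1"]], of f g x] grad_scale[of g "-1" x] by simp

lemma grad_inner: "b \<in> Basis \<Longrightarrow> grad f x \<bullet> b = partial b f x"
  by (simp add: grad_def)

lemma grad_inner_sum: "grad f x \<bullet> v = (\<Sum>b\<in>Basis. partial b f x * (v \<bullet> b))"
  by (simp add: grad_def inner_sum_left inner_commute[of v])

lemma norm_grad: "(norm (grad f x))\<^sup>2 = (\<Sum>b\<in>Basis. (partial b f x)\<^sup>2)"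
  unfolding power2_norm_eq_inner by (subst euclidean_inner) (simp add: grad_inner power2_eq_square)

section \<open>Square integrable functions\<close>

text \<open>The measure is a parameter because the same facts serve for
  \<open>lebesgue_on \<Omega>\<close> and for Lebesgue measure on an interval.\<close>

definition L2 :: "'a measure \<Rightarrow> ('a \<Rightarrow> 'b::euclidean_space) \<Rightarrow> bool" where
  "L2 M f \<longleftrightarrow> f \<in> borel_measurable M \<and> integrable M (\<lambda>x. (norm (f x))\<^sup>2)"

definition L2norm :: "'a measure \<Rightarrow> ('a \<Rightarrow> 'b::euclidean_space) \<Rightarrow> real" where
  "L2norm M f = sqrt (LINT x|M. (norm (f x))\<^sup>2)"

lemma L2D: "L2 M f \<Longrightarrow> f \<in> borel_measurable M" "L2 M f \<Longrightarrow> integrable M (\<lambda>x. (norm (f x))\<^sup>2)"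
  by (simp_all add: L2_def)

lemma L2norm_nonneg: "L2norm M f \<ge> 0"
  by (simp add: L2norm_def)

lemma L2norm_power2: "(L2norm M f)\<^sup>2 = (LINT x|M. (norm (f x))\<^sup>2)"
  by (simp add: L2norm_def)

lemma L2_integrable_inner:
  assumes "L2 M f" "L2 M g"
  shows "integrable M (\<lambda>x. f x \<bullet> g x)"
proof (rule Bochner_Integration.integrable_bound)
  show "integrable M (\<lambda>x. (norm (f x))\<^sup>2 + (norm (g x))\<^sup>2)" using assms by (simp add: L2_def)
  show "(\<lambda>x. f x \<bullet> g x) \<in> borel_measurable M"
    using L2D(1)[OF assms(1)] L2D(1)[OF assms(2)] by measurable
  have "\<bar>f x \<bullet> g x\<bar> \<le> (norm (f x))\<^sup>2 + (norm (g x))\<^sup>2" for x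
  proof -
    have "\<bar>f x \<bullet> g x\<bar> \<le> norm (f x) * norm (g x)" by (rule Cauchy_Schwarz_ineq2)
    also have "\<dots> \<le> (norm (f x))\<^sup>2 + (norm (g x))\<^sup>2"
      using sum_squares_bound[of "norm (f x)" "norm (g x)"] mult_nonneg_nonneg[of "norm (f x)" "norm (g x)"]
      by (simp del: mult_nonneg_nonneg)
    finally show ?thesis .
  qed
  then show "AE x in M. norm (f x \<bullet> g x) \<le> norm ((norm (f x))\<^sup>2 + (norm (g x))\<^sup>2)" by simp
qed

lemma L2_add:
  assumes "L2 M f" "L2 M g"
  shows "L2 M (\<lambda>x. f x + g x)"
  unfolding L2_def
proof
  show "(\<lambda>x. f x + g x) \<in> borel_measurable M"
    using L2D(1)[OF assms(1)] L2D(1)[OF assms(2)] by measurable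
  have "(norm (f x + g x))\<^sup>2 = (norm (f x))\<^sup>2 + 2 * (f x \<bullet> g x) + (norm (g x))\<^sup>2" for x
    by (simp add: power2_norm_eq_inner inner_add_left inner_add_right inner_commute)
  then show "integrable M (\<lambda>x. (norm (f x + g x))\<^sup>2)"
    using assms L2_integrable_inner[OF assms] by (simp add: L2_def)
qed

lemma L2_scaleR: "L2 M f \<Longrightarrow> L2 M (\<lambda>x. c *\<^sub>R f x)"
  by (auto simp: L2_def power_mult_distrib intro: borel_measurable_scaleR)

lemma L2_diff: "L2 M f \<Longrightarrow> L2 M g \<Longrightarrow> L2 M (\<lambda>x. f x - g x)"
  using L2_add[OF _ L2_scaleR[of M g "-1"], of f] by simp

lemma L2_0: "L2 M (\<lambda>x. 0)"
  by (simp add: L2_def)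

lemma L2_bounded_mult:
  fixes h :: "'a \<Rightarrow> real"
  assumes "L2 M f" "h \<in> borel_measurable M" "\<And>x. \<bar>h x\<bar> \<le> B"
  shows "L2 M (\<lambda>x. h x *\<^sub>R f x)"
  unfolding L2_def
proof
  show 1: "(\<lambda>x. h x *\<^sub>R f x) \<in> borel_measurable M" using L2D(1)[OF assms(1)] assms(2) by measurable
  show "integrable M (\<lambda>x. (norm (h x *\<^sub>R f x))\<^sup>2)"
  proof (rule Bochner_Integration.integrable_bound)
    show "integrable M (\<lambda>x. B\<^sup>2 * (norm (f x))\<^sup>2)" using assms(1) by (simp add: L2_def)
    show "(\<lambda>x. (norm (h x *\<^sub>R f x))\<^sup>2) \<in> borel_measurable M" using 1 by measurable
    have "(h x)\<^sup>2 \<le> B\<^sup>2" for x using power_mono[OF assms(3)[of x] abs_ge_zero, of 2] by simp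
    then show "AE x in M. norm ((norm (h x *\<^sub>R f x))\<^sup>2) \<le> norm (B\<^sup>2 * (norm (f x))\<^sup>2)"
      by (intro AE_I2) (simp add: power_mult_distrib mult_right_mono)
  qed
qed

lemma L2_Cauchy_Schwarz:
  assumes "L2 M f" "L2 M g"
  shows "\<bar>LINT x|M. f x \<bullet> g x\<bar> \<le> L2norm M f * L2norm M g"
proof -
  define A B C where "A = (LINT x|M. (norm (f x))\<^sup>2)" and "B = (LINT x|M. f x \<bullet> g x)"
    and "C = (LINT x|M. (norm (g x))\<^sup>2)"
  have q: "0 \<le> A + 2 * t * B + t\<^sup>2 * C" for t
  proof -
    have "(norm (f x + t *\<^sub>R g x))\<^sup>2 = (norm (f x))\<^sup>2 + (2 * t) * (f x \<bullet> g x) + t\<^sup>2 * (norm (g x))\<^sup>2" for x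
      unfolding power2_norm_eq_inner
      by (simp add: inner_add_left inner_add_right inner_commute power2_eq_square[of t])
    then have "(LINT x|M. (norm (f x + t *\<^sub>R g x))\<^sup>2) = A + 2 * t * B + t\<^sup>2 * C"
      using assms L2_integrable_inner[OF assms] by (simp add: L2_def A_def B_def C_def)
    moreover have "0 \<le> (LINT x|M. (norm (f x + t *\<^sub>R g x))\<^sup>2)" by (rule integral_nonneg_AE) simp
    ultimately show ?thesis by simp
  qed
  have AC: "A \<ge> 0" "C \<ge> 0" by (auto simp: A_def C_def)
  have "B\<^sup>2 \<le> A * C"
  proof (cases "C = 0")
    case True
    have "B = 0"
    proof (rule ccontr)
      assume "B \<noteq> 0"
      \<comment> \<open>For \<open>C = 0\<close> the quadratic is affine in \<open>t\<close>, and
        here it takes the value -1.\<close>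
      then show False using q[of "- (A + 1) / (2 * B)"] True by (simp add: field_simps)
    qed
    then show ?thesis using AC by simp
  next
    case False
    with AC have "C > 0" by simp
    \<comment> \<open>This \<open>t\<close> minimises the quadratic.\<close>
    with q[of "- B / C"] show ?thesis by (simp add: field_simps power2_eq_square)
  qed
  then have "sqrt (B\<^sup>2) \<le> sqrt (A * C)" by (rule real_sqrt_le_mono)
  then show ?thesis by (simp add: L2norm_def A_def B_def C_def real_sqrt_mult)
qed

lemma L2norm_triangle:
  assumes "L2 M f" "L2 M g"
  shows "L2norm M (\<lambda>x. f x + g x) \<le> L2norm M f + L2norm M g"
proof -
  have "(norm (f x + g x))\<^sup>2 = (norm (f x))\<^sup>2 + 2 * (f x \<bullet> g x) + (norm (g x))\<^sup>2" for x
    by (simp add: power2_norm_eq_inner inner_add_left inner_add_right inner_commute)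
  then have "(L2norm M (\<lambda>x. f x + g x))\<^sup>2 = (L2norm M f)\<^sup>2 + 2 * (LINT x|M. f x \<bullet> g x) + (L2norm M g)\<^sup>2"
    unfolding L2norm_power2 using assms L2_integrable_inner[OF assms] by (simp add: L2_def)
  also have "\<dots> \<le> (L2norm M f + L2norm M g)\<^sup>2"
    using L2_Cauchy_Schwarz[OF assms] by (simp add: power2_sum)
  finally show ?thesis using L2norm_nonneg by (meson add_nonneg_nonneg power2_le_imp_le)
qed

lemma L2norm_minus_commute: "L2norm M (\<lambda>x. f x - g x) = L2norm M (\<lambda>x. g x - f x)"
  by (simp add: L2norm_def norm_minus_commute)

lemma L2norm_triangle_diff:
  assumes "L2 M f" "L2 M g" "L2 M h"
  shows "L2norm M (\<lambda>x. f x - h x) \<le> L2norm M (\<lambda>x. f x - g x) + L2norm M (\<lambda>x. g x - h x)"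
  using L2norm_triangle[OF L2_diff[OF assms(1,2)] L2_diff[OF assms(2,3)]] by simp

lemma L2norm_diff_le:
  assumes "L2 M f" "L2 M g"
  shows "\<bar>L2norm M f - L2norm M g\<bar> \<le> L2norm M (\<lambda>x. f x - g x)"
  using L2norm_triangle_diff[OF assms L2_0] L2norm_triangle_diff[OF assms(2,1) L2_0]
    L2norm_minus_commute[of M f g] by simp

lemma L2_tendsto_norm:
  assumes "\<And>n. L2 M (f n)" "L2 M f0" "(\<lambda>n. L2norm M (\<lambda>x. f n x - f0 x)) \<longlonglongrightarrow> 0"
  shows "(\<lambda>n. L2norm M (f n)) \<longlonglongrightarrow> L2norm M f0"
proof -
  have "(\<lambda>n. L2norm M (f n) - L2norm M f0) \<longlonglongrightarrow> 0"
    by (rule Lim_null_comparison[OF _ assms(3)]) (use L2norm_diff_le[OF assms(1,2)] in simp)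
  then show ?thesis by (simp add: LIM_zero_iff)
qed

lemma L2_tendsto_inner:
  assumes f: "\<And>n. L2 M (f n)" "L2 M f0" "(\<lambda>n. L2norm M (\<lambda>x. f n x - f0 x)) \<longlonglongrightarrow> 0"
    and g: "\<And>n. L2 M (g n)" "L2 M g0" "(\<lambda>n. L2norm M (\<lambda>x. g n x - g0 x)) \<longlonglongrightarrow> 0"
  shows "(\<lambda>n. LINT x|M. f n x \<bullet> g n x) \<longlonglongrightarrow> (LINT x|M. f0 x \<bullet> g0 x)"
proof -
  have "(\<lambda>n. (LINT x|M. f n x \<bullet> g n x) - (LINT x|M. f0 x \<bullet> g0 x)) \<longlonglongrightarrow> 0"
  proof (rule Lim_null_comparison)
    show "(\<lambda>n. L2norm M (\<lambda>x. f n x - f0 x) * L2norm M (g n) + L2norm M f0 * L2norm M (\<lambda>x. g n x - g0 x)) \<longlonglongrightarrow> 0"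
      by (rule tendsto_eq_intros f(3) g(3) L2_tendsto_norm[OF g] refl)+ simp
    have "norm ((LINT x|M. f n x \<bullet> g n x) - (LINT x|M. f0 x \<bullet> g0 x))
        \<le> L2norm M (\<lambda>x. f n x - f0 x) * L2norm M (g n) + L2norm M f0 * L2norm M (\<lambda>x. g n x - g0 x)" for n
    proof -
      note i = L2_integrable_inner[OF f(1)[of n] g(1)[of n]] L2_integrable_inner[OF f(2) g(2)]
        L2_integrable_inner[OF f(2) g(1)[of n]]
      have "(LINT x|M. f n x \<bullet> g n x) - (LINT x|M. f0 x \<bullet> g0 x)
        = (LINT x|M. (f n x - f0 x) \<bullet> g n x) + (LINT x|M. f0 x \<bullet> (g n x - g0 x))"
        using i by (simp add: inner_diff_left inner_diff_right)
      then show ?thesis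
        using L2_Cauchy_Schwarz[OF L2_diff[OF f(1)[of n] f(2)] g(1)[of n]]
          L2_Cauchy_Schwarz[OF f(2) L2_diff[OF g(1)[of n] g(2)]] by simp
    qed
    then show "\<forall>\<^sub>F n in sequentially. norm ((LINT x|M. f n x \<bullet> g n x) - (LINT x|M. f0 x \<bullet> g0 x))
        \<le> L2norm M (\<lambda>x. f n x - f0 x) * L2norm M (g n) + L2norm M f0 * L2norm M (\<lambda>x. g n x - g0 x)" by simp
  qed
  then show ?thesis by (simp add: LIM_zero_iff)
qed

section \<open>L2 over a finite measure: inclusion in L1 and completeness\<close>

lemma (in finite_measure) L2_const: "L2 M (\<lambda>x. c)"
  by (simp add: L2_def)

lemma (in finite_measure) L2_imp_integrable:
  fixes f :: "'a \<Rightarrow> 'b::euclidean_space"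
  assumes "L2 M f"
  shows "integrable M f" "(LINT x|M. norm (f x)) \<le> L2norm M f * sqrt (measure M (space M))"
proof -
  have n: "L2 M (\<lambda>x. norm (f x))" using assms by (auto simp: L2_def)
  have 1: "L2 M (\<lambda>x. 1::real)" by (rule L2_const)
  have "integrable M (\<lambda>x. norm (f x))" using L2_integrable_inner[OF n 1] by simp
  then show "integrable M f" using L2D(1)[OF assms] by (simp add: integrable_norm_iff)
  have "(LINT x|M. norm (f x)) \<le> L2norm M (\<lambda>x. norm (f x)) * L2norm M (\<lambda>x. 1::real)"
    using L2_Cauchy_Schwarz[OF n 1] by simp
  then show "(LINT x|M. norm (f x)) \<le> L2norm M f * sqrt (measure M (space M))"
    by (simp add: L2norm_def)
qed

text \<open>As in the proof of Riesz and Fischer: on a finite measure space the geometric rate in L2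
  is one in L1, so the increments are summable almost everywhere and a pointwise limit exists.
  Fatou's lemma then upgrades pointwise convergence to convergence in norm.\<close>

lemma (in finite_measure) L2_complete:
  fixes f :: "nat \<Rightarrow> 'a \<Rightarrow> 'b::euclidean_space"
  assumes f: "\<And>n. L2 M (f n)" and C: "\<And>n. L2norm M (\<lambda>x. f (Suc n) x - f n x) \<le> C * (1 / 2) ^ n"
  obtains f0 where "L2 M f0" "(\<lambda>n. L2norm M (\<lambda>x. f n x - f0 x)) \<longlonglongrightarrow> 0"
proof -
  note [measurable] = L2D(1)[OF f]
  have C0: "C \<ge> 0" using C[of 0] L2norm_nonneg[of M "\<lambda>x. f (Suc 0) x - f 0 x"] by simp
  define A where "A = C * sqrt (measure M (space M))"
  have A0: "A \<ge> 0" using C0 by (simp add: A_def)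
  have "(\<integral>\<^sup>+x. (\<Sum>n. ennreal (norm (f (Suc n) x - f n x))) \<partial>M) = (\<Sum>n. \<integral>\<^sup>+x. ennreal (norm (f (Suc n) x - f n x)) \<partial>M)"
    by (rule nn_integral_suminf) measurable
  also have "\<dots> \<le> (\<Sum>n. ennreal (A * (1 / 2) ^ n))"
  proof (rule suminf_le)
    fix n
    have L: "L2 M (\<lambda>x. f (Suc n) x - f n x)" by (rule L2_diff[OF f f])
    have "(LINT x|M. norm (f (Suc n) x - f n x)) \<le> A * (1 / 2) ^ n"
      using L2_imp_integrable(2)[OF L] mult_right_mono[OF C[of n], of "sqrt (measure M (space M))"]
      by (simp add: A_def algebra_simps)
    then show "(\<integral>\<^sup>+x. ennreal (norm (f (Suc n) x - f n x)) \<partial>M) \<le> ennreal (A * (1 / 2) ^ n)"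
      using L2_imp_integrable(1)[OF L] by (subst nn_integral_eq_integral) (auto intro: ennreal_leI)
  qed simp_all
  also have "\<dots> = ennreal (\<Sum>n. A * (1 / 2) ^ n)"
    by (rule suminf_ennreal2) (use A0 in \<open>auto intro: summable_mult summable_geometric\<close>)
  also have "\<dots> < \<infinity>" by simp
  finally have "AE x in M. (\<Sum>n. ennreal (norm (f (Suc n) x - f n x))) \<noteq> \<infinity>"
    by (intro nn_integral_PInf_AE) (auto simp: less_top)
  then have conv: "AE x in M. convergent (\<lambda>n. f n x)"
  proof eventually_elim
    case (elim x)
    then have "summable (\<lambda>n. norm (f (Suc n) x - f n x))"
      by (intro summable_suminf_not_top) auto
    then have "summable (\<lambda>n. f (Suc n) x - f n x)" by (rule summable_norm_cancel)
    then have "convergent (\<lambda>n. (\<Sum>i<n. f (Suc i) x - f i x) + f 0 x)"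
      by (intro convergent_add convergent_const) (simp add: summable_iff_convergent)
    then show ?case unfolding sum_lessThan_telescope[of "\<lambda>i. f i x"] by simp
  qed
  define f0 where "f0 x = lim (\<lambda>n. f n x)" for x
  have [measurable]: "f0 \<in> borel_measurable M" unfolding f0_def by (rule borel_measurable_lim_metric) measurable
  have lim: "AE x in M. (\<lambda>n. f n x) \<longlonglongrightarrow> f0 x"
    using conv by eventually_elim (simp add: f0_def convergent_LIMSEQ_iff)
  have tail: "L2norm M (\<lambda>x. f n x - f (n + k) x) \<le> 2 * C * (1 / 2) ^ n" for n k
  proof -
    \<comment> \<open>The exact partial geometric sum is carried along, since the bound without the
      last factor would not reproduce itself in the induction.\<close>
    have "L2norm M (\<lambda>x. f n x - f (n + k) x) \<le> 2 * C * (1 / 2) ^ n * (1 - (1 / 2) ^ k)"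
    proof (induction k)
      case 0
      then show ?case by (simp add: L2norm_def)
    next
      case (Suc k)
      have "L2norm M (\<lambda>x. f n x - f (n + Suc k) x) \<le>
        L2norm M (\<lambda>x. f n x - f (n + k) x) + L2norm M (\<lambda>x. f (n + k) x - f (n + Suc k) x)"
        by (rule L2norm_triangle_diff) (rule f)+
      also have "\<dots> \<le> 2 * C * (1 / 2) ^ n * (1 - (1 / 2) ^ k) + C * (1 / 2) ^ (n + k)"
        using Suc C[of "n + k"] L2norm_minus_commute[of M "f (n + k)" "f (n + Suc k)"] by simp
      also have "\<dots> = 2 * C * (1 / 2) ^ n * (1 - (1 / 2) ^ Suc k)"
        by (simp add: power_add algebra_simps)
      finally show ?case .
    qed
    also have "\<dots> \<le> 2 * C * (1 / 2) ^ n * 1" using C0 by (intro mult_left_mono) auto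
    finally show ?thesis by simp
  qed
  \<comment> \<open>Fatou's lemma in \<open>k\<close> at fixed \<open>n\<close>, with the bound
    \<open>tail\<close> being uniform in \<open>k\<close>.\<close>
  have key: "(\<integral>\<^sup>+x. ennreal ((norm (f n x - f0 x))\<^sup>2) \<partial>M) \<le> ennreal ((2 * C * (1 / 2) ^ n)\<^sup>2)" for n
  proof -
    have "(\<integral>\<^sup>+x. ennreal ((norm (f n x - f0 x))\<^sup>2) \<partial>M) = (\<integral>\<^sup>+x. liminf (\<lambda>k. ennreal ((norm (f n x - f (n + k) x))\<^sup>2)) \<partial>M)"
    proof (rule nn_integral_cong_AE)
      show "AE x in M. ennreal ((norm (f n x - f0 x))\<^sup>2) = liminf (\<lambda>k. ennreal ((norm (f n x - f (n + k) x))\<^sup>2))"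
        using lim
      proof eventually_elim
        case (elim x)
        have "(\<lambda>k. f (k + n) x) \<longlonglongrightarrow> f0 x" using elim by (rule LIMSEQ_ignore_initial_segment)
        then have "(\<lambda>k. ennreal ((norm (f n x - f (n + k) x))\<^sup>2)) \<longlonglongrightarrow> ennreal ((norm (f n x - f0 x))\<^sup>2)"
          by (intro tendsto_intros tendsto_ennrealI) (simp add: add.commute)
        from lim_imp_Liminf[OF trivial_limit_sequentially this] show ?case by (rule sym)
      qed
    qed
    also have "\<dots> \<le> liminf (\<lambda>k. \<integral>\<^sup>+x. ennreal ((norm (f n x - f (n + k) x))\<^sup>2) \<partial>M)"
      by (rule nn_integral_liminf) measurable
    also have "\<dots> \<le> limsup (\<lambda>k. \<integral>\<^sup>+x. ennreal ((norm (f n x - f (n + k) x))\<^sup>2) \<partial>M)"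
      by (rule Liminf_le_Limsup) simp
    also have "\<dots> \<le> ennreal ((2 * C * (1 / 2) ^ n)\<^sup>2)"
    proof (rule Limsup_bounded, rule always_eventually, rule allI)
      fix k
      have L: "L2 M (\<lambda>x. f n x - f (n + k) x)" by (rule L2_diff[OF f f])
      have "(LINT x|M. (norm (f n x - f (n + k) x))\<^sup>2) \<le> (2 * C * (1 / 2) ^ n)\<^sup>2"
        unfolding L2norm_power2[symmetric] by (rule power_mono[OF tail L2norm_nonneg])
      then show "(\<integral>\<^sup>+x. ennreal ((norm (f n x - f (n + k) x))\<^sup>2) \<partial>M) \<le> ennreal ((2 * C * (1 / 2) ^ n)\<^sup>2)"
        using L2D(2)[OF L] by (subst nn_integral_eq_integral) (auto intro: ennreal_leI)
    qed
    finally show ?thesis .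
  qed
  have d: "L2 M (\<lambda>x. f n x - f0 x)" for n
    unfolding L2_def
  proof
    show "integrable M (\<lambda>x. (norm (f n x - f0 x))\<^sup>2)"
    proof (rule integrableI_bounded)
      show "(\<integral>\<^sup>+x. ennreal (norm ((norm (f n x - f0 x))\<^sup>2)) \<partial>M) < \<infinity>"
        using le_less_trans[OF key[of n] ennreal_less_top] by simp
    qed measurable
  qed measurable
  have "L2 M f0" using L2_diff[OF f[of 0] d[of 0]] by simp
  moreover have "(\<lambda>n. L2norm M (\<lambda>x. f n x - f0 x)) \<longlonglongrightarrow> 0"
  proof (rule Lim_null_comparison)
    have "norm (L2norm M (\<lambda>x. f n x - f0 x)) \<le> 2 * C * (1 / 2) ^ n" for n
    proof -
      have "ennreal (LINT x|M. (norm (f n x - f0 x))\<^sup>2) \<le> ennreal ((2 * C * (1 / 2) ^ n)\<^sup>2)"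
        using key[of n] L2D(2)[OF d[of n]] by (subst (asm) nn_integral_eq_integral) auto
      then have "(L2norm M (\<lambda>x. f n x - f0 x))\<^sup>2 \<le> (2 * C * (1 / 2) ^ n)\<^sup>2"
        unfolding L2norm_power2 by (simp add: ennreal_le_iff)
      then have "L2norm M (\<lambda>x. f n x - f0 x) \<le> 2 * C * (1 / 2) ^ n"
        by (rule power2_le_imp_le) (use C0 in simp)
      then show ?thesis using L2norm_nonneg[of M "\<lambda>x. f n x - f0 x"] by simp
    qed
    then show "\<forall>\<^sub>F n in sequentially. norm (L2norm M (\<lambda>x. f n x - f0 x)) \<le> 2 * C * (1 / 2) ^ n"
      by (intro always_eventually allI)
    have "(\<lambda>n. 2 * C * (1 / 2) ^ n) \<longlonglongrightarrow> 2 * C * 0"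
      by (intro tendsto_mult_left LIMSEQ_power_zero) simp
    then show "(\<lambda>n. 2 * C * (1 / 2) ^ n) \<longlonglongrightarrow> 0" by simp
  qed
  ultimately show ?thesis by (rule that)
qed

section \<open>Weak gradients\<close>

text \<open>The standard bump \<open>exp (-1 / (1 - |x - a|^2 / r^2))\<close>, extended by zero
  outside the ball.\<close>

definition ball_bump :: "'a::euclidean_space \<Rightarrow> real \<Rightarrow> 'a \<Rightarrow> real" where
  "ball_bump a r x = bump_poly 1 (1 - (norm (x - a))\<^sup>2 / r\<^sup>2)"

lemma smooth_ball_bump: "smooth (ball_bump a r)"
proof -
  have "smooth (\<lambda>x. bump_poly 1 (1 - (1 / r\<^sup>2) * (norm (x - a))\<^sup>2))"
    by (rule smooth_bump_poly[OF smooth_diff[OF smooth_const smooth_mult[OF smooth_const smooth_norm2]]])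
  then show ?thesis by (simp add: ball_bump_def[abs_def])
qed

lemma ball_bump_nonneg: "ball_bump a r x \<ge> 0"
  by (simp add: ball_bump_def bump_poly_def)

lemma ball_bump_pos:
  assumes "r > 0"
  shows "ball_bump a r x > 0 \<longleftrightarrow> x \<in> ball a r"
proof -
  have "ball_bump a r x > 0 \<longleftrightarrow> (norm (x - a))\<^sup>2 / r\<^sup>2 < 1" by (simp add: ball_bump_def bump_poly_def)
  also have "\<dots> \<longleftrightarrow> (norm (x - a))\<^sup>2 < r\<^sup>2" using assms by (simp add: divide_less_eq)
  also have "\<dots> \<longleftrightarrow> norm (x - a) < r" using assms by (auto intro: power2_less_imp_less power_strict_mono)
  finally show ?thesis by (simp add: dist_norm norm_minus_commute)
qed

lemma test_function_ball_bump:
  assumes "r > 0" "cball a r \<subseteq> \<Omega>"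
  shows "test_function \<Omega> (ball_bump a r)"
proof (rule test_functionI[OF smooth_ball_bump compact_cball assms(2)])
  fix x assume "x \<notin> cball a r"
  then have "\<not> ball_bump a r x > 0" using assms(1) by (simp add: ball_bump_pos)
  then show "ball_bump a r x = 0" using ball_bump_nonneg[of a r x] by linarith
qed

text \<open>By Lindelof, countably many balls whose closures lie in \<open>U\<close> cover
  \<open>U\<close>. Finite sums of their bumps have compact support and are eventually positive at
  every point of \<open>U\<close>; a function increasing to 1 then pushes them towards the
  indicator.\<close>

lemma open_indicator_test_functions:
  fixes U :: "'a::euclidean_space set"
  assumes "open U"
  obtains \<psi> where "\<And>n::nat. test_function U (\<psi> n)" "\<And>n x. 0 \<le> \<psi> n x" "\<And>n x. \<psi> n x \<le> 1"
    "\<And>x. (\<lambda>n. \<psi> n x) \<longlonglongrightarrow> indicator U x"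
proof (cases "U = {}")
  case True
  show ?thesis by (rule that[of "\<lambda>n x. 0"]) (auto simp: True test_function_0)
next
  case False
  define F where "F = {B. \<exists>a r. r > 0 \<and> cball a r \<subseteq> U \<and> B = ball a r}"
  have UF: "\<Union>F = U"
  proof
    show "\<Union>F \<subseteq> U" using ball_subset_cball by (fastforce simp: F_def)
    show "U \<subseteq> \<Union>F"
    proof
      fix x assume "x \<in> U"
      then obtain r where "r > 0" "cball x r \<subseteq> U" using assms open_contains_cball by blast
      then show "x \<in> \<Union>F" unfolding F_def by (intro UnionI[of "ball x r"]) auto
    qed
  qed
  obtain F' where F': "F' \<subseteq> F" "countable F'" "\<Union>F' = \<Union>F"
  proof (rule Lindelof[of F])
    show "open S" if "S \<in> F" for S using that by (auto simp: F_def)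
  qed blast
  have ne: "F' \<noteq> {}" using False UF F'(3) by auto
  have "\<exists>a r. r > 0 \<and> cball a r \<subseteq> U \<and> from_nat_into F' i = ball a r" for i
    using from_nat_into[OF ne, of i] F'(1) unfolding F_def by blast
  then obtain a r where ar: "\<And>i. r i > 0" "\<And>i. cball (a i) (r i) \<subseteq> U" "\<And>i. from_nat_into F' i = ball (a i) (r i)"
    by metis
  define S where "S n x = (\<Sum>i<n. ball_bump (a i) (r i) x)" for n x
  have S0: "S n x \<ge> 0" for n x by (simp add: S_def sum_nonneg ball_bump_nonneg)
  have tS: "test_function U (S n)" for n
    unfolding S_def[abs_def] by (intro test_function_sum test_function_ball_bump ar)
  \<comment> \<open>The factor \<open>n\<close> drives the exponent to infinity wherever some bump
    is positive, while the partial sum keeps the support compact.\<close>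
  define \<psi> where "\<psi> n x = 1 - exp (- (real n * S n x))" for n x
  show ?thesis
  proof (rule that[of \<psi>])
    show "0 \<le> \<psi> n x" "\<psi> n x \<le> 1" for n x using S0[of n x] by (auto simp: \<psi>_def)
    show "test_function U (\<psi> n)" for n
    proof (rule test_functionI[OF _ test_functionD(2)[OF tS[of n]] test_functionD(3)[OF tS[of n]]])
      have "smooth (\<lambda>x. 1 - exp ((- real n) * S n x))"
        by (rule smooth_diff[OF smooth_const smooth_exp[OF smooth_mult[OF smooth_const test_functionD(1)[OF tS]]]])
      then show "smooth (\<psi> n)" by (simp add: \<psi>_def[abs_def])
      show "\<psi> n x = 0" if "x \<notin> closure {x. S n x \<noteq> 0}" for x
        using zero_outside_support[OF that] by (simp add: \<psi>_def)
    qed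
    show "(\<lambda>n. \<psi> n x) \<longlonglongrightarrow> indicator U x" for x
    proof (cases "x \<in> U")
      case False
      then have "\<psi> n x = 0" for n using test_functionD(4)[OF tS False] by (simp add: \<psi>_def)
      with False show ?thesis by simp
    next
      case True
      then obtain B where B: "B \<in> F'" "x \<in> B" using UF F'(3) by blast
      then obtain j where j: "from_nat_into F' j = B" using F'(2) by (metis from_nat_into_surj)
      define c where "c = ball_bump (a j) (r j) x"
      have c: "c > 0" unfolding c_def using B(2) j ar by (simp add: ball_bump_pos)
      have "(\<lambda>n. exp (- (real n * S n x))) \<longlonglongrightarrow> 0"
      proof (rule Lim_null_comparison)
        show "\<forall>\<^sub>F n in sequentially. norm (exp (- (real n * S n x))) \<le> exp (- (real n * c))"
        proof (rule eventually_sequentiallyI[of "Suc j"])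
          fix n assume "Suc j \<le> n"
          then have "c \<le> S n x"
            unfolding c_def S_def by (intro member_le_sum) (auto simp: ball_bump_nonneg)
          then show "norm (exp (- (real n * S n x))) \<le> exp (- (real n * c))"
            by (simp add: mult_left_mono)
        qed
        have "(\<lambda>n. (exp (- c)) ^ n) \<longlonglongrightarrow> 0" by (rule LIMSEQ_power_zero) (use c in simp)
        then show "(\<lambda>n. exp (- (real n * c))) \<longlonglongrightarrow> 0" by (simp add: exp_of_nat_mult[symmetric])
      qed
      then have "(\<lambda>n. 1 - exp (- (real n * S n x))) \<longlonglongrightarrow> 1 - 0" by (intro tendsto_intros)
      with True show ?thesis by (simp add: \<psi>_def)
    qed
  qed
qed

section \<open>Weak gradients on an open set of finite measure\<close>

locale finite_domain =
  fixes \<Omega> :: "'a::euclidean_space set"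
  assumes open_domain: "open \<Omega>" and finite_domain: "\<Omega> \<in> lmeasurable"
begin

abbreviation "M \<equiv> lebesgue_on \<Omega>"

sublocale finite_measure M
  by (rule finite_measure_lebesgue_on[OF finite_domain])

lemma square_integrable_iff: "square_integrable \<Omega> u \<longleftrightarrow> L2 M u"
  by (simp add: square_integrable_def L2_def)

lemma domain_sets: "\<Omega> \<in> sets lebesgue"
  using finite_domain by (rule fmeasurableD)

lemma measure_M: "measure M \<Omega> = measure lebesgue \<Omega>"
  using measure_restrict_space[of \<Omega> lebesgue \<Omega>] domain_sets by simp

lemma borel_imp_M: "f \<in> borel_measurable borel \<Longrightarrow> f \<in> borel_measurable M"
  by (intro measurable_restrict_space1 measurable_completion) simp

text \<open>The definitions integrate over the completed measure on \<open>\<Omega>\<close>.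
  Translation invariance and Tonelli's theorem are applied on \<open>lborel\<close>, and functions
  vanishing off \<open>\<Omega>\<close> pass freely between the two.\<close>

lemma integral_M_lborel:
  fixes f :: "'a \<Rightarrow> real"
  assumes "f \<in> borel_measurable borel" "\<And>x. x \<notin> \<Omega> \<Longrightarrow> f x = 0"
  shows "(LINT x|M. f x) = (LINT x|lborel. f x)" "integrable lborel f \<Longrightarrow> integrable M f"
proof -
  have 1: "(\<lambda>x. indicator \<Omega> x *\<^sub>R f x) = f"
  proof
    fix x show "indicator \<Omega> x *\<^sub>R f x = f x" using assms(2)[of x] by (cases "x \<in> \<Omega>") simp_all
  qed
  have m: "f \<in> borel_measurable lborel" using assms(1) by simp
  have "(LINT x|M. f x) = (LINT x|lebesgue. indicator \<Omega> x *\<^sub>R f x)"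
    by (rule integral_restrict_space) (use domain_sets in simp)
  also have "\<dots> = (LINT x|lborel. f x)" unfolding 1 by (rule integral_completion[OF m])
  finally show "(LINT x|M. f x) = (LINT x|lborel. f x)" .
  show "integrable M f" if "integrable lborel f"
    using domain_sets that by (simp add: integrable_restrict_space 1[simplified] integrable_completion[OF m])
qed

lemma test_function_L2:
  assumes "test_function \<Omega> \<phi>"
  shows "L2 M \<phi>"
  unfolding L2_def
proof
  have m: "\<phi> \<in> borel_measurable borel" by (rule test_function_measurable[OF assms])
  show "\<phi> \<in> borel_measurable M" by (rule borel_imp_M[OF m])
  have t: "test_function \<Omega> (\<lambda>x. \<phi> x * \<phi> x)" by (rule test_function_mult[OF assms test_functionD(1)[OF assms]])
  have "integrable M (\<lambda>x. \<phi> x * \<phi> x)"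
    by (rule integral_M_lborel(2)[OF test_function_measurable[OF t] test_functionD(4)[OF t] test_function_integrable[OF t]])
  then show "integrable M (\<lambda>x. (norm (\<phi> x))\<^sup>2)" by (simp add: power2_eq_square)
qed

lemma integral_test_function: "test_function \<Omega> \<phi> \<Longrightarrow> (LINT x|M. \<phi> x) = (LINT x|lborel. \<phi> x)"
  by (rule integral_M_lborel(1)[OF test_function_measurable test_functionD(4)])

lemma L2_componentI:
  fixes g :: "'a \<Rightarrow> 'a"
  assumes "\<And>b. b \<in> Basis \<Longrightarrow> L2 M (\<lambda>x. g x \<bullet> b)"
  shows "L2 M g"
proof -
  have comp: "L2 M (\<lambda>x. (g x \<bullet> b) *\<^sub>R b)" if "b \<in> Basis" for b
  proof -
    have "(\<lambda>x. (g x \<bullet> b) *\<^sub>R b) \<in> borel_measurable M"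
      using L2D(1)[OF assms[OF that]] by measurable
    then show ?thesis using L2D(2)[OF assms[OF that]] that by (simp add: L2_def)
  qed
  have "finite B \<Longrightarrow> B \<subseteq> Basis \<Longrightarrow> L2 M (\<lambda>x. \<Sum>b\<in>B. (g x \<bullet> b) *\<^sub>R b)" for B
    by (induction B rule: finite_induct) (simp_all add: L2_add L2_0 comp)
  from this[of Basis] show ?thesis by (simp add: euclidean_representation)
qed

lemma L2_component: "L2 M g \<Longrightarrow> L2 M (\<lambda>x. g x \<bullet> b)" for g :: "'a \<Rightarrow> 'a"
  unfolding L2_def
proof (elim conjE, rule conjI)
  assume g: "g \<in> borel_measurable M" "integrable M (\<lambda>x. (norm (g x))\<^sup>2)"
  show 1: "(\<lambda>x. g x \<bullet> b) \<in> borel_measurable M" using g(1) by measurable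
  show "integrable M (\<lambda>x. (norm (g x \<bullet> b))\<^sup>2)"
  proof (rule Bochner_Integration.integrable_bound)
    show "integrable M (\<lambda>x. (norm b)\<^sup>2 * (norm (g x))\<^sup>2)" using g(2) by simp
    show "(\<lambda>x. (norm (g x \<bullet> b))\<^sup>2) \<in> borel_measurable M" using 1 by measurable
    have "(norm (g x \<bullet> b))\<^sup>2 \<le> (norm b * norm (g x))\<^sup>2" for x
      using Cauchy_Schwarz_ineq2[of "g x" b] by (intro power_mono) (simp_all add: mult.commute)
    then show "AE x in M. norm ((norm (g x \<bullet> b))\<^sup>2) \<le> norm ((norm b)\<^sup>2 * (norm (g x))\<^sup>2)"
      by (simp add: power_mult_distrib)
  qed
qed

lemma grad_L2: "test_function \<Omega> \<phi> \<Longrightarrow> L2 M (grad \<phi>)"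
  by (rule L2_componentI) (simp add: grad_inner test_function_L2 test_function_partial)

lemma has_weak_gradient_iff: "has_weak_gradient \<Omega> u g \<longleftrightarrow> L2 M u \<and> L2 M g \<and>
     (\<forall>\<phi> b. test_function \<Omega> \<phi> \<longrightarrow> b \<in> Basis \<longrightarrow>
        (LINT x|M. u x * partial b \<phi> x) = - (LINT x|M. (g x \<bullet> b) * \<phi> x))"
  unfolding has_weak_gradient_def square_integrable_iff partial_def by blast

lemma has_weak_gradientD:
  assumes "has_weak_gradient \<Omega> u g"
  shows "L2 M u" "L2 M g" "test_function \<Omega> \<phi> \<Longrightarrow> b \<in> Basis \<Longrightarrow>
        (LINT x|M. u x * partial b \<phi> x) = - (LINT x|M. (g x \<bullet> b) * \<phi> x)"
  using assms unfolding has_weak_gradient_iff by blast+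

lemma has_weak_gradient_test_function:
  assumes "test_function \<Omega> \<phi>"
  shows "has_weak_gradient \<Omega> \<phi> (grad \<phi>)"
  unfolding has_weak_gradient_iff
proof (intro conjI allI impI)
  show "L2 M \<phi>" "L2 M (grad \<phi>)" using assms by (rule test_function_L2 grad_L2)+
  fix \<psi> b assume \<psi>: "test_function \<Omega> \<psi>" and b: "b \<in> (Basis :: 'a set)"
  note s = test_functionD(1)[OF assms]
  note t1 = test_function_mult[OF test_function_partial[OF \<psi> b] s]
  note t2 = test_function_mult[OF \<psi> smoothD(2)[OF s b]]
  show "(LINT x|M. \<phi> x * partial b \<psi> x) = - (LINT x|M. (grad \<phi> x \<bullet> b) * \<psi> x)"
    unfolding grad_inner[OF b] integral_test_function[OF t1] integral_test_function[OF t2]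
    by (rule integral_by_parts_test_function[OF \<psi> s b])
qed

section \<open>Fundamental lemma of the calculus of variations and uniqueness of weak
  gradients\<close>

lemma L2_orthogonal_open:
  fixes f :: "'a \<Rightarrow> real"
  assumes f: "L2 M f" and orth: "\<And>\<phi>. test_function \<Omega> \<phi> \<Longrightarrow> (LINT x|M. f x * \<phi> x) = 0"
    and U: "open U" "U \<subseteq> \<Omega>"
  shows "(LINT x|M. f x * indicator U x) = 0"
proof -
  obtain \<psi> where \<psi>: "\<And>n::nat. test_function U (\<psi> n)" "\<And>n x. 0 \<le> \<psi> n x" "\<And>n x. \<psi> n x \<le> 1"
    "\<And>x. (\<lambda>n. \<psi> n x) \<longlonglongrightarrow> indicator U x"
    using open_indicator_test_functions[OF U(1)] by blast
  have t: "test_function \<Omega> (\<psi> n)" for n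
  proof (rule test_functionI)
    show "smooth (\<psi> n)" "compact (closure {x. \<psi> n x \<noteq> 0})" by (rule test_functionD[OF \<psi>(1)])+
    show "closure {x. \<psi> n x \<noteq> 0} \<subseteq> \<Omega>" using test_functionD(3)[OF \<psi>(1)] U(2) by (rule order_trans)
  qed (rule zero_outside_support)
  have m: "U \<in> sets M" using U open_domain by (simp add: sets_restrict_space_iff domain_sets borel_open)
  \<comment> \<open>Indicators of open subsets are bounded pointwise limits of test functions, so
    orthogonality passes to them.\<close>
  have "(\<lambda>n. LINT x|M. f x * \<psi> n x) \<longlonglongrightarrow> (LINT x|M. f x * indicator U x)"
  proof (rule integral_dominated_convergence)
    show "(\<lambda>x. f x * indicator U x) \<in> borel_measurable M" using L2D(1)[OF f] m by measurable
    show "(\<lambda>x. f x * \<psi> n x) \<in> borel_measurable M" for n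
      using L2D(1)[OF f] L2D(1)[OF test_function_L2[OF t[of n]]] by measurable
    show "integrable M (\<lambda>x. \<bar>f x\<bar>)" using L2_imp_integrable(1)[OF f] by simp
    show "AE x in M. (\<lambda>n. f x * \<psi> n x) \<longlonglongrightarrow> f x * indicator U x"
      by (intro AE_I2 tendsto_intros \<psi>)
    show "AE x in M. norm (f x * \<psi> n x) \<le> \<bar>f x\<bar>" for n
      using \<psi>(2,3)[of n] by (intro AE_I2) (simp add: abs_mult mult_left_le)
  qed
  then show ?thesis using orth[OF t] by (simp add: LIMSEQ_const_iff)
qed

text \<open>The set where \<open>f\<close> is positive is enclosed in an open \<open>U\<close> with
  excess measure below \<open>e\<close>. As \<open>f\<close> has integral 0 over \<open>U\<close>,
  its integral over the set is minus that over the excess, hence at most \<open>sqrt e\<close> times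
  the norm of \<open>f\<close>.\<close>

lemma L2_orthogonal_nonpos:
  fixes f :: "'a \<Rightarrow> real"
  assumes f: "L2 M f" and orth: "\<And>\<phi>. test_function \<Omega> \<phi> \<Longrightarrow> (LINT x|M. f x * \<phi> x) = 0"
  shows "AE x in M. f x \<le> 0"
proof -
  have [measurable]: "f \<in> borel_measurable M" by (rule L2D(1)[OF f])
  define E where "E = {x \<in> space M. f x > 0}"
  have E: "E \<in> sets M" unfolding E_def by measurable
  then have E': "E \<in> sets lebesgue" "E \<subseteq> \<Omega>" by (auto simp: sets_restrict_space_iff domain_sets)
  have int: "integrable M (\<lambda>x. f x * indicator A x)" if "A \<in> sets M" for A
    using integrable_mult_indicator[OF that L2_imp_integrable(1)[OF f]] by (simp add: mult.commute)
  have le: "(LINT x|M. f x * indicator E x) \<le> L2norm M f * sqrt e" if e: "e > 0" for e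
  proof -
    obtain T where T: "open T" "E \<subseteq> T" "T - E \<in> lmeasurable" "emeasure lebesgue (T - E) < ennreal e"
      using sets_lebesgue_outer_open[OF E'(1) e] by blast
    define U where "U = T \<inter> \<Omega>"
    have U: "open U" "U \<subseteq> \<Omega>" "E \<subseteq> U" using T open_domain E' by (auto simp: U_def)
    have UM: "U \<in> sets M" "U - E \<in> sets M"
      using U E by (auto simp: sets_restrict_space_iff domain_sets borel_open)
    have "(LINT x|M. f x * indicator U x) = (LINT x|M. f x * indicator E x + f x * indicator (U - E) x)"
      using U(3) by (intro Bochner_Integration.integral_cong) (auto simp: indicator_def)
    also have "\<dots> = (LINT x|M. f x * indicator E x) + (LINT x|M. f x * indicator (U - E) x)"
      by (rule Bochner_Integration.integral_add[OF int[OF E] int[OF UM(2)]])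
    finally have "(LINT x|M. f x * indicator E x) = - (LINT x|M. f x * indicator (U - E) x)"
      using L2_orthogonal_open[OF f orth U(1,2)] by simp
    also have "\<dots> \<le> L2norm M f * L2norm M (indicator (U - E) :: 'a \<Rightarrow> real)"
    proof -
      have "L2 M (indicator (U - E) :: 'a \<Rightarrow> real)"
        using L2_bounded_mult[OF L2_const[of "1::real"] borel_measurable_indicator[OF UM(2)], of 1] by simp
      from L2_Cauchy_Schwarz[OF f this] show ?thesis by simp
    qed
    also have "L2norm M (indicator (U - E) :: 'a \<Rightarrow> real) \<le> sqrt e"
    proof -
      have "(norm (indicator (U - E) x :: real))\<^sup>2 = indicator (U - E) x" for x by (simp add: indicator_def)
      then have "(LINT x|M. (norm (indicator (U - E) x :: real))\<^sup>2) = measure M (U - E)"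
        using UM(2) U(2) by (simp add: Int_absorb2 Diff_subset_conv le_supI2)
      also have "\<dots> = measure lebesgue (U - E)"
        using UM(2) domain_sets by (subst measure_restrict_space) (auto simp: sets_restrict_space_iff)
      also have "\<dots> \<le> measure lebesgue (T - E)"
        by (rule measure_mono_fmeasurable) (use T UM(2) in \<open>auto simp: U_def sets_restrict_space_iff domain_sets\<close>)
      also have "\<dots> \<le> e"
        using T(3,4) e by (simp add: emeasure_eq_measure2 ennreal_less_iff)
      finally show ?thesis unfolding L2norm_def by simp
    qed
    finally show ?thesis using L2norm_nonneg[of M f] by (simp add: mult_left_mono)
  qed
  have le0: "(LINT x|M. f x * indicator E x) \<le> 0"
  proof (rule tendsto_lowerbound)
    show "((\<lambda>e. L2norm M f * sqrt e) \<longlongrightarrow> 0) (at_right 0)"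
      by (rule tendsto_eq_intros refl)+ simp
    show "\<forall>\<^sub>F e in at_right 0. (LINT x|M. f x * indicator E x) \<le> L2norm M f * sqrt e"
      by (rule eventually_at_rightI[of 0 1]) (use le in auto)
  qed simp
  have nn: "AE x in M. 0 \<le> f x * indicator E x" by (auto simp: E_def indicator_def)
  have "(LINT x|M. f x * indicator E x) = 0"
    using le0 integral_nonneg_AE[OF nn] by simp
  then have "AE x in M. f x * indicator E x = 0"
    using integral_nonneg_eq_0_iff_AE[OF int[OF E] nn] by simp
  then show ?thesis
    using AE_space by eventually_elim (auto simp: E_def indicator_def split: if_splits)
qed

lemma L2_orthogonal_zero:
  fixes f :: "'a \<Rightarrow> real"
  assumes f: "L2 M f" and orth: "\<And>\<phi>. test_function \<Omega> \<phi> \<Longrightarrow> (LINT x|M. f x * \<phi> x) = 0"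
  shows "AE x in M. f x = 0"
proof -
  have "AE x in M. f x \<le> 0" by (rule L2_orthogonal_nonpos[OF assms])
  moreover have "AE x in M. - f x \<le> 0"
    by (rule L2_orthogonal_nonpos) (use L2_scaleR[OF f, of "-1"] orth in auto)
  ultimately show ?thesis by eventually_elim simp
qed

text \<open>Makes the choice in \<open>weak_gradient\<close> harmless: norms and energies may be
  computed from any weak gradient at hand.\<close>

lemma weak_gradient_unique:
  assumes g: "has_weak_gradient \<Omega> u g" and h: "has_weak_gradient \<Omega> u h"
  shows "AE x in M. g x = h x"
proof -
  have "AE x in M. (g x - h x) \<bullet> b = 0" if b: "b \<in> Basis" for b
  proof (rule L2_orthogonal_zero)
    show "L2 M (\<lambda>x. (g x - h x) \<bullet> b)"
      by (rule L2_component[OF L2_diff[OF has_weak_gradientD(2)[OF g] has_weak_gradientD(2)[OF h]]])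
    fix \<phi> assume t: "test_function \<Omega> \<phi>"
    have i: "integrable M (\<lambda>x. (k x \<bullet> b) * \<phi> x)" if "L2 M k" for k :: "'a \<Rightarrow> 'a"
      using L2_integrable_inner[OF L2_component[OF that] test_function_L2[OF t]] by simp
    show "(LINT x|M. ((g x - h x) \<bullet> b) * \<phi> x) = 0"
      using has_weak_gradientD(3)[OF g t b] has_weak_gradientD(3)[OF h t b]
        i[OF has_weak_gradientD(2)[OF g]] i[OF has_weak_gradientD(2)[OF h]]
      by (simp add: inner_diff_left left_diff_distrib)
  qed
  then have "AE x in M. \<forall>b\<in>Basis. (g x - h x) \<bullet> b = 0"
    by (simp add: AE_finite_all)
  then show ?thesis by eventually_elim (auto simp: inner_diff_left intro: euclidean_eqI)
qed

lemma has_weak_gradient_diff: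
  assumes g: "has_weak_gradient \<Omega> u g" and h: "has_weak_gradient \<Omega> v h"
  shows "has_weak_gradient \<Omega> (\<lambda>x. u x - v x) (\<lambda>x. g x - h x)"
  unfolding has_weak_gradient_iff
proof (intro conjI allI impI)
  note L = has_weak_gradientD(1,2)[OF g] has_weak_gradientD(1,2)[OF h]
  show "L2 M (\<lambda>x. u x - v x)" "L2 M (\<lambda>x. g x - h x)" by (intro L2_diff L)+
  fix \<phi> b assume t: "test_function \<Omega> \<phi>" and b: "b \<in> (Basis :: 'a set)"
  note t' = test_function_partial[OF t b]
  have "integrable M (\<lambda>x. u x * partial b \<phi> x)" "integrable M (\<lambda>x. v x * partial b \<phi> x)"
    "integrable M (\<lambda>x. (g x \<bullet> b) * \<phi> x)" "integrable M (\<lambda>x. (h x \<bullet> b) * \<phi> x)"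
    using L2_integrable_inner[OF L(1) test_function_L2[OF t']] L2_integrable_inner[OF L(3) test_function_L2[OF t']]
      L2_integrable_inner[OF L2_component[OF L(2)] test_function_L2[OF t]]
      L2_integrable_inner[OF L2_component[OF L(4)] test_function_L2[OF t]] by simp_all
  then show "(LINT x|M. (u x - v x) * partial b \<phi> x) = - (LINT x|M. ((g x - h x) \<bullet> b) * \<phi> x)"
    using has_weak_gradientD(3)[OF g t b] has_weak_gradientD(3)[OF h t b]
    by (simp add: inner_diff_left left_diff_distrib)
qed

lemma has_weak_gradient_weak_gradient:
  assumes "has_weak_gradient \<Omega> u g"
  shows "has_weak_gradient \<Omega> u (weak_gradient \<Omega> u)" "AE x in M. weak_gradient \<Omega> u x = g x"
proof -
  show "has_weak_gradient \<Omega> u (weak_gradient \<Omega> u)"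
    unfolding weak_gradient_def using assms by (rule someI[of "has_weak_gradient \<Omega> u"])
  then show "AE x in M. weak_gradient \<Omega> u x = g x" using assms by (rule weak_gradient_unique)
qed

lemma H1_norm_eq:
  assumes g: "has_weak_gradient \<Omega> u g"
  shows "H1_norm \<Omega> u = sqrt ((L2norm M u)\<^sup>2 + (L2norm M g)\<^sup>2)"
proof -
  have "(LINT x|M. (norm (weak_gradient \<Omega> u x))\<^sup>2) = (LINT x|M. (norm (g x))\<^sup>2)"
  proof (rule integral_cong_AE)
    show "AE x in M. (norm (weak_gradient \<Omega> u x))\<^sup>2 = (norm (g x))\<^sup>2"
      using has_weak_gradient_weak_gradient(2)[OF g] by eventually_elim simp
    show "(\<lambda>x. (norm (weak_gradient \<Omega> u x))\<^sup>2) \<in> borel_measurable M"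
      using L2D(1)[OF has_weak_gradientD(2)[OF has_weak_gradient_weak_gradient(1)[OF g]]] by measurable
    show "(\<lambda>x. (norm (g x))\<^sup>2) \<in> borel_measurable M"
      using L2D(1)[OF has_weak_gradientD(2)[OF g]] by measurable
  qed
  then show ?thesis unfolding H1_norm_def L2norm_power2 by simp
qed

section \<open>The space H10 through approximating test functions\<close>

lemma H10E:
  assumes "u \<in> H10 \<Omega>"
  obtains \<phi> where "\<And>n::nat. test_function \<Omega> (\<phi> n)" "has_weak_gradient \<Omega> u (weak_gradient \<Omega> u)"
    "(\<lambda>n. L2norm M (\<lambda>x. \<phi> n x - u x)) \<longlonglongrightarrow> 0"
    "(\<lambda>n. L2norm M (\<lambda>x. grad (\<phi> n) x - weak_gradient \<Omega> u x)) \<longlonglongrightarrow> 0"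
proof -
  obtain g \<phi> where g: "has_weak_gradient \<Omega> u g" and \<phi>: "\<And>n::nat. test_function \<Omega> (\<phi> n)"
    "(\<lambda>n. H1_norm \<Omega> (\<lambda>x. \<phi> n x - u x)) \<longlonglongrightarrow> 0"
    using assms unfolding H10_def H1_def by blast
  note g' = has_weak_gradient_weak_gradient(1)[OF g]
  have n: "H1_norm \<Omega> (\<lambda>x. \<phi> n x - u x) = sqrt ((L2norm M (\<lambda>x. \<phi> n x - u x))\<^sup>2
      + (L2norm M (\<lambda>x. grad (\<phi> n) x - weak_gradient \<Omega> u x))\<^sup>2)" for n
    by (rule H1_norm_eq[OF has_weak_gradient_diff[OF has_weak_gradient_test_function[OF \<phi>(1)] g']])
  have 1: "(\<lambda>n. L2norm M (\<lambda>x. \<phi> n x - u x)) \<longlonglongrightarrow> 0"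
    by (rule Lim_null_comparison[OF _ \<phi>(2)]) (auto simp: n L2norm_nonneg intro!: always_eventually real_le_rsqrt)
  have 2: "(\<lambda>n. L2norm M (\<lambda>x. grad (\<phi> n) x - weak_gradient \<Omega> u x)) \<longlonglongrightarrow> 0"
    by (rule Lim_null_comparison[OF _ \<phi>(2)]) (auto simp: n L2norm_nonneg intro!: always_eventually real_le_rsqrt)
  show ?thesis by (rule that[OF \<phi>(1) g' 1 2])
qed

text \<open>The gradient \<open>g\<close> is only an L2 limit of classical gradients here; that it
  is the weak gradient of \<open>u\<close> follows since both sides of the defining identity are
  continuous in L2.\<close>

lemma H10I:
  assumes \<phi>: "\<And>n::nat. test_function \<Omega> (\<phi> n)" and u: "L2 M u" and g: "L2 M g"
    and cu: "(\<lambda>n. L2norm M (\<lambda>x. \<phi> n x - u x)) \<longlonglongrightarrow> 0"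
    and cg: "(\<lambda>n. L2norm M (\<lambda>x. grad (\<phi> n) x - g x)) \<longlonglongrightarrow> 0"
  shows "u \<in> H10 \<Omega>" "has_weak_gradient \<Omega> u g"
proof -
  show hg: "has_weak_gradient \<Omega> u g"
    unfolding has_weak_gradient_iff
  proof (intro conjI allI impI u g)
    fix \<psi> b assume t: "test_function \<Omega> \<psi>" and b: "b \<in> (Basis :: 'a set)"
    have L: "L2 M (\<lambda>x. \<psi> x *\<^sub>R b)"
      using borel_imp_M[OF test_function_measurable[OF t]] L2D(2)[OF test_function_L2[OF t]] b
      by (auto simp: L2_def intro: borel_measurable_scaleR)
    have c0: "(\<lambda>n. L2norm M (\<lambda>x. v x - v x)) \<longlonglongrightarrow> 0" for v :: "'a \<Rightarrow> 'c::euclidean_space" by (simp add: L2norm_def)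
    have 1: "(\<lambda>n. LINT x|M. \<phi> n x \<bullet> partial b \<psi> x) \<longlonglongrightarrow> (LINT x|M. u x \<bullet> partial b \<psi> x)"
      by (rule L2_tendsto_inner[OF test_function_L2[OF \<phi>] u cu _ _ c0])
        (rule test_function_L2[OF test_function_partial[OF t b]])+
    have 2: "(\<lambda>n. LINT x|M. grad (\<phi> n) x \<bullet> (\<psi> x *\<^sub>R b)) \<longlonglongrightarrow> (LINT x|M. g x \<bullet> (\<psi> x *\<^sub>R b))"
      by (rule L2_tendsto_inner[OF grad_L2[OF \<phi>] g cg L L c0])
    have "(LINT x|M. \<phi> n x \<bullet> partial b \<psi> x) = - (LINT x|M. grad (\<phi> n) x \<bullet> (\<psi> x *\<^sub>R b))" for n
      using has_weak_gradientD(3)[OF has_weak_gradient_test_function[OF \<phi>] t b] by (simp add: mult.commute)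
    with 1 have "(\<lambda>n. - (LINT x|M. grad (\<phi> n) x \<bullet> (\<psi> x *\<^sub>R b))) \<longlonglongrightarrow> (LINT x|M. u x \<bullet> partial b \<psi> x)" by simp
    from LIMSEQ_unique[OF this tendsto_minus[OF 2]]
    show "(LINT x|M. u x * partial b \<psi> x) = - (LINT x|M. (g x \<bullet> b) * \<psi> x)" by (simp add: mult.commute)
  qed
  have "H1_norm \<Omega> (\<lambda>x. \<phi> n x - u x) = sqrt ((L2norm M (\<lambda>x. \<phi> n x - u x))\<^sup>2
      + (L2norm M (\<lambda>x. grad (\<phi> n) x - g x))\<^sup>2)" for n
    by (rule H1_norm_eq[OF has_weak_gradient_diff[OF has_weak_gradient_test_function[OF \<phi>] hg]])
  moreover have "(\<lambda>n. sqrt ((L2norm M (\<lambda>x. \<phi> n x - u x))\<^sup>2 + (L2norm M (\<lambda>x. grad (\<phi> n) x - g x))\<^sup>2)) \<longlonglongrightarrow> 0"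
    by (rule tendsto_eq_intros cu cg refl)+ simp
  ultimately have "(\<lambda>n. H1_norm \<Omega> (\<lambda>x. \<phi> n x - u x)) \<longlonglongrightarrow> 0" by simp
  then show "u \<in> H10 \<Omega>" unfolding H10_def H1_def using hg \<phi> by blast
qed

lemma test_function_H10: "test_function \<Omega> \<phi> \<Longrightarrow> \<phi> \<in> H10 \<Omega>"
  by (rule H10I(1)[of "\<lambda>_. \<phi>" \<phi> "grad \<phi>"]) (auto intro: test_function_L2 grad_L2 simp: L2norm_def)

end

section \<open>A local Poincare inequality near the complement\<close>

abbreviation pt :: "real \<Rightarrow> real \<Rightarrow> real ^ 2" where
  "pt x y \<equiv> vector [x, y]"

lemma pt_components: "pt (v $ 1) (v $ 2) = v"
  by (simp add: vec_eq_iff forall_2)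

lemma pt_eq: "pt x y = x *\<^sub>R axis 1 1 + y *\<^sub>R axis 2 1"
  by (simp add: vec_eq_iff forall_2 axis_def)

lemma Basis_real2: "(Basis :: (real ^ 2) set) = {axis 1 1, axis 2 1}"
  by (auto simp: Basis_vec_def UNIV_2)

lemma axis_neq: "(axis 1 1 :: real ^ 2) \<noteq> axis 2 1"
  by (simp add: axis_eq_axis)

lemma measurable_pt [measurable (raw)]:
  assumes [measurable]: "f \<in> borel_measurable N" "g \<in> borel_measurable N"
  shows "(\<lambda>p. pt (f p) (g p)) \<in> borel_measurable N"
  unfolding pt_eq by measurable

lemma lborel_real2: "lborel = distr (lborel \<Otimes>\<^sub>M lborel) borel (\<lambda>p. pt (fst p) (snd p))"
proof (rule lborel_eqI)
  fix l u :: "real ^ 2" assume le: "\<And>b. b \<in> Basis \<Longrightarrow> l \<bullet> b \<le> u \<bullet> b"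
  have le': "l $ 1 \<le> u $ 1" "l $ 2 \<le> u $ 2"
    using le[of "axis 1 1"] le[of "axis 2 1"] by (auto simp: Basis_real2 inner_axis)
  have "(\<lambda>p. pt (fst p) (snd p)) -` box l u \<inter> space (lborel \<Otimes>\<^sub>M lborel)
      = {l $ 1<..<u $ 1} \<times> {l $ 2<..<u $ 2}"
    by (auto simp: mem_box_cart forall_2 space_pair_measure)
  then have "emeasure (distr (lborel \<Otimes>\<^sub>M lborel) borel (\<lambda>p. pt (fst p) (snd p))) (box l u)
      = emeasure (lborel \<Otimes>\<^sub>M lborel) ({l $ 1<..<u $ 1} \<times> {l $ 2<..<u $ 2})"
    by (subst emeasure_distr) auto
  also have "\<dots> = ennreal (u $ 1 - l $ 1) * ennreal (u $ 2 - l $ 2)"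
    using le' by (subst lborel.emeasure_pair_measure_Times) auto
  also have "\<dots> = (\<Prod>b\<in>Basis. (u - l) \<bullet> b)"
    using le' axis_neq by (simp add: Basis_real2 inner_axis ennreal_mult)
  finally show "emeasure (distr (lborel \<Otimes>\<^sub>M lborel) borel (\<lambda>p. pt (fst p) (snd p))) (box l u) = (\<Prod>b\<in>Basis. (u - l) \<bullet> b)" .
qed simp

lemma nn_integral_real2:
  assumes [measurable]: "H \<in> borel_measurable borel"
  shows "(\<integral>\<^sup>+v. H v \<partial>lborel) = (\<integral>\<^sup>+x. \<integral>\<^sup>+y. H (pt x y) \<partial>lborel \<partial>lborel)"
    "(\<integral>\<^sup>+v. H v \<partial>lborel) = (\<integral>\<^sup>+y. \<integral>\<^sup>+x. H (pt x y) \<partial>lborel \<partial>lborel)"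
proof -
  have 1: "(\<integral>\<^sup>+v. H v \<partial>lborel) = (\<integral>\<^sup>+p. H (pt (fst p) (snd p)) \<partial>(lborel \<Otimes>\<^sub>M lborel))"
    by (subst lborel_real2, subst nn_integral_distr) auto
  have m: "(\<lambda>p. H (pt (fst p) (snd p))) \<in> borel_measurable (lborel \<Otimes>\<^sub>M lborel)" by measurable
  show "(\<integral>\<^sup>+v. H v \<partial>lborel) = (\<integral>\<^sup>+x. \<integral>\<^sup>+y. H (pt x y) \<partial>lborel \<partial>lborel)"
    unfolding 1 using lborel.nn_integral_fst[OF m] by simp
  show "(\<integral>\<^sup>+v. H v \<partial>lborel) = (\<integral>\<^sup>+y. \<integral>\<^sup>+x. H (pt x y) \<partial>lborel \<partial>lborel)"
    unfolding 1 using lborel_pair.nn_integral_snd[OF m] by simp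
qed

text \<open>The fundamental theorem of calculus followed by the Cauchy-Schwarz inequality. Values in
  \<open>ennreal\<close> allow the bound to be integrated over further variables without
  integrability conditions.\<close>

lemma square_diff_le_integral_deriv:
  fixes h h' :: "real \<Rightarrow> real"
  assumes d: "\<And>t. (h has_real_derivative h' t) (at t)" and c: "continuous_on UNIV h'"
    and pq: "p \<in> {a..b}" "q \<in> {a..b}"
  shows "ennreal ((h p - h q)\<^sup>2) \<le> ennreal (b - a) * (\<integral>\<^sup>+t. ennreal ((h' t)\<^sup>2) * indicator {a..b} t \<partial>lborel)"
  using pq
proof (induction p q rule: linorder_wlog)
  case (sym p q)
  then show ?case by (simp add: power2_commute)
next
  case (le p q)
  define N where "N = restrict_space lborel {p..q}"
  interpret N: finite_measure N
    by (rule finite_measureI) (use le in \<open>simp add: N_def emeasure_restrict_space space_restrict_space\<close>)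
  have hm: "h' \<in> borel_measurable borel" by (rule borel_measurable_continuous_onI[OF c])
  have ci: "continuous_on {p..q} h'" "continuous_on {p..q} (\<lambda>t. (h' t)\<^sup>2)"
    using continuous_on_subset[OF c] by (auto intro!: continuous_intros)
  have i2: "integrable lborel (\<lambda>t. indicator {p..q} t *\<^sub>R (h' t)\<^sup>2)"
    by (rule borel_integrable_compact[OF compact_Icc ci(2)])
  have L: "L2 N h'"
    unfolding L2_def N_def using hm i2 by (simp add: integrable_restrict_space measurable_restrict_space1)
  have "h q - h p = (LINT t|lborel. h' t * indicator {p..q} t)"
    by (rule integral_FTC_Icc_real[symmetric]) (use le d c in \<open>auto simp: continuous_on_eq_continuous_at\<close>)
  also have "\<dots> = (LINT t|N. h' t)"
    by (simp add: N_def integral_restrict_space mult.commute)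
  finally have "\<bar>h q - h p\<bar> \<le> (LINT t|N. norm (h' t))"
    using integral_norm_bound[of N h'] by simp
  also have "\<dots> \<le> L2norm N h' * sqrt (measure N (space N))" by (rule N.L2_imp_integrable(2)[OF L])
  finally have "(h q - h p)\<^sup>2 \<le> (L2norm N h' * sqrt (measure N (space N)))\<^sup>2"
    using power_mono[of "\<bar>h q - h p\<bar>" _ 2] by fastforce
  also have "\<dots> = (q - p) * (LINT t|N. (h' t)\<^sup>2)"
  proof -
    have "measure N (space N) = q - p" using le by (simp add: N_def measure_restrict_space space_restrict_space)
    then show ?thesis using le by (simp add: power_mult_distrib L2norm_power2)
  qed
  finally have "ennreal ((h q - h p)\<^sup>2) \<le> ennreal (q - p) * ennreal (LINT t|N. (h' t)\<^sup>2)"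
    using le by (simp add: ennreal_mult[symmetric] ennreal_leI)
  also have "ennreal (LINT t|N. (h' t)\<^sup>2) = (\<integral>\<^sup>+t. ennreal ((h' t)\<^sup>2) \<partial>N)"
    by (rule nn_integral_eq_integral[symmetric]) (use L2D(2)[OF L] in auto)
  also have "\<dots> = (\<integral>\<^sup>+t. ennreal ((h' t)\<^sup>2) * indicator {p..q} t \<partial>lborel)"
    unfolding N_def by (subst nn_integral_restrict_space) auto
  also have "ennreal (q - p) * \<dots> \<le> ennreal (b - a) * (\<integral>\<^sup>+t. ennreal ((h' t)\<^sup>2) * indicator {a..b} t \<partial>lborel)"
    using le by (intro mult_mono ennreal_leI nn_integral_mono) (auto simp: indicator_def)
  finally show ?case by (simp add: power2_commute)
qed

text \<open>If the boundary of the square lay in \<open>\<Omega>\<close>, its winding number about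
  \<open>z\<close>, a point off the simply connected set, would be 0; but \<open>z\<close> is the
  centre and the number is 1. The set is moved to the complex plane for this.\<close>

lemma simply_connected_square_meets_complement:
  fixes \<Omega> :: "(real ^ 2) set"
  assumes "simply_connected \<Omega>" "z \<notin> \<Omega>" "r > 0"
  obtains p where "p \<notin> \<Omega>" "(\<bar>p $ 1 - z $ 1\<bar> = r \<and> (\<bar>p $ 2 - z $ 2\<bar>) \<le> r) \<or> (\<bar>p $ 2 - z $ 2\<bar> = r \<and> (\<bar>p $ 1 - z $ 1\<bar>) \<le> r)"
proof -
  define c where "c v = Complex (v $ 1) (v $ 2)" for v :: "real ^ 2"
  have lin: "linear c"
    by (rule linearI) (auto simp: c_def complex_eq_iff)
  have inj: "inj c"
    by (rule injI) (auto simp: c_def vec_eq_iff forall_2)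
  have "\<Omega> homeomorphic c ` \<Omega>"
    using homeomorphic_sym linear_homeomorphic_image[OF lin inj] by blast
  then have sc: "simply_connected (c ` \<Omega>)"
    using assms(1) homeomorphic_simply_connected_eq by blast
  have cz: "c z \<notin> c ` \<Omega>" using assms(2) inj by (auto simp: inj_image_mem_iff)
  define a b where "a = c z - Complex r r" and "b = c z + Complex r r"
  have box: "c z \<in> box a b" using assms(3) by (simp add: a_def b_def in_box_complex_iff)
  have "\<not> path_image (rectpath a b) \<subseteq> c ` \<Omega>"
  proof
    assume "path_image (rectpath a b) \<subseteq> c ` \<Omega>"
    then have "winding_number (rectpath a b) (c z) = 0"
      by (intro simply_connected_imp_winding_number_zero[OF sc]) (auto simp: cz)
    with winding_number_rectpath[OF box] show False by simp
  qed
  then obtain q where q: "q \<in> path_image (rectpath a b)" "q \<notin> c ` \<Omega>" by blast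
  define p where "p = pt (Re q) (Im q)"
  have cp: "c p = q" by (simp add: c_def p_def)
  have "q \<in> cbox a b - box a b"
    using q(1) assms(3) by (subst (asm) path_image_rectpath_cbox_minus_box) (auto simp: a_def b_def)
  then have "\<bar>p $ 1 - z $ 1\<bar> \<le> r" "\<bar>p $ 2 - z $ 2\<bar> \<le> r" "\<not> ((\<bar>p $ 1 - z $ 1\<bar>) < r \<and> (\<bar>p $ 2 - z $ 2\<bar>) < r)"
    unfolding cp[symmetric] by (auto simp: a_def b_def c_def in_cbox_complex_iff in_box_complex_iff abs_le_iff abs_less_iff)
  moreover have "p \<notin> \<Omega>" using q(2) cp by auto
  ultimately show ?thesis by (intro that[of p]) auto
qed

definition square :: "real ^ 2 \<Rightarrow> real \<Rightarrow> (real ^ 2) set" where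
  "square c s = {v. (\<bar>v $ 1 - c $ 1\<bar>) \<le> s \<and> (\<bar>v $ 2 - c $ 2\<bar>) \<le> s}"

lemma square_cbox: "square c s = cbox (pt (c $ 1 - s) (c $ 2 - s)) (pt (c $ 1 + s) (c $ 2 + s))"
  by (auto simp: square_def mem_box_cart forall_2 abs_le_iff)

lemma closed_square: "closed (square c s)"
  by (simp add: square_cbox closed_cbox)

lemma sets_square [measurable]: "square c s \<in> sets borel"
  by (rule borel_closed[OF closed_square])

lemma indicator_square: "indicator (square c s) (pt x y)
    = (indicator {c $ 1 - s..c $ 1 + s} x * indicator {c $ 2 - s..c $ 2 + s} y :: ennreal)"
  by (auto simp: square_def indicator_def abs_le_iff)

text \<open>The two opposite sides of the square of half side \<open>r\<close> about
  \<open>z\<close> lie on the lines at \<open>z + r\<close> and \<open>z - r\<close>. As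
  \<open>r\<close> runs through \<open>{0<..<s}\<close>, these positions sweep two disjoint
  intervals inside \<open>J\<close>.\<close>

lemma nn_integral_reflect_le:
  fixes G :: "real \<Rightarrow> ennreal"
  assumes [measurable]: "G \<in> borel_measurable borel" "J \<in> sets borel" and J: "{z - s..z + s} \<subseteq> J"
  shows "(\<integral>\<^sup>+r. (G (z + r) + G (z - r)) * indicator {0<..<s} r \<partial>lborel) \<le> (\<integral>\<^sup>+x. G x * indicator J x \<partial>lborel)"
proof -
  have 1: "(\<integral>\<^sup>+r. G (z + r) * indicator {0<..<s} r \<partial>lborel) = (\<integral>\<^sup>+x. G x * indicator {z<..<z + s} x \<partial>lborel)"
    by (subst nn_integral_real_affine[where c = 1 and t = z]) (auto intro!: nn_integral_cong simp: indicator_def)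
  have 2: "(\<integral>\<^sup>+r. G (z - r) * indicator {0<..<s} r \<partial>lborel) = (\<integral>\<^sup>+x. G x * indicator {z - s<..<z} x \<partial>lborel)"
    by (subst nn_integral_real_affine[where c = "-1" and t = z]) (auto intro!: nn_integral_cong simp: indicator_def)
  have "(\<integral>\<^sup>+r. (G (z + r) + G (z - r)) * indicator {0<..<s} r \<partial>lborel)
    = (\<integral>\<^sup>+x. G x * indicator {z<..<z + s} x \<partial>lborel) + (\<integral>\<^sup>+x. G x * indicator {z - s<..<z} x \<partial>lborel)"
    unfolding 1[symmetric] 2[symmetric] by (simp add: distrib_right nn_integral_add)
  also have "\<dots> = (\<integral>\<^sup>+x. G x * indicator {z<..<z + s} x + G x * indicator {z - s<..<z} x \<partial>lborel)"
    by (rule nn_integral_add[symmetric]) auto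
  also have "\<dots> \<le> (\<integral>\<^sup>+x. G x * indicator J x \<partial>lborel)"
    using J by (intro nn_integral_mono) (auto simp: indicator_def subset_iff)
  finally show ?thesis .
qed

text \<open>The zero on the boundary of the square of half side \<open>r\<close> need not depend measurably on \<open>r\<close>.
  Hence the pointwise bound sums over all four lines that may carry it, before it is averaged
  over \<open>r\<close>.\<close>

lemma local_poincare:
  fixes \<phi> :: "real ^ 2 \<Rightarrow> real"
  assumes \<phi>: "smooth \<phi>" and s: "s > 0" and z: "z \<in> square c s"
    and zero: "\<And>r. 0 < r \<Longrightarrow> r < s \<Longrightarrow> \<exists>p. \<phi> p = 0 \<and>
      ((\<bar>p $ 1 - z $ 1\<bar> = r \<and> \<bar>p $ 2 - z $ 2\<bar> \<le> r) \<or> (\<bar>p $ 2 - z $ 2\<bar> = r \<and> \<bar>p $ 1 - z $ 1\<bar> \<le> r))"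
  shows "(\<integral>\<^sup>+v. ennreal ((\<phi> v)\<^sup>2) * indicator (square c s) v \<partial>lborel)
    \<le> ennreal (48 * s\<^sup>2) * (\<integral>\<^sup>+v. ennreal ((norm (grad \<phi> v))\<^sup>2) * indicator (square c (2 * s)) v \<partial>lborel)"
proof -
  define d1 where "d1 = partial (axis 1 1) \<phi>"
  define d2 where "d2 = partial (axis 2 1) \<phi>"
  have cd: "continuous_on UNIV d1" "continuous_on UNIV d2" "continuous_on UNIV \<phi>"
    unfolding d1_def d2_def by (auto intro!: smooth_imp_continuous smoothD(2) \<phi> simp: Basis_real2)
  note [measurable] = borel_measurable_continuous_onI[OF cd(1)] borel_measurable_continuous_onI[OF cd(2)]
    borel_measurable_continuous_onI[OF cd(3)]
  \<comment> \<open>A zero differs from \<open>z\<close> by at most \<open>r < s\<close> in each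
    coordinate, and \<open>z\<close> from \<open>c\<close> by at most \<open>s\<close>; so all
    segments stay inside the square of half side \<open>2 * s\<close>.\<close>
  define I1 J1 I2 J2 where "I1 = {c $ 1 - s..c $ 1 + s}" and "J1 = {c $ 1 - 2 * s..c $ 1 + 2 * s}"
    and "I2 = {c $ 2 - s..c $ 2 + s}" and "J2 = {c $ 2 - 2 * s..c $ 2 + 2 * s}"
  note IJ = I1_def J1_def I2_def J2_def
  have [measurable]: "I1 \<in> sets borel" "J1 \<in> sets borel" "I2 \<in> sets borel" "J2 \<in> sets borel" by (auto simp: IJ)
  have sub: "I1 \<subseteq> J1" "I2 \<subseteq> J2" using s by (auto simp: IJ)
  have eI: "emeasure lborel I1 = ennreal (2 * s)" "emeasure lborel I2 = ennreal (2 * s)" using s by (auto simp: IJ)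
  define G1 where "G1 y = (\<integral>\<^sup>+x. ennreal ((d1 (pt x y))\<^sup>2) * indicator J1 x \<partial>lborel)" for y
  define G2 where "G2 x = (\<integral>\<^sup>+y. ennreal ((d2 (pt x y))\<^sup>2) * indicator J2 y \<partial>lborel)" for x
  have [measurable]: "G1 \<in> borel_measurable borel" "G2 \<in> borel_measurable borel"
    unfolding G1_def[abs_def] G2_def[abs_def] by measurable
  define D1 where "D1 = (\<integral>\<^sup>+y. G1 y * indicator J2 y \<partial>lborel)"
  define D2 where "D2 = (\<integral>\<^sup>+x. G2 x * indicator J1 x \<partial>lborel)"
  \<comment> \<open>The interval length \<open>4 * s\<close> from Cauchy-Schwarz, times 2 from
    splitting the square of a sum along two segments.\<close>
  define K where "K = ennreal (8 * s)"
  have K: "K = 2 * ennreal (4 * s)" using s by (simp add: K_def ennreal_mult'[symmetric] flip: ennreal_numeral)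

  have l1: "ennreal ((\<phi> (pt x y) - \<phi> (pt p y))\<^sup>2) \<le> ennreal (4 * s) * G1 y" if "x \<in> J1" "p \<in> J1" for x p y
  proof -
    have d: "((\<lambda>t. \<phi> (pt t y)) has_real_derivative d1 (pt t y)) (at t)" for t
      using smooth_line_deriv[OF \<phi>, of "y *\<^sub>R axis 2 1" "axis 1 1" t] by (simp add: pt_eq d1_def add.commute)
    have c: "continuous_on UNIV (\<lambda>t. d1 (pt t y))"
      by (rule continuous_on_compose2[OF cd(1)]) (auto simp: pt_eq intro!: continuous_intros)
    have "c $ 1 + 2 * s - (c $ 1 - 2 * s) = 4 * s" by simp
    then show ?thesis
      using square_diff_le_integral_deriv[OF d c that[unfolded J1_def]] by (simp only: G1_def J1_def)
  qed
  have l2: "ennreal ((\<phi> (pt x y) - \<phi> (pt x p))\<^sup>2) \<le> ennreal (4 * s) * G2 x" if "y \<in> J2" "p \<in> J2" for x p y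
  proof -
    have d: "((\<lambda>t. \<phi> (pt x t)) has_real_derivative d2 (pt x t)) (at t)" for t
      using smooth_line_deriv[OF \<phi>, of "x *\<^sub>R axis 1 1" "axis 2 1" t] by (simp add: pt_eq d2_def)
    have c: "continuous_on UNIV (\<lambda>t. d2 (pt x t))"
      by (rule continuous_on_compose2[OF cd(2)]) (auto simp: pt_eq intro!: continuous_intros)
    have "c $ 2 + 2 * s - (c $ 2 - 2 * s) = 4 * s" by simp
    then show ?thesis
      using square_diff_le_integral_deriv[OF d c that[unfolded J2_def]] by (simp only: G2_def J2_def)
  qed
  have sq: "ennreal (u\<^sup>2) \<le> 2 * ennreal ((u - v)\<^sup>2) + 2 * ennreal (v\<^sup>2)" for u v :: real
  proof -
    have "u\<^sup>2 \<le> 2 * (u - v)\<^sup>2 + 2 * v\<^sup>2"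
      using sum_squares_ge_zero[of "u - 2 * v" 0] by (simp add: power2_eq_square algebra_simps)
    then have "ennreal (u\<^sup>2) \<le> ennreal (2 * (u - v)\<^sup>2 + 2 * v\<^sup>2)" by (rule ennreal_leI)
    also have "\<dots> = 2 * ennreal ((u - v)\<^sup>2) + 2 * ennreal (v\<^sup>2)" by (simp add: ennreal_plus ennreal_mult')
    finally show ?thesis .
  qed
  \<comment> \<open>For a zero on a vertical side, \<open>(x, y)\<close> is joined to it first
    horizontally at height \<open>y\<close>, then vertically on the line carrying that side; for a
    horizontal side the roles are exchanged. The second segment thus lies on a line determined by
    \<open>r\<close> up to a sign, which makes averaging over \<open>r\<close> effective.\<close>
  have pw: "ennreal ((\<phi> (pt x y))\<^sup>2) \<le> K * ((G1 y + G2 x) + ((G2 (z $ 1 + r) + G2 (z $ 1 - r)) + (G1 (z $ 2 + r) + G1 (z $ 2 - r))))"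
    if xy: "x \<in> I1" "y \<in> I2" and r: "0 < r" "r < s" for x y r
  proof -
    obtain p where p: "\<phi> p = 0" "(\<bar>p $ 1 - z $ 1\<bar> = r \<and> \<bar>p $ 2 - z $ 2\<bar> \<le> r) \<or> (\<bar>p $ 2 - z $ 2\<bar> = r \<and> \<bar>p $ 1 - z $ 1\<bar> \<le> r)"
      using zero[OF r] by blast
    have zc: "\<bar>z $ 1 - c $ 1\<bar> \<le> s" "\<bar>z $ 2 - c $ 2\<bar> \<le> s" using z by (auto simp: square_def)
    have pJ: "p $ 1 \<in> J1" "p $ 2 \<in> J2" using p(2) zc r by (auto simp: IJ)
    have p0: "\<phi> (pt (p $ 1) (p $ 2)) = 0" using p(1) by (simp add: pt_components)
    note xyJ = subsetD[OF sub(1) xy(1)] subsetD[OF sub(2) xy(2)]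
    from p(2) show ?thesis
    proof
      assume a: "\<bar>p $ 1 - z $ 1\<bar> = r \<and> \<bar>p $ 2 - z $ 2\<bar> \<le> r"
      then have "p $ 1 = z $ 1 + r \<or> p $ 1 = z $ 1 - r" by linarith
      then have g: "G2 (p $ 1) \<le> G2 (z $ 1 + r) + G2 (z $ 1 - r)" by auto
      have "ennreal ((\<phi> (pt x y))\<^sup>2) \<le> 2 * ennreal ((\<phi> (pt x y) - \<phi> (pt (p $ 1) y))\<^sup>2) + 2 * ennreal ((\<phi> (pt (p $ 1) y))\<^sup>2)"
        by (rule sq)
      also have "\<dots> \<le> 2 * (ennreal (4 * s) * G1 y) + 2 * (ennreal (4 * s) * G2 (p $ 1))"
        using l1[OF xyJ(1) pJ(1), of y] l2[OF xyJ(2) pJ(2), of "p $ 1"] unfolding p0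
        by (intro add_mono mult_left_mono) simp_all
      also have "\<dots> = K * (G1 y + G2 (p $ 1))" by (simp add: K distrib_left mult.assoc)
      also have "\<dots> \<le> K * ((G1 y + G2 x) + ((G2 (z $ 1 + r) + G2 (z $ 1 - r)) + (G1 (z $ 2 + r) + G1 (z $ 2 - r))))"
        by (rule mult_left_mono[OF add_mono[OF _ add_increasing2[OF _ g]]]) simp_all
      finally show ?thesis .
    next
      assume a: "\<bar>p $ 2 - z $ 2\<bar> = r \<and> \<bar>p $ 1 - z $ 1\<bar> \<le> r"
      then have "p $ 2 = z $ 2 + r \<or> p $ 2 = z $ 2 - r" by linarith
      then have g: "G1 (p $ 2) \<le> G1 (z $ 2 + r) + G1 (z $ 2 - r)" by auto
      have "ennreal ((\<phi> (pt x y))\<^sup>2) \<le> 2 * ennreal ((\<phi> (pt x y) - \<phi> (pt x (p $ 2)))\<^sup>2) + 2 * ennreal ((\<phi> (pt x (p $ 2)))\<^sup>2)"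
        by (rule sq)
      also have "\<dots> \<le> 2 * (ennreal (4 * s) * G2 x) + 2 * (ennreal (4 * s) * G1 (p $ 2))"
        using l2[OF xyJ(2) pJ(2), of x] l1[OF xyJ(1) pJ(1), of "p $ 2"] unfolding p0
        by (intro add_mono mult_left_mono) simp_all
      also have "\<dots> = K * (G2 x + G1 (p $ 2))" by (simp add: K distrib_left mult.assoc)
      also have "\<dots> \<le> K * ((G1 y + G2 x) + ((G2 (z $ 1 + r) + G2 (z $ 1 - r)) + (G1 (z $ 2 + r) + G1 (z $ 2 - r))))"
        by (rule mult_left_mono[OF add_mono[OF _ add_increasing[OF _ g]]]) simp_all
      finally show ?thesis .
    qed
  qed
  have zc: "\<bar>z $ 1 - c $ 1\<bar> \<le> s" "\<bar>z $ 2 - c $ 2\<bar> \<le> s" using z by (auto simp: square_def)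
  have avg: "ennreal s * ennreal ((\<phi> (pt x y))\<^sup>2) \<le> K * (ennreal s * (G1 y + G2 x) + (D1 + D2))"
    if xy: "x \<in> I1" "y \<in> I2" for x y
  proof -
    have "ennreal s * ennreal ((\<phi> (pt x y))\<^sup>2) = (\<integral>\<^sup>+r. ennreal ((\<phi> (pt x y))\<^sup>2) * indicator {0<..<s} r \<partial>lborel)"
      using s by (subst nn_integral_cmult_indicator) (simp_all add: mult.commute)
    also have "\<dots> \<le> (\<integral>\<^sup>+r. K * ((G1 y + G2 x) * indicator {0<..<s} r +
        ((G2 (z $ 1 + r) + G2 (z $ 1 - r)) * indicator {0<..<s} r + (G1 (z $ 2 + r) + G1 (z $ 2 - r)) * indicator {0<..<s} r)) \<partial>lborel)"
      using pw[OF xy] by (intro nn_integral_mono) (auto simp: indicator_def)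
    also have "\<dots> = K * ((G1 y + G2 x) * ennreal s + ((\<integral>\<^sup>+r. (G2 (z $ 1 + r) + G2 (z $ 1 - r)) * indicator {0<..<s} r \<partial>lborel)
        + (\<integral>\<^sup>+r. (G1 (z $ 2 + r) + G1 (z $ 2 - r)) * indicator {0<..<s} r \<partial>lborel)))"
      using s by (simp add: nn_integral_cmult nn_integral_add nn_integral_cmult_indicator)
    also have "\<dots> \<le> K * ((G1 y + G2 x) * ennreal s + (D2 + D1))"
      unfolding D1_def D2_def using zc
      by (intro mult_left_mono add_mono nn_integral_reflect_le) (auto simp: IJ)
    finally show ?thesis by (simp add: add.commute mult.commute)
  qed
  have D': "(\<integral>\<^sup>+x. G2 x * indicator I1 x \<partial>lborel) \<le> D2" "(\<integral>\<^sup>+y. G1 y * indicator I2 y \<partial>lborel) \<le> D1"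
    unfolding D1_def D2_def using sub by (auto intro!: nn_integral_mono simp: indicator_def subset_iff)
  have step: "ennreal s * (\<integral>\<^sup>+x. ennreal ((\<phi> (pt x y))\<^sup>2) * indicator I1 x \<partial>lborel)
      \<le> K * (ennreal s * (ennreal (2 * s) * G1 y + D2) + ennreal (2 * s) * (D1 + D2))" if y: "y \<in> I2" for y
  proof -
    have "ennreal s * (\<integral>\<^sup>+x. ennreal ((\<phi> (pt x y))\<^sup>2) * indicator I1 x \<partial>lborel)
      = (\<integral>\<^sup>+x. ennreal s * (ennreal ((\<phi> (pt x y))\<^sup>2) * indicator I1 x) \<partial>lborel)"
      by (rule nn_integral_cmult[symmetric]) measurable
    also have "\<dots> \<le> (\<integral>\<^sup>+x. K * (ennreal s * (G1 y * indicator I1 x + G2 x * indicator I1 x) + (D1 + D2) * indicator I1 x) \<partial>lborel)"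
      using avg[OF _ y] by (intro nn_integral_mono) (auto simp: indicator_def)
    also have "\<dots> = K * (ennreal s * (G1 y * ennreal (2 * s) + (\<integral>\<^sup>+x. G2 x * indicator I1 x \<partial>lborel)) + (D1 + D2) * ennreal (2 * s))"
      by (simp add: nn_integral_cmult nn_integral_add nn_integral_cmult_indicator eI)
    also have "\<dots> \<le> K * (ennreal s * (G1 y * ennreal (2 * s) + D2) + (D1 + D2) * ennreal (2 * s))"
      using D' by (intro mult_left_mono add_mono) auto
    finally show ?thesis by (simp add: mult.commute)
  qed
  define X where "X = (\<integral>\<^sup>+v. ennreal ((\<phi> v)\<^sup>2) * indicator (square c s) v \<partial>lborel)"
  have "ennreal s * X = ennreal s * (\<integral>\<^sup>+y. (\<integral>\<^sup>+x. ennreal ((\<phi> (pt x y))\<^sup>2) * indicator I1 x \<partial>lborel) * indicator I2 y \<partial>lborel)"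
    unfolding X_def by (subst nn_integral_real2(2), measurable)
      (simp add: indicator_square IJ[symmetric] mult.assoc[symmetric] nn_integral_multc)
  also have "\<dots> = (\<integral>\<^sup>+y. (ennreal s * (\<integral>\<^sup>+x. ennreal ((\<phi> (pt x y))\<^sup>2) * indicator I1 x \<partial>lborel)) * indicator I2 y \<partial>lborel)"
    by (subst nn_integral_cmult[symmetric]) (auto simp: mult.assoc)
  also have "\<dots> \<le> (\<integral>\<^sup>+y. K * (ennreal s * (ennreal (2 * s) * (G1 y * indicator I2 y) + D2 * indicator I2 y) + ennreal (2 * s) * ((D1 + D2) * indicator I2 y)) \<partial>lborel)"
    using step by (intro nn_integral_mono) (auto simp: indicator_def)
  also have "\<dots> = K * (ennreal s * (ennreal (2 * s) * (\<integral>\<^sup>+y. G1 y * indicator I2 y \<partial>lborel) + D2 * ennreal (2 * s)) + ennreal (2 * s) * ((D1 + D2) * ennreal (2 * s)))"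
    by (simp add: nn_integral_cmult nn_integral_add nn_integral_cmult_indicator eI)
  also have "\<dots> \<le> K * (ennreal s * (ennreal (2 * s) * D1 + D2 * ennreal (2 * s)) + ennreal (2 * s) * ((D1 + D2) * ennreal (2 * s)))"
    using D' by (intro mult_left_mono add_mono) auto
  \<comment> \<open>Here \<open>48 * s^3 = 8 * s * (2 * s) * (s + 2 * s)\<close>: the factor
    \<open>K\<close>, the side length of the square, then \<open>s\<close> from the lines through
    \<open>(x, y)\<close> and \<open>2 * s\<close> from the lines carrying the zeros. One
    \<open>s\<close> cancels against the average over \<open>r\<close>.\<close>
  also have "\<dots> = ennreal s * (ennreal (48 * s\<^sup>2) * (D1 + D2))"
  proof -
    have "K * (ennreal s * (ennreal (2 * s) * D1 + D2 * ennreal (2 * s)) + ennreal (2 * s) * ((D1 + D2) * ennreal (2 * s)))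
      = (K * ennreal (2 * s) * (ennreal s + ennreal (2 * s))) * (D1 + D2)"
      by (simp add: algebra_simps)
    also have "K * ennreal (2 * s) * (ennreal s + ennreal (2 * s)) = ennreal (8 * s * (2 * s) * (s + 2 * s))"
    proof -
      have nn: "0 \<le> s" "0 \<le> 2 * s" "0 \<le> 8 * s" "0 \<le> 8 * s * (2 * s)" "0 \<le> s + 2 * s" using s by auto
      show ?thesis
        unfolding K_def ennreal_plus[OF nn(1,2), symmetric] ennreal_mult[OF nn(3,2), symmetric]
          ennreal_mult[OF nn(4,5), symmetric] ..
    qed
    also have "8 * s * (2 * s) * (s + 2 * s) = s * (48 * s\<^sup>2)" by (simp add: power2_eq_square)
    also have "ennreal (s * (48 * s\<^sup>2)) = ennreal s * ennreal (48 * s\<^sup>2)" using s by (intro ennreal_mult) auto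
    finally show ?thesis by (simp add: mult.assoc)
  qed
  finally have XD: "X \<le> ennreal (48 * s\<^sup>2) * (D1 + D2)"
    using s by (simp add: ennreal_mult_le_mult_iff)
  have "D1 + D2 = (\<integral>\<^sup>+v. ennreal ((norm (grad \<phi> v))\<^sup>2) * indicator (square c (2 * s)) v \<partial>lborel)"
  proof -
    have "D1 = (\<integral>\<^sup>+v. ennreal ((d1 v)\<^sup>2) * indicator (square c (2 * s)) v \<partial>lborel)"
      unfolding D1_def G1_def by (subst nn_integral_real2(2), measurable)
        (simp add: indicator_square IJ[symmetric] mult.assoc[symmetric] nn_integral_multc)
    moreover have "D2 = (\<integral>\<^sup>+v. ennreal ((d2 v)\<^sup>2) * indicator (square c (2 * s)) v \<partial>lborel)"
    proof -
      have "G2 x * indicator J1 x = (\<integral>\<^sup>+y. ennreal ((d2 (pt x y))\<^sup>2) * indicator (square c (2 * s)) (pt x y) \<partial>lborel)" for x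
        unfolding G2_def by (subst nn_integral_multc[symmetric]) (auto simp: indicator_square IJ ac_simps)
      then show ?thesis unfolding D2_def by (subst nn_integral_real2(1)) simp_all
    qed
    ultimately have "D1 + D2 = (\<integral>\<^sup>+v. ennreal ((d1 v)\<^sup>2) * indicator (square c (2 * s)) v
        + ennreal ((d2 v)\<^sup>2) * indicator (square c (2 * s)) v \<partial>lborel)"
      by (simp add: nn_integral_add)
    also have "\<dots> = (\<integral>\<^sup>+v. ennreal ((norm (grad \<phi> v))\<^sup>2) * indicator (square c (2 * s)) v \<partial>lborel)"
      by (intro nn_integral_cong) (simp add: norm_grad Basis_real2 axis_neq d1_def d2_def ennreal_plus distrib_right)
    finally show ?thesis .
  qed
  with XD show ?thesis by (simp add: X_def)
qed

section \<open>Existence of the torsion function\<close>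

lemma emeasure_square: "s \<ge> 0 \<Longrightarrow> emeasure lborel (square c s) = ennreal (4 * s\<^sup>2)"
proof -
  assume s: "s \<ge> 0"
  have "emeasure lborel (square c s) = (\<integral>\<^sup>+v. indicator (square c s) v \<partial>lborel)" by simp
  also have "\<dots> = ennreal (2 * s) * ennreal (2 * s)"
  proof -
    have "(\<integral>\<^sup>+y. indicator (square c s) (pt x y) \<partial>lborel) = ennreal (2 * s) * indicator {c $ 1 - s..c $ 1 + s} x" for x
      unfolding indicator_square by (subst nn_integral_cmult) (use s in \<open>simp_all add: mult.commute\<close>)
    moreover have "(\<integral>\<^sup>+x. ennreal (2 * s) * indicator {c $ 1 - s..c $ 1 + s} x \<partial>lborel) = ennreal (2 * s) * ennreal (2 * s)"
      by (subst nn_integral_cmult_indicator) (use s in simp_all)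
    ultimately show ?thesis by (subst nn_integral_real2(1)) simp_all
  qed
  also have "\<dots> = ennreal (4 * s\<^sup>2)" using s by (simp add: ennreal_mult[symmetric] power2_eq_square)
  finally show ?thesis .
qed

lemma square_sym: "v \<in> square c s \<longleftrightarrow> c \<in> square v s"
  by (simp add: square_def abs_minus_commute)

lemma measurable_square_pair:
  "(\<lambda>(c, v). indicator (square c s) v :: ennreal) \<in> borel_measurable (lborel \<Otimes>\<^sub>M lborel)"
proof -
  have "{p. snd p \<in> square (fst p) s} = {p :: (real ^ 2) \<times> (real ^ 2). \<bar>snd p $ 1 - fst p $ 1\<bar> \<le> s} \<inter> {p. \<bar>snd p $ 2 - fst p $ 2\<bar> \<le> s}"
    by (auto simp: square_def)
  also have "closed \<dots>"
    by (intro closed_Int closed_Collect_le continuous_intros)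
  finally have "{p. snd p \<in> square (fst p) s} \<in> sets (lborel \<Otimes>\<^sub>M lborel)"
    unfolding lborel_prod sets_lborel by (rule borel_closed)
  then have "indicator {p. snd p \<in> square (fst p) s} \<in> borel_measurable (lborel \<Otimes>\<^sub>M lborel)"
    by (rule borel_measurable_indicator)
  also have "indicator {p. snd p \<in> square (fst p) s} = (\<lambda>(c, v). indicator (square c s) v :: ennreal)"
    by (auto simp: fun_eq_iff indicator_def)
  finally show ?thesis .
qed

text \<open>By Tonelli each point \<open>v\<close> is weighted with the area of the set of centres
  whose squares contain it, and this set is the square about \<open>v\<close>.\<close>

lemma nn_integral_square_average:
  assumes [measurable]: "H \<in> borel_measurable borel" and s: "s \<ge> 0"
  shows "(\<lambda>c. \<integral>\<^sup>+v. H v * indicator (square c s) v \<partial>lborel) \<in> borel_measurable borel"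
    "(\<integral>\<^sup>+c. (\<integral>\<^sup>+v. H v * indicator (square c s) v \<partial>lborel) \<partial>lborel) = ennreal (4 * s\<^sup>2) * (\<integral>\<^sup>+v. H v \<partial>lborel)"
proof -
  have H: "(\<lambda>p. H (snd p)) \<in> borel_measurable (lborel \<Otimes>\<^sub>M lborel)" by measurable
  have m: "(\<lambda>(c, v). H v * indicator (square c s) v) \<in> borel_measurable (lborel \<Otimes>\<^sub>M lborel)"
    using borel_measurable_times_ennreal[OF H measurable_square_pair[of s]] by (simp add: case_prod_beta)
  show "(\<lambda>c. \<integral>\<^sup>+v. H v * indicator (square c s) v \<partial>lborel) \<in> borel_measurable borel"
    using lborel.borel_measurable_nn_integral_fst[OF m] by simp
  have "(\<integral>\<^sup>+c. (\<integral>\<^sup>+v. H v * indicator (square c s) v \<partial>lborel) \<partial>lborel)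
      = (\<integral>\<^sup>+v. (\<integral>\<^sup>+c. H v * indicator (square c s) v \<partial>lborel) \<partial>lborel)"
    using lborel_pair.Fubini'[OF m] by simp
  also have "\<dots> = (\<integral>\<^sup>+v. H v * ennreal (4 * s\<^sup>2) \<partial>lborel)"
  proof (rule nn_integral_cong)
    fix v
    have "(\<integral>\<^sup>+c. H v * indicator (square c s) v \<partial>lborel) = (\<integral>\<^sup>+c. H v * indicator (square v s) c \<partial>lborel)"
      by (intro nn_integral_cong) (simp add: indicator_def square_sym[of v])
    then show "(\<integral>\<^sup>+c. H v * indicator (square c s) v \<partial>lborel) = H v * ennreal (4 * s\<^sup>2)"
      by (simp add: nn_integral_cmult_indicator emeasure_square[OF s])
  qed
  finally show "(\<integral>\<^sup>+c. (\<integral>\<^sup>+v. H v * indicator (square c s) v \<partial>lborel) \<partial>lborel) = ennreal (4 * s\<^sup>2) * (\<integral>\<^sup>+v. H v \<partial>lborel)"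
    by (subst (asm) nn_integral_multc) (simp_all add: mult.commute)
qed

text \<open>For small \<open>t\<close> of sign opposite to \<open>d\<close> the linear term would
  win. This extracts the Euler-Lagrange equation from minimality.\<close>

lemma quadratic_nonneg_imp_zero:
  fixes d q :: real
  assumes "q \<ge> 0" "\<And>t. 0 \<le> t * d + t\<^sup>2 * q"
  shows "d = 0"
proof (rule ccontr)
  assume d: "d \<noteq> 0"
  have q1: "q + 1 > 0" using assms(1) by simp
  define t where "t = d / (q + 1)"
  have td: "d = t * (q + 1)" using q1 by (simp add: t_def)
  have "0 \<le> (- t) * d + (- t)\<^sup>2 * q" by (rule assms(2))
  also have "\<dots> = - t\<^sup>2" by (simp add: td power2_eq_square algebra_simps)
  also have "\<dots> < 0" using d q1 by (simp add: t_def)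
  finally show False by simp
qed

context finite_domain
begin

lemma test_function_norm_grad:
  assumes "test_function \<Omega> \<phi>"
  shows "test_function \<Omega> (\<lambda>x. (norm (grad \<phi> x))\<^sup>2)"
proof -
  have "test_function \<Omega> (\<lambda>x. \<Sum>b\<in>Basis. (partial b \<phi> x)\<^sup>2)"
    unfolding power2_eq_square
    by (intro test_function_sum test_function_mult test_function_partial[OF assms]
        test_functionD(1)[OF test_function_partial[OF assms]])
  then show ?thesis by (simp only: norm_grad)
qed

lemma nn_integral_test_function:
  assumes f: "test_function \<Omega> f" and nn: "\<And>x. f x \<ge> 0" and S: "S \<in> sets borel"
  shows "(\<integral>\<^sup>+v. ennreal (f v) * indicator S v \<partial>lborel) = ennreal (LINT v|M. f v * indicator S v)"
proof -
  have "(\<integral>\<^sup>+v. ennreal (f v) * indicator S v \<partial>lborel) = (\<integral>\<^sup>+v. ennreal (f v * indicator S v) \<partial>lborel)"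
    by (intro nn_integral_cong) (simp add: indicator_def)
  also have "\<dots> = ennreal (LINT v|lborel. f v * indicator S v)"
    by (rule nn_integral_eq_integral)
      (use integrable_real_mult_indicator[OF _ test_function_integrable[OF f], of S] S nn in auto)
  also have "(LINT v|lborel. f v * indicator S v) = (LINT v|M. f v * indicator S v)"
    by (rule integral_M_lborel(1)[symmetric])
      (use S test_function_measurable[OF f] test_functionD(4)[OF f] in auto)
  finally show ?thesis .
qed

lemma test_function_square: "test_function \<Omega> \<phi> \<Longrightarrow> test_function \<Omega> (\<lambda>x. (\<phi> x)\<^sup>2)"
  unfolding power2_eq_square by (rule test_function_mult[OF _ test_functionD(1)])

lemma integrable_indicator_mult:
  fixes f :: "'a \<Rightarrow> real"
  assumes "integrable M f" "S \<in> sets borel"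
  shows "integrable M (\<lambda>v. f v * indicator S v)"
proof -
  have "(indicator S :: 'a \<Rightarrow> real) \<in> borel_measurable M"
    by (rule borel_imp_M) (use assms(2) in measurable)
  then have "(\<lambda>v. f v * indicator S v) \<in> borel_measurable M"
    using borel_measurable_integrable[OF assms(1)] by measurable
  then show ?thesis
    by (rule Bochner_Integration.integrable_bound[OF assms(1)]) (auto simp: indicator_def)
qed

end

section \<open>Simply connected planar domains: Poincare inequality and existence\<close>

locale planar_domain = finite_domain \<Omega> for \<Omega> :: "(real ^ 2) set" +
  assumes simply_conn: "simply_connected \<Omega>"
begin

text \<open>Test functions vanish off \<open>\<Omega>\<close>, so each point of the complement on
  the boundary of a square is one of the zeros that \<open>local_poincare\<close> asks for.\<close>

lemma test_function_local_poincare: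
  assumes t: "test_function \<Omega> \<phi>" and s: "s > 0" and c: "\<not> square c s \<subseteq> \<Omega>"
  shows "(LINT v|M. (\<phi> v)\<^sup>2 * indicator (square c s) v)
    \<le> 48 * s\<^sup>2 * (LINT v|M. (norm (grad \<phi> v))\<^sup>2 * indicator (square c (2 * s)) v)"
proof -
  obtain z where z: "z \<in> square c s" "z \<notin> \<Omega>" using c by blast
  have "ennreal (LINT v|M. (\<phi> v)\<^sup>2 * indicator (square c s) v)
    \<le> ennreal (48 * s\<^sup>2) * ennreal (LINT v|M. (norm (grad \<phi> v))\<^sup>2 * indicator (square c (2 * s)) v)"
    unfolding nn_integral_test_function[OF test_function_square[OF t] zero_le_power2 sets_square, symmetric]
      nn_integral_test_function[OF test_function_norm_grad[OF t] zero_le_power2 sets_square, symmetric]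
  proof (rule local_poincare[OF test_functionD(1)[OF t] s z(1)])
    fix r :: real assume "0 < r"
    from simply_connected_square_meets_complement[OF simply_conn z(2) this]
    show "\<exists>p. \<phi> p = 0 \<and> ((\<bar>p $ 1 - z $ 1\<bar> = r \<and> \<bar>p $ 2 - z $ 2\<bar> \<le> r) \<or> (\<bar>p $ 2 - z $ 2\<bar> = r \<and> \<bar>p $ 1 - z $ 1\<bar> \<le> r))"
      using test_functionD(4)[OF t] by metis
  qed
  then show ?thesis by (simp add: ennreal_mult'[symmetric] ennreal_le_iff)
qed

lemma poincare:
  obtains C where "C \<ge> 0" "\<And>\<phi>. test_function \<Omega> \<phi> \<Longrightarrow> L2norm M \<phi> \<le> C * L2norm M (grad \<phi>)"
proof -
  \<comment> \<open>A square of half side \<open>s\<close> then has area \<open>4 * s^2\<close>,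
    more than \<open>\<Omega>\<close>, so no such square is contained in \<open>\<Omega>\<close> and
    the local inequality holds at every centre.\<close>
  define s where "s = sqrt (measure lebesgue \<Omega> + 1)"
  have s2: "s\<^sup>2 = measure lebesgue \<Omega> + 1" and s0: "s > 0" by (auto simp: s_def add_nonneg_pos)
  have nsub: "\<not> square c s \<subseteq> \<Omega>" for c
  proof
    assume sub: "square c s \<subseteq> \<Omega>"
    have "measure lebesgue (square c s) \<le> measure lebesgue \<Omega>"
      by (rule measure_mono_fmeasurable[OF sub _ finite_domain]) simp
    moreover have "measure lebesgue (square c s) = 4 * s\<^sup>2"
      using emeasure_square[of s c] s0 by (simp add: measure_def)
    ultimately show False using s2 s0 measure_nonneg[of lebesgue \<Omega>] by linarith
  qed
  show ?thesis
  proof (rule that)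
    \<comment> \<open>The local constant 48 times 4, the ratio of the areas of the squares with half
      sides \<open>2 * s\<close> and \<open>s\<close>.\<close>
    show "sqrt (192 * s\<^sup>2) \<ge> 0" by simp
    fix \<phi> assume t: "test_function \<Omega> \<phi>"
    note t2 = test_function_square[OF t] and tg = test_function_norm_grad[OF t]
    have m: "(\<lambda>v. ennreal ((\<phi> v)\<^sup>2)) \<in> borel_measurable borel" "(\<lambda>v. ennreal ((norm (grad \<phi> v))\<^sup>2)) \<in> borel_measurable borel"
      using test_function_measurable[OF t2] test_function_measurable[OF tg] by auto
    have total: "(\<integral>\<^sup>+v. ennreal ((\<phi> v)\<^sup>2) \<partial>lborel) = ennreal (LINT v|M. (\<phi> v)\<^sup>2)"
        "(\<integral>\<^sup>+v. ennreal ((norm (grad \<phi> v))\<^sup>2) \<partial>lborel) = ennreal (LINT v|M. (norm (grad \<phi> v))\<^sup>2)"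
      using nn_integral_test_function[OF t2 zero_le_power2, of UNIV] nn_integral_test_function[OF tg zero_le_power2, of UNIV]
      by simp_all
    have "ennreal (4 * s\<^sup>2) * ennreal (LINT v|M. (\<phi> v)\<^sup>2)
      = (\<integral>\<^sup>+c. (\<integral>\<^sup>+v. ennreal ((\<phi> v)\<^sup>2) * indicator (square c s) v \<partial>lborel) \<partial>lborel)"
      using nn_integral_square_average(2)[OF m(1)] s0 total by simp
    also have "\<dots> \<le> (\<integral>\<^sup>+c. ennreal (48 * s\<^sup>2) * (\<integral>\<^sup>+v. ennreal ((norm (grad \<phi> v))\<^sup>2) * indicator (square c (2 * s)) v \<partial>lborel) \<partial>lborel)"
    proof (rule nn_integral_mono)
      fix c
      show "(\<integral>\<^sup>+v. ennreal ((\<phi> v)\<^sup>2) * indicator (square c s) v \<partial>lborel)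
        \<le> ennreal (48 * s\<^sup>2) * (\<integral>\<^sup>+v. ennreal ((norm (grad \<phi> v))\<^sup>2) * indicator (square c (2 * s)) v \<partial>lborel)"
        unfolding nn_integral_test_function[OF t2 zero_le_power2 sets_square]
          nn_integral_test_function[OF tg zero_le_power2 sets_square]
        using test_function_local_poincare[OF t s0 nsub]
        by (simp add: ennreal_mult'[symmetric] ennreal_leI)
    qed
    also have "\<dots> = ennreal (48 * s\<^sup>2) * (ennreal (4 * (2 * s)\<^sup>2) * ennreal (LINT v|M. (norm (grad \<phi> v))\<^sup>2))"
      using s0 nn_integral_square_average[OF m(2), of "2 * s"] total
      by (subst nn_integral_cmult) auto
    finally have "ennreal (4 * s\<^sup>2 * (LINT v|M. (\<phi> v)\<^sup>2)) \<le> ennreal (48 * s\<^sup>2 * (4 * (2 * s)\<^sup>2 * (LINT v|M. (norm (grad \<phi> v))\<^sup>2)))"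
      by (simp add: ennreal_mult'[symmetric])
    then have "4 * s\<^sup>2 * (LINT v|M. (\<phi> v)\<^sup>2) \<le> 48 * s\<^sup>2 * (4 * (2 * s)\<^sup>2 * (LINT v|M. (norm (grad \<phi> v))\<^sup>2))"
      by (subst (asm) ennreal_le_iff) auto
    then have "4 * s\<^sup>2 * (LINT v|M. (\<phi> v)\<^sup>2) \<le> 4 * s\<^sup>2 * (192 * s\<^sup>2 * (LINT v|M. (norm (grad \<phi> v))\<^sup>2))"
      by (simp add: power_mult_distrib algebra_simps)
    then have "(LINT v|M. (\<phi> v)\<^sup>2) \<le> 192 * s\<^sup>2 * (LINT v|M. (norm (grad \<phi> v))\<^sup>2)"
      by (rule mult_left_le_imp_le) (use s0 in simp)
    then have "(L2norm M \<phi>)\<^sup>2 \<le> 192 * s\<^sup>2 * (L2norm M (grad \<phi>))\<^sup>2"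
      by (simp add: L2norm_power2)
    then have "sqrt ((L2norm M \<phi>)\<^sup>2) \<le> sqrt (192 * s\<^sup>2 * (L2norm M (grad \<phi>))\<^sup>2)" by (rule real_sqrt_le_mono)
    then show "L2norm M \<phi> \<le> sqrt (192 * s\<^sup>2) * L2norm M (grad \<phi>)"
      by (simp add: real_sqrt_mult L2norm_nonneg)
  qed
qed

text \<open>Direct method: the energy \<open>J\<close> is bounded below on test functions by the
  Poincare inequality, and its uniform convexity makes a minimising sequence Cauchy. The limit
  solves the equation, although the infimum need not be attained by a test function. Without
  existence, the choice in \<open>torsion_function\<close> would say nothing.\<close>

lemma torsion_solution_exists: "\<exists>w. torsion_solution \<Omega> w"
proof -
  obtain C where C: "C \<ge> 0" "\<And>\<phi>. test_function \<Omega> \<phi> \<Longrightarrow> L2norm M \<phi> \<le> C * L2norm M (grad \<phi>)"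
    using poincare by blast
  define J where "J \<phi> = (L2norm M (grad \<phi>))\<^sup>2 / 2 - (LINT x|M. \<phi> x)" for \<phi> :: "real ^ 2 \<Rightarrow> real"
  define T where "T = {\<phi> :: real ^ 2 \<Rightarrow> real. test_function \<Omega> \<phi>}"
  have expand: "J (\<lambda>x. \<phi> x + t * \<psi> x) = J \<phi> + t * ((LINT x|M. grad \<phi> x \<bullet> grad \<psi> x) - (LINT x|M. \<psi> x)) + t\<^sup>2 * (L2norm M (grad \<psi>))\<^sup>2 / 2"
    if "\<phi> \<in> T" "\<psi> \<in> T" for \<phi> \<psi> t
  proof -
    have t: "test_function \<Omega> \<phi>" "test_function \<Omega> \<psi>" using that by (auto simp: T_def)
    note L = grad_L2[OF t(1)] grad_L2[OF t(2)]
    have g: "grad (\<lambda>x. \<phi> x + t * \<psi> x) x = grad \<phi> x + t *\<^sub>R grad \<psi> x" for x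
      using grad_add[OF test_functionD(1)[OF t(1)] test_functionD(1)[OF test_function_scale[OF t(2)]], of t x]
      by (simp add: grad_scale[OF test_functionD(1)[OF t(2)]])
    have "(norm (grad (\<lambda>x. \<phi> x + t * \<psi> x) x))\<^sup>2
        = (norm (grad \<phi> x))\<^sup>2 + (2 * t) * (grad \<phi> x \<bullet> grad \<psi> x) + t\<^sup>2 * (norm (grad \<psi> x))\<^sup>2" for x
      unfolding g power2_norm_eq_inner
      by (simp add: inner_add_left inner_add_right inner_commute power2_eq_square[of t])
    then have "(L2norm M (grad (\<lambda>x. \<phi> x + t * \<psi> x)))\<^sup>2
        = (L2norm M (grad \<phi>))\<^sup>2 + (2 * t) * (LINT x|M. grad \<phi> x \<bullet> grad \<psi> x) + t\<^sup>2 * (L2norm M (grad \<psi>))\<^sup>2"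
      unfolding L2norm_power2 using L2D(2)[OF L(1)] L2D(2)[OF L(2)] L2_integrable_inner[OF L] by simp
    moreover have "(LINT x|M. \<phi> x + t * \<psi> x) = (LINT x|M. \<phi> x) + t * (LINT x|M. \<psi> x)"
      using L2_imp_integrable(1)[OF test_function_L2[OF t(1)]] L2_imp_integrable(1)[OF test_function_L2[OF t(2)]] by simp
    ultimately show ?thesis by (simp add: J_def algebra_simps add_divide_distrib)
  qed
  have lin: "(\<lambda>x. \<phi> x + t * \<psi> x) \<in> T" if "\<phi> \<in> T" "\<psi> \<in> T" for \<phi> \<psi> t
    using that unfolding T_def by (auto intro: test_function_add test_function_scale)
  define B where "B = C * sqrt (measure M (space M))"
  \<comment> \<open>With \<open>G\<close> the norm of the gradient,
    \<open>J \<ge> G^2 / 2 - B * G\<close>, and completing the square gives the bound.\<close>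
  have below: "- (B\<^sup>2 / 2) \<le> J \<phi>" if "\<phi> \<in> T" for \<phi>
  proof -
    have t: "test_function \<Omega> \<phi>" using that by (simp add: T_def)
    note L = test_function_L2[OF t]
    have "(LINT x|M. \<phi> x) \<le> (LINT x|M. norm (\<phi> x))"
      using L2_imp_integrable(1)[OF L] by (intro integral_mono) auto
    also have "\<dots> \<le> L2norm M \<phi> * sqrt (measure M (space M))" by (rule L2_imp_integrable(2)[OF L])
    also have "\<dots> \<le> (C * L2norm M (grad \<phi>)) * sqrt (measure M (space M))"
      by (intro mult_right_mono C t) simp
    finally have "(LINT x|M. \<phi> x) \<le> B * L2norm M (grad \<phi>)" by (simp add: B_def mult_ac)
    moreover have "0 \<le> (L2norm M (grad \<phi>) - B)\<^sup>2" by simp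
    ultimately show ?thesis by (simp add: J_def power2_eq_square algebra_simps)
  qed
  have T0: "(\<lambda>x. 0) \<in> T" by (simp add: T_def test_function_0)
  define I where "I = Inf (J ` T)"
  have bdd: "bdd_below (J ` T)" using below by (auto simp: bdd_below_def)
  have I: "I \<le> J \<phi>" if "\<phi> \<in> T" for \<phi> unfolding I_def using bdd that by (intro cInf_lower) auto
  have "\<exists>\<phi>\<in>T. J \<phi> < I + (1 / 4) ^ n" for n :: nat
    using cInf_lessD[of "J ` T" "I + (1 / 4) ^ n"] T0 by (auto simp: I_def)
  \<comment> \<open>Energy gaps \<open>4^(-n)\<close> correspond to distances of order
    \<open>2^(-n)\<close>, the rate that \<open>L2_complete\<close> asks for.\<close>
  then obtain \<phi> where \<phi>: "\<And>n::nat. \<phi> n \<in> T" "\<And>n. J (\<phi> n) < I + (1 / 4) ^ n" by metis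
  have t\<phi>: "test_function \<Omega> (\<phi> n)" for n using \<phi>(1) by (simp add: T_def)
  have t\<phi>d: "test_function \<Omega> (\<lambda>x. \<phi> (Suc n) x - \<phi> n x)" for n by (rule test_function_diff[OF t\<phi> t\<phi>])
  have gd: "grad (\<lambda>x. \<phi> (Suc n) x - \<phi> n x) = (\<lambda>x. grad (\<phi> (Suc n)) x - grad (\<phi> n) x)" for n
    using grad_diff[OF test_functionD(1)[OF t\<phi>] test_functionD(1)[OF t\<phi>]] by blast
  have cauchy: "L2norm M (\<lambda>x. grad (\<phi> (Suc n)) x - grad (\<phi> n) x) \<le> 3 * (1 / 2) ^ n" for n
  proof -
    define \<psi> where "\<psi> = (\<lambda>x. \<phi> (Suc n) x - \<phi> n x)"
    have \<psi>T: "\<psi> \<in> T" unfolding \<psi>_def T_def using t\<phi>d by simp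
    define p q where "p = (LINT x|M. grad (\<phi> n) x \<bullet> grad \<psi> x) - (LINT x|M. \<psi> x)" and "q = (L2norm M (grad \<psi>))\<^sup>2"
    have "J (\<lambda>x. \<phi> n x + 1 * \<psi> x) = J (\<phi> n) + 1 * p + 1\<^sup>2 * q / 2"
      unfolding p_def q_def by (rule expand[OF \<phi>(1) \<psi>T])
    then have e1: "J (\<phi> (Suc n)) = J (\<phi> n) + p + q / 2" by (simp add: \<psi>_def)
    \<comment> \<open>The midpoint of consecutive members has energy at least \<open>I\<close>. By
      the parallelogram identity this bounds \<open>q / 4\<close>, so the distance of their
      gradients is controlled by the energy gaps.\<close>
    have "J (\<lambda>x. \<phi> n x + (1 / 2) * \<psi> x) = J (\<phi> n) + (1 / 2) * p + (1 / 2)\<^sup>2 * q / 2"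
      unfolding p_def q_def by (rule expand[OF \<phi>(1) \<psi>T])
    then have e2: "I \<le> J (\<phi> n) + p / 2 + q / 8"
      using I[OF lin[OF \<phi>(1) \<psi>T], of n "1 / 2"] by (simp add: power2_eq_square)
    have "q / 4 = J (\<phi> (Suc n)) + J (\<phi> n) - 2 * (J (\<phi> n) + p / 2 + q / 8)" using e1 by simp
    also have "\<dots> \<le> (1 / 4) ^ n + (1 / 4) ^ Suc n"
    proof -
      have "J (\<phi> (Suc n)) + J (\<phi> n) - 2 * (J (\<phi> n) + p / 2 + q / 8) \<le> a + b"
        if "J (\<phi> n) < I + a" "J (\<phi> (Suc n)) < I + b" for a b
        using e2 that by (simp add: field_simps)
      from this[OF \<phi>(2) \<phi>(2)] show ?thesis .
    qed
    also have "\<dots> \<le> 2 * (1 / 4) ^ n" by simp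
    \<comment> \<open>The 3 in the rate comes from \<open>8 \<le> 9\<close>.\<close>
    finally have "q \<le> 8 * (1 / 4) ^ n" by simp
    also have "\<dots> \<le> (3 * (1 / 2) ^ n)\<^sup>2"
      by (simp add: power_mult_distrib power_mult[symmetric] power2_eq_square power_divide divide_right_mono flip: power_mult_distrib)
    finally have "L2norm M (grad \<psi>) \<le> 3 * (1 / 2) ^ n"
      unfolding q_def by (rule power2_le_imp_le) simp
    then show ?thesis by (simp add: \<psi>_def gd)
  qed
  obtain g where g: "L2 M g" "(\<lambda>n. L2norm M (\<lambda>x. grad (\<phi> n) x - g x)) \<longlonglongrightarrow> 0"
    using L2_complete[OF grad_L2[OF t\<phi>] cauchy] by blast
  have cauchy': "L2norm M (\<lambda>x. \<phi> (Suc n) x - \<phi> n x) \<le> (C * 3) * (1 / 2) ^ n" for n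
    using C(2)[OF t\<phi>d[of n]] mult_left_mono[OF cauchy[of n] C(1)] by (simp add: gd)
  obtain u where u: "L2 M u" "(\<lambda>n. L2norm M (\<lambda>x. \<phi> n x - u x)) \<longlonglongrightarrow> 0"
    using L2_complete[OF test_function_L2[OF t\<phi>] cauchy'] by blast
  note uH = H10I[OF t\<phi> u(1) g(1) u(2) g(2)]
  note wg = has_weak_gradient_weak_gradient[OF uH(2)]
  have zero: "(\<lambda>n. L2norm M (\<lambda>x. v x - v x)) \<longlonglongrightarrow> 0" for v :: "real ^ 2 \<Rightarrow> 'c::euclidean_space" by (simp add: L2norm_def)
  have EL: "(LINT x|M. g x \<bullet> grad \<psi> x) = (LINT x|M. \<psi> x)" if t: "test_function \<Omega> \<psi>" for \<psi>
  proof -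
    have "(LINT x|M. g x \<bullet> grad \<psi> x) - (LINT x|M. \<psi> x) = 0"
    proof (rule quadratic_nonneg_imp_zero)
      show "0 \<le> (L2norm M (grad \<psi>))\<^sup>2 / 2" by simp
      fix t
      \<comment> \<open>No minimality of the limit is used: perturbing \<open>\<phi> n\<close> by
        \<open>t * \<psi>\<close> lowers the energy by less than the gap, and the limit in
        \<open>n\<close> removes the gap.\<close>
      have "(\<lambda>n. (1 / 4) ^ n + t * ((LINT x|M. grad (\<phi> n) x \<bullet> grad \<psi> x) - (LINT x|M. \<psi> x)) + t\<^sup>2 * (L2norm M (grad \<psi>))\<^sup>2 / 2)
        \<longlonglongrightarrow> 0 + t * ((LINT x|M. g x \<bullet> grad \<psi> x) - (LINT x|M. \<psi> x)) + t\<^sup>2 * (L2norm M (grad \<psi>))\<^sup>2 / 2"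
        by (intro tendsto_intros LIMSEQ_power_zero L2_tendsto_inner[OF grad_L2[OF t\<phi>] g grad_L2[OF that] grad_L2[OF that] zero]) simp
      moreover have "0 \<le> (1 / 4) ^ n + t * ((LINT x|M. grad (\<phi> n) x \<bullet> grad \<psi> x) - (LINT x|M. \<psi> x)) + t\<^sup>2 * (L2norm M (grad \<psi>))\<^sup>2 / 2" for n
      proof -
        have \<psi>T: "\<psi> \<in> T" using that by (simp add: T_def)
        show ?thesis using I[OF lin[OF \<phi>(1) \<psi>T], of n t] expand[OF \<phi>(1) \<psi>T, of n t] \<phi>(2)[of n] by linarith
      qed
      ultimately show "0 \<le> t * ((LINT x|M. g x \<bullet> grad \<psi> x) - (LINT x|M. \<psi> x)) + t\<^sup>2 * ((L2norm M (grad \<psi>))\<^sup>2 / 2)"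
        using LIMSEQ_le_const by fastforce
    qed
    then show ?thesis by simp
  qed
  have EL': "(LINT x|M. weak_gradient \<Omega> u x \<bullet> weak_gradient \<Omega> v x) = (LINT x|M. v x)" if v: "v \<in> H10 \<Omega>" for v
  proof -
    obtain \<psi> where \<psi>: "\<And>n::nat. test_function \<Omega> (\<psi> n)" "has_weak_gradient \<Omega> v (weak_gradient \<Omega> v)"
      "(\<lambda>n. L2norm M (\<lambda>x. \<psi> n x - v x)) \<longlonglongrightarrow> 0"
      "(\<lambda>n. L2norm M (\<lambda>x. grad (\<psi> n) x - weak_gradient \<Omega> v x)) \<longlonglongrightarrow> 0"
      using H10E[OF v] by blast
    note Lv = has_weak_gradientD(1,2)[OF \<psi>(2)] and Lu = has_weak_gradientD(2)[OF wg(1)]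
    have "(\<lambda>n. LINT x|M. g x \<bullet> grad (\<psi> n) x) \<longlonglongrightarrow> (LINT x|M. g x \<bullet> weak_gradient \<Omega> v x)"
      by (rule L2_tendsto_inner[OF g(1) g(1) zero grad_L2[OF \<psi>(1)] Lv(2) \<psi>(4)])
    moreover have "(\<lambda>n. LINT x|M. \<psi> n x \<bullet> 1) \<longlonglongrightarrow> (LINT x|M. v x \<bullet> 1)"
      by (rule L2_tendsto_inner[OF test_function_L2[OF \<psi>(1)] Lv(1) \<psi>(3) L2_const L2_const zero])
    ultimately have "(LINT x|M. g x \<bullet> weak_gradient \<Omega> v x) = (LINT x|M. v x)"
      using LIMSEQ_unique by (simp add: EL[OF \<psi>(1)]) blast
    moreover have "(LINT x|M. weak_gradient \<Omega> u x \<bullet> weak_gradient \<Omega> v x) = (LINT x|M. g x \<bullet> weak_gradient \<Omega> v x)"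
    proof (rule integral_cong_AE)
      show "AE x in M. weak_gradient \<Omega> u x \<bullet> weak_gradient \<Omega> v x = g x \<bullet> weak_gradient \<Omega> v x"
        using wg(2) by eventually_elim simp
    qed (use L2D(1)[OF Lu] L2D(1)[OF Lv(2)] L2D(1)[OF g(1)] in measurable)
    ultimately show ?thesis by simp
  qed
  show ?thesis unfolding torsion_solution_def using uH(1) EL' by blast
qed

end

section \<open>Properties of the torsion function\<close>

context finite_domain
begin

lemma torsion_weak_form:
  assumes w: "torsion_solution \<Omega> w" and t: "test_function \<Omega> \<psi>"
  shows "(LINT x|M. weak_gradient \<Omega> w x \<bullet> grad \<psi> x) = (LINT x|M. \<psi> x)"
proof -
  have wH: "w \<in> H10 \<Omega>" using w by (simp add: torsion_solution_def)
  have hw: "has_weak_gradient \<Omega> w (weak_gradient \<Omega> w)" using H10E[OF wH] by blast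
  note wt = has_weak_gradient_weak_gradient[OF has_weak_gradient_test_function[OF t]]
  have "(LINT x|M. weak_gradient \<Omega> w x \<bullet> weak_gradient \<Omega> \<psi> x) = (LINT x|M. \<psi> x)"
    using w test_function_H10[OF t] by (simp add: torsion_solution_def)
  moreover have "(LINT x|M. weak_gradient \<Omega> w x \<bullet> weak_gradient \<Omega> \<psi> x) = (LINT x|M. weak_gradient \<Omega> w x \<bullet> grad \<psi> x)"
  proof (rule integral_cong_AE)
    show "AE x in M. weak_gradient \<Omega> w x \<bullet> weak_gradient \<Omega> \<psi> x = weak_gradient \<Omega> w x \<bullet> grad \<psi> x"
      using wt(2) by eventually_elim simp
  qed (use L2D(1)[OF has_weak_gradientD(2)[OF hw]] L2D(1)[OF has_weak_gradientD(2)[OF wt(1)]]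
        L2D(1)[OF grad_L2[OF t]] in measurable)
  ultimately show ?thesis by simp
qed

lemma torsion_energy:
  assumes w: "torsion_solution \<Omega> w"
  shows "(LINT x|M. (norm (weak_gradient \<Omega> w x))\<^sup>2) = (LINT x|M. w x)"
  using w by (simp add: torsion_solution_def power2_norm_eq_inner)

text \<open>Formally, the weak equation is tested with \<open>|\<phi>|\<close>, whose gradient has
  the same length as that of \<open>\<phi>\<close>. Young's inequality then splits the inner
  product, and the energy of \<open>w\<close> equals its integral.\<close>

lemma integral_abs_test_function_le:
  assumes w: "torsion_solution \<Omega> w" and t: "test_function \<Omega> \<phi>"
  shows "(LINT x|M. \<bar>\<phi> x\<bar>) \<le> (LINT x|M. w x) / 2 + (L2norm M (grad \<phi>))\<^sup>2 / 2"
proof (rule field_le_epsilon)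
  fix d :: real assume d: "d > 0"
  \<comment> \<open>The smooth substitute falls short of \<open>|\<phi>|\<close> by at most
    \<open>e\<close>, so the loss over the domain is at most \<open>d\<close>. The 1 keeps the
    denominator positive.\<close>
  define e where "e = d / (measure M (space M) + 1)"
  have A: "measure M (space M) + 1 > 0" by (simp add: add_nonneg_pos)
  have e: "e > 0" using d A by (simp add: e_def)
  have eA: "e * measure M (space M) \<le> d"
  proof -
    have "e * measure M (space M) \<le> e * (measure M (space M) + 1)" using e by simp
    also have "\<dots> = d" using A by (simp add: e_def)
    finally show ?thesis .
  qed
  \<comment> \<open>a test function that replaces \<open>\<bar>\<phi>\<bar>\<close>\<close>
  define \<psi> where "\<psi> x = sqrt ((\<phi> x)\<^sup>2 + e\<^sup>2) - e" for x
  have s\<phi>: "smooth \<phi>" by (rule test_functionD(1)[OF t])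
  have s\<psi>: "smooth \<psi>"
    unfolding \<psi>_def[abs_def] by (rule smooth_diff[OF smooth_sqrt[OF s\<phi> e] smooth_const])
  have t\<psi>: "test_function \<Omega> \<psi>"
  proof (rule test_functionI[OF s\<psi> test_functionD(2,3)[OF t]])
    show "\<psi> x = 0" if "x \<notin> closure {x. \<phi> x \<noteq> 0}" for x
      using zero_outside_support[OF that] e by (simp add: \<psi>_def)
  qed
  have pos: "y\<^sup>2 + e\<^sup>2 > 0" for y using e by (simp add: add_nonneg_pos)
  \<comment> \<open>The chain rule multiplies the derivative by \<open>\<phi> / S\<close>, of
    modulus at most 1, so smoothing does not increase the energy.\<close>
  have p: "\<bar>partial b \<psi> x\<bar> \<le> \<bar>partial b \<phi> x\<bar>" for b x
  proof -
    define S where "S = sqrt ((\<phi> x)\<^sup>2 + e\<^sup>2)"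
    have S: "S > 0" "\<bar>\<phi> x\<bar> \<le> S" unfolding S_def using pos by (auto intro: real_le_rsqrt)
    have d: "((\<lambda>y. sqrt (y\<^sup>2 + e\<^sup>2) - e) has_real_derivative \<phi> x / S) (at (\<phi> x))"
      unfolding S_def using pos[of "\<phi> x"] by (auto intro!: derivative_eq_intros simp: field_simps)
    have "partial b \<psi> x = \<phi> x / S * partial b \<phi> x"
      unfolding \<psi>_def[abs_def] by (rule partial_compose[OF d smooth_imp_has_derivative[OF s\<phi>]])
    moreover have "\<bar>\<phi> x / S\<bar> \<le> 1" using S by (simp add: abs_divide)
    ultimately show ?thesis using mult_right_mono[of "\<bar>\<phi> x / S\<bar>" 1 "\<bar>partial b \<phi> x\<bar>"] by (simp add: abs_mult)
  qed
  have n: "(norm (grad \<psi> x))\<^sup>2 \<le> (norm (grad \<phi> x))\<^sup>2" for x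
    unfolding norm_grad using p by (intro sum_mono) (simp add: abs_le_square_iff)
  define g where "g = weak_gradient \<Omega> w"
  have wH: "w \<in> H10 \<Omega>" using w by (simp add: torsion_solution_def)
  have hw: "has_weak_gradient \<Omega> w g" using H10E[OF wH] unfolding g_def by blast
  note Lg = has_weak_gradientD(2)[OF hw]
  have "(LINT x|M. \<psi> x) = (LINT x|M. g x \<bullet> grad \<psi> x)"
    unfolding g_def by (rule torsion_weak_form[OF w t\<psi>, symmetric])
  also have "\<dots> \<le> (LINT x|M. (norm (g x))\<^sup>2 / 2 + (norm (grad \<phi> x))\<^sup>2 / 2)"
  proof (rule integral_mono)
    show "integrable M (\<lambda>x. g x \<bullet> grad \<psi> x)" by (rule L2_integrable_inner[OF Lg grad_L2[OF t\<psi>]])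
    show "integrable M (\<lambda>x. (norm (g x))\<^sup>2 / 2 + (norm (grad \<phi> x))\<^sup>2 / 2)"
      using L2D(2)[OF Lg] L2D(2)[OF grad_L2[OF t]] by simp
    show "g x \<bullet> grad \<psi> x \<le> (norm (g x))\<^sup>2 / 2 + (norm (grad \<phi> x))\<^sup>2 / 2" for x
      using norm_cauchy_schwarz[of "g x" "grad \<psi> x"] sum_squares_bound[of "norm (g x)" "norm (grad \<psi> x)"] n[of x]
      by linarith
  qed
  also have "\<dots> = (LINT x|M. w x) / 2 + (L2norm M (grad \<phi>))\<^sup>2 / 2"
    unfolding L2norm_power2 torsion_energy[OF w, symmetric] g_def[symmetric]
    using L2D(2)[OF Lg] L2D(2)[OF grad_L2[OF t]] by simp
  finally have 1: "(LINT x|M. \<psi> x) \<le> (LINT x|M. w x) / 2 + (L2norm M (grad \<phi>))\<^sup>2 / 2" .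
  have "(LINT x|M. \<bar>\<phi> x\<bar>) \<le> (LINT x|M. \<psi> x + e)"
  proof (rule integral_mono)
    show "integrable M (\<lambda>x. \<bar>\<phi> x\<bar>)" "integrable M (\<lambda>x. \<psi> x + e)"
      using L2_imp_integrable(1)[OF test_function_L2[OF t]] L2_imp_integrable(1)[OF test_function_L2[OF t\<psi>]] by auto
    show "\<bar>\<phi> x\<bar> \<le> \<psi> x + e" for x by (simp add: \<psi>_def real_le_rsqrt)
  qed
  also have "\<dots> = (LINT x|M. \<psi> x) + e * measure M (space M)"
    using L2_imp_integrable(1)[OF test_function_L2[OF t\<psi>]] by (simp add: mult.commute)
  finally show "(LINT x|M. \<bar>\<phi> x\<bar>) \<le> (LINT x|M. w x) / 2 + (L2norm M (grad \<phi>))\<^sup>2 / 2 + d"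
    using 1 eA by linarith
qed

text \<open>In the limit the preceding bound becomes \<open>\<integral>|w| \<le> \<integral>w / 2 +
  \<integral>|\<nabla>w|^2 / 2\<close>, and both halves on the right are equal. This identifies the
  L1 norm without a maximum principle.\<close>

lemma torsion_integral_abs:
  assumes w: "torsion_solution \<Omega> w"
  shows "(LINT x|M. \<bar>w x\<bar>) = (LINT x|M. w x)"
proof (rule antisym)
  have wH: "w \<in> H10 \<Omega>" using w by (simp add: torsion_solution_def)
  obtain \<phi> where \<phi>: "\<And>n::nat. test_function \<Omega> (\<phi> n)" "has_weak_gradient \<Omega> w (weak_gradient \<Omega> w)"
    "(\<lambda>n. L2norm M (\<lambda>x. \<phi> n x - w x)) \<longlonglongrightarrow> 0"
    "(\<lambda>n. L2norm M (\<lambda>x. grad (\<phi> n) x - weak_gradient \<Omega> w x)) \<longlonglongrightarrow> 0"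
    using H10E[OF wH] by blast
  note L = has_weak_gradientD(1,2)[OF \<phi>(2)]
  have iw: "integrable M w" by (rule L2_imp_integrable(1)[OF L(1)])
  have i\<phi>: "integrable M (\<phi> n)" for n by (rule L2_imp_integrable(1)[OF test_function_L2[OF \<phi>(1)]])
  have "(\<lambda>n. (LINT x|M. \<bar>\<phi> n x\<bar>) - (LINT x|M. \<bar>w x\<bar>)) \<longlonglongrightarrow> 0"
  proof (rule Lim_null_comparison)
    show "(\<lambda>n. L2norm M (\<lambda>x. \<phi> n x - w x) * sqrt (measure M (space M))) \<longlonglongrightarrow> 0"
      using tendsto_mult_right[OF \<phi>(3)] by simp
    have "norm ((LINT x|M. \<bar>\<phi> n x\<bar>) - (LINT x|M. \<bar>w x\<bar>)) \<le> L2norm M (\<lambda>x. \<phi> n x - w x) * sqrt (measure M (space M))" for n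
    proof -
      have "norm ((LINT x|M. \<bar>\<phi> n x\<bar>) - (LINT x|M. \<bar>w x\<bar>)) = norm (LINT x|M. \<bar>\<phi> n x\<bar> - \<bar>w x\<bar>)"
        using iw i\<phi>[of n] by simp
      also have "\<dots> \<le> (LINT x|M. norm (\<bar>\<phi> n x\<bar> - \<bar>w x\<bar>))" by (rule integral_norm_bound)
      also have "\<dots> \<le> (LINT x|M. norm (\<phi> n x - w x))"
        using iw i\<phi>[of n] by (intro integral_mono) auto
      also have "\<dots> \<le> L2norm M (\<lambda>x. \<phi> n x - w x) * sqrt (measure M (space M))"
        by (rule L2_imp_integrable(2)[OF L2_diff[OF test_function_L2[OF \<phi>(1)] L(1)]])
      finally show ?thesis .
    qed
    then show "\<forall>\<^sub>F n in sequentially. norm ((LINT x|M. \<bar>\<phi> n x\<bar>) - (LINT x|M. \<bar>w x\<bar>))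
        \<le> L2norm M (\<lambda>x. \<phi> n x - w x) * sqrt (measure M (space M))" by (intro always_eventually allI)
  qed
  then have c: "(\<lambda>n. LINT x|M. \<bar>\<phi> n x\<bar>) \<longlonglongrightarrow> (LINT x|M. \<bar>w x\<bar>)" by (simp add: LIM_zero_iff)
  have "(\<lambda>n. (LINT x|M. w x) / 2 + (L2norm M (grad (\<phi> n)))\<^sup>2 / 2) \<longlonglongrightarrow>
      (LINT x|M. w x) / 2 + (L2norm M (weak_gradient \<Omega> w))\<^sup>2 / 2"
    by (intro tendsto_intros L2_tendsto_norm[OF grad_L2[OF \<phi>(1)] L(2) \<phi>(4)]) auto
  also have "(LINT x|M. w x) / 2 + (L2norm M (weak_gradient \<Omega> w))\<^sup>2 / 2 = (LINT x|M. w x)"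
    unfolding L2norm_power2 torsion_energy[OF w] by simp
  finally show "(LINT x|M. \<bar>w x\<bar>) \<le> (LINT x|M. w x)"
    using c integral_abs_test_function_le[OF w \<phi>(1)] by (blast intro: LIMSEQ_le)
  show "(LINT x|M. w x) \<le> (LINT x|M. \<bar>w x\<bar>)"
    using iw by (intro integral_mono) auto
qed

lemma L2norm_indicator:
  fixes f :: "'a \<Rightarrow> 'b::euclidean_space"
  assumes "L2 M f" "S \<in> sets borel"
  shows "L2 M (\<lambda>x. indicator S x *\<^sub>R f x)"
    "(L2norm M (\<lambda>x. indicator S x *\<^sub>R f x))\<^sup>2 = (LINT x|M. (norm (f x))\<^sup>2 * indicator S x)"
    "L2norm M (\<lambda>x. indicator S x *\<^sub>R f x) \<le> L2norm M f"
proof -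
  have m: "(indicator S :: 'a \<Rightarrow> real) \<in> borel_measurable M"
    by (rule borel_imp_M) (use assms(2) in measurable)
  show "L2 M (\<lambda>x. indicator S x *\<^sub>R f x)"
    by (rule L2_bounded_mult[OF assms(1) m, of 1]) (simp add: indicator_def)
  show 1: "(L2norm M (\<lambda>x. indicator S x *\<^sub>R f x))\<^sup>2 = (LINT x|M. (norm (f x))\<^sup>2 * indicator S x)"
    unfolding L2norm_power2 by (intro Bochner_Integration.integral_cong) (auto simp: indicator_def)
  have "(LINT x|M. (norm (f x))\<^sup>2 * indicator S x) \<le> (LINT x|M. (norm (f x))\<^sup>2)"
    by (rule integral_mono[OF integrable_indicator_mult[OF L2D(2)[OF assms(1)] assms(2)] L2D(2)[OF assms(1)]])
      (simp add: indicator_def)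
  then have "(L2norm M (\<lambda>x. indicator S x *\<^sub>R f x))\<^sup>2 \<le> (L2norm M f)\<^sup>2"
    unfolding 1 by (simp add: L2norm_power2)
  then show "L2norm M (\<lambda>x. indicator S x *\<^sub>R f x) \<le> L2norm M f"
    by (rule power2_le_imp_le[OF _ L2norm_nonneg])
qed

lemma L2_tendsto_indicator:
  fixes f :: "nat \<Rightarrow> 'a \<Rightarrow> 'b::euclidean_space"
  assumes f: "\<And>n. L2 M (f n)" "L2 M f0" "(\<lambda>n. L2norm M (\<lambda>x. f n x - f0 x)) \<longlonglongrightarrow> 0" and S: "S \<in> sets borel"
  shows "(\<lambda>n. LINT x|M. (norm (f n x))\<^sup>2 * indicator S x) \<longlonglongrightarrow> (LINT x|M. (norm (f0 x))\<^sup>2 * indicator S x)"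
proof -
  have "(\<lambda>n. L2norm M (\<lambda>x. indicator S x *\<^sub>R f n x)) \<longlonglongrightarrow> L2norm M (\<lambda>x. indicator S x *\<^sub>R f0 x)"
  proof (rule L2_tendsto_norm)
    show "L2 M (\<lambda>x. indicator S x *\<^sub>R f n x)" "L2 M (\<lambda>x. indicator S x *\<^sub>R f0 x)" for n
      by (rule L2norm_indicator(1)[OF f(1) S] L2norm_indicator(1)[OF f(2) S])+
    show "(\<lambda>n. L2norm M (\<lambda>x. indicator S x *\<^sub>R f n x - indicator S x *\<^sub>R f0 x)) \<longlonglongrightarrow> 0"
    proof (rule Lim_null_comparison[OF _ f(3)], rule always_eventually, rule allI)
      show "norm (L2norm M (\<lambda>x. indicator S x *\<^sub>R f n x - indicator S x *\<^sub>R f0 x)) \<le> L2norm M (\<lambda>x. f n x - f0 x)" for n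
        using L2norm_indicator(3)[OF L2_diff[OF f(1)[of n] f(2)] S]
        by (simp add: scaleR_diff_right L2norm_nonneg)
    qed
  qed
  from tendsto_power[OF this, of 2] show ?thesis
    by (simp only: L2norm_indicator(2)[OF f(1) S] L2norm_indicator(2)[OF f(2) S])
qed

text \<open>Functions on \<open>\<Omega>\<close> are only Lebesgue measurable, while averaging over
  centres uses Tonelli for the Borel product. A Borel function equal almost everywhere to the
  extension by zero bridges the gap.\<close>

lemma integral_indicator_borel_density:
  fixes f :: "'a \<Rightarrow> real"
  assumes f: "integrable M f" and nn: "\<And>x. f x \<ge> 0"
  obtains H where "H \<in> borel_measurable borel"
    "\<And>S. S \<in> sets borel \<Longrightarrow> (\<integral>\<^sup>+v. H v * indicator S v \<partial>lborel) = ennreal (LINT v|M. f v * indicator S v)"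
proof -
  have i: "integrable lebesgue (\<lambda>x. indicator \<Omega> x *\<^sub>R f x)"
    using f domain_sets by (simp add: integrable_restrict_space)
  then obtain f' where f': "f' \<in> borel_measurable lborel" "AE x in lborel. indicator \<Omega> x *\<^sub>R f x = f' x"
    using completion_ex_borel_measurable_real[OF borel_measurable_integrable] by blast
  show ?thesis
  proof (rule that)
    show "(\<lambda>v. ennreal (f' v)) \<in> borel_measurable borel" using f'(1) by simp
    fix S :: "'a set" assume S: "S \<in> sets borel"
    have "ennreal (LINT v|M. f v * indicator S v) = (\<integral>\<^sup>+v. ennreal (f v * indicator S v) \<partial>M)"
      using integrable_indicator_mult[OF f S] nn by (intro nn_integral_eq_integral[symmetric]) auto
    also have "\<dots> = (\<integral>\<^sup>+v. ennreal (f v * indicator S v) * indicator \<Omega> v \<partial>lebesgue)"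
      using domain_sets by (subst nn_integral_restrict_space) auto
    also have "\<dots> = (\<integral>\<^sup>+v. ennreal (f' v) * indicator S v \<partial>lebesgue)"
    proof (rule nn_integral_cong_AE)
      have "AE x in lebesgue. indicator \<Omega> x *\<^sub>R f x = f' x" using f'(2) by (rule AE_completion)
      then show "AE v in lebesgue. ennreal (f v * indicator S v) * indicator \<Omega> v = ennreal (f' v) * indicator S v"
        by eventually_elim (auto simp: indicator_def split: if_splits)
    qed
    also have "\<dots> = (\<integral>\<^sup>+v. ennreal (f' v) * indicator S v \<partial>lborel)"
      by (rule nn_integral_completion) (use f'(1) S in measurable)
    finally show "(\<integral>\<^sup>+v. ennreal (f' v) * indicator S v \<partial>lborel) = ennreal (LINT v|M. f v * indicator S v)" ..
  qed
qed

end

section \<open>Averages and the local Poincare inequality on H10\<close>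

context planar_domain
begin

lemma square_average:
  fixes f :: "real ^ 2 \<Rightarrow> real"
  assumes f: "integrable M f" and nn: "\<And>x. f x \<ge> 0" and s: "s \<ge> 0"
  shows "(\<lambda>c. ennreal (LINT v|M. f v * indicator (square c s) v)) \<in> borel_measurable borel"
    "(\<integral>\<^sup>+c. ennreal (LINT v|M. f v * indicator (square c s) v) \<partial>lborel) = ennreal (4 * s\<^sup>2 * (LINT v|M. f v))"
proof -
  obtain H where H: "H \<in> borel_measurable borel"
    "\<And>S. S \<in> sets borel \<Longrightarrow> (\<integral>\<^sup>+v. H v * indicator S v \<partial>lborel) = ennreal (LINT v|M. f v * indicator S v)"
    using integral_indicator_borel_density[OF f nn] by blast
  have "(\<integral>\<^sup>+v. H v \<partial>lborel) = ennreal (LINT v|M. f v)" using H(2)[of UNIV] by simp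
  with nn_integral_square_average[OF H(1) s]
  show "(\<lambda>c. ennreal (LINT v|M. f v * indicator (square c s) v)) \<in> borel_measurable borel"
    "(\<integral>\<^sup>+c. ennreal (LINT v|M. f v * indicator (square c s) v) \<partial>lborel) = ennreal (4 * s\<^sup>2 * (LINT v|M. f v))"
    by (simp_all add: H(2)[OF sets_square] ennreal_mult')
qed

lemma H10_local_poincare:
  assumes w: "w \<in> H10 \<Omega>" and s: "s > 0" and c: "\<not> square c s \<subseteq> \<Omega>"
  shows "(LINT v|M. (w v)\<^sup>2 * indicator (square c s) v)
    \<le> 48 * s\<^sup>2 * (LINT v|M. (norm (weak_gradient \<Omega> w v))\<^sup>2 * indicator (square c (2 * s)) v)"
proof -
  obtain \<phi> where \<phi>: "\<And>n::nat. test_function \<Omega> (\<phi> n)" "has_weak_gradient \<Omega> w (weak_gradient \<Omega> w)"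
    "(\<lambda>n. L2norm M (\<lambda>x. \<phi> n x - w x)) \<longlonglongrightarrow> 0"
    "(\<lambda>n. L2norm M (\<lambda>x. grad (\<phi> n) x - weak_gradient \<Omega> w x)) \<longlonglongrightarrow> 0"
    using H10E[OF w] by blast
  note L = has_weak_gradientD(1,2)[OF \<phi>(2)]
  have 1: "(\<lambda>n. LINT v|M. (\<phi> n v)\<^sup>2 * indicator (square c s) v) \<longlonglongrightarrow> (LINT v|M. (w v)\<^sup>2 * indicator (square c s) v)"
    using L2_tendsto_indicator[OF test_function_L2[OF \<phi>(1)] L(1) \<phi>(3) sets_square] by simp
  have 2: "(\<lambda>n. 48 * s\<^sup>2 * (LINT v|M. (norm (grad (\<phi> n) v))\<^sup>2 * indicator (square c (2 * s)) v))
      \<longlonglongrightarrow> 48 * s\<^sup>2 * (LINT v|M. (norm (weak_gradient \<Omega> w v))\<^sup>2 * indicator (square c (2 * s)) v)"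
    by (intro tendsto_mult_left L2_tendsto_indicator[OF grad_L2[OF \<phi>(1)] L(2) \<phi>(4) sets_square])
  show ?thesis
    by (rule LIMSEQ_le[OF 1 2]) (use test_function_local_poincare[OF \<phi>(1) s c] in blast)
qed

end

section \<open>Deviation of the torsion function from its mean\<close>

lemma exp_1_ge: "(8 / 3 :: real) \<le> exp 1"
proof -
  have "\<bar>exp 1 - 5837465777 / 2147483648 :: real\<bar> \<le> inverse (2 ^ 32)" by (rule e_approx_32)
  moreover have "inverse (2 ^ 32) \<le> (1 / 1000 :: real)" "(5837465777 / 2147483648 :: real) \<ge> 27 / 10" by simp_all
  ultimately show ?thesis by linarith
qed

text \<open>The maximum of \<open>y^n exp (-y)\<close> is \<open>(n / e)^n\<close>, attained at
  \<open>y = n\<close>; the rational bound \<open>8 / 3 \<le> e\<close> gives the stated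
  constant.\<close>

lemma power_exp_le:
  fixes y :: real
  assumes "y \<ge> 0" "n > 0"
  shows "y ^ n * exp (- y) \<le> (3 * n / 8) ^ n"
proof -
  have "1 + (y / n - 1) \<le> exp (y / n - 1)" by (rule exp_ge_add_one_self)
  then have "y / n * exp 1 \<le> exp (y / n)" by (simp add: exp_diff field_simps)
  moreover have "y / n * (8 / 3) \<le> y / n * exp 1"
    using exp_1_ge assms by (intro mult_left_mono) auto
  ultimately have "y * exp (- (y / n)) \<le> 3 * n / 8"
    using assms by (simp add: exp_minus field_simps)
  then have "(y * exp (- (y / n))) ^ n \<le> (3 * n / 8) ^ n"
    using assms by (intro power_mono) auto
  moreover have "exp (- (y / n)) ^ n = exp (- y)" using assms(2) by (simp add: exp_of_nat_mult[symmetric])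
  ultimately show ?thesis by (simp add: power_mult_distrib)
qed

text \<open>Closed forms of the first and second derivatives of the profile
  \<open>exp (-1/t)\<close>.\<close>

definition bump1 where "bump1 = bump_poly (monom 1 2)"
definition bump2 where "bump2 = bump_poly (monom 1 4 - monom 2 3)"

lemma bump_poly_derivs:
  "(bump_poly 1 has_real_derivative bump1 t) (at t)" "(bump1 has_real_derivative bump2 t) (at t)"
proof -
  show "(bump_poly 1 has_real_derivative bump1 t) (at t)"
    using bump_poly_DERIV[of 1 t] by (simp add: bump1_def)
  have "monom 1 2 * (monom 1 2 - pderiv (monom 1 2)) = monom 1 4 - monom (2::real) 3"
    by (simp add: pderiv_monom algebra_simps mult_monom eval_nat_numeral)
  then show "(bump1 has_real_derivative bump2 t) (at t)"
    using bump_poly_DERIV[of "monom 1 2" t] by (simp add: bump1_def bump2_def)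
qed

text \<open>Up to the factor \<open>4 / s^2\<close> this combination is the Laplacian of the planar
  bump. With \<open>y = 1/u\<close> it is a positive \<open>y^4\<close> term minus
  \<open>y^3\<close> and \<open>y^2\<close> terms; the first decides, with
  \<open>81 / 16 = (3 / 2)^4\<close>.\<close>

lemma bump_combination_bound:
  assumes "u \<le> 1"
  shows "\<bar>(1 - u) * bump2 u - bump1 u\<bar> \<le> 81 / 16"
proof (cases "u > 0")
  case False
  then show ?thesis by (simp add: bump1_def bump2_def bump_poly_def)
next
  case True
  define y where "y = 1 / u"
  have y: "y \<ge> 1" using assms True by (simp add: y_def)
  define E where "E = exp (- y)"
  have E: "E > 0" by (simp add: E_def)
  have eq: "(1 - u) * bump2 u - bump1 u = (1 - u) * (y ^ 4 * E) - (1 - u) * (2 * (y ^ 3 * E)) - y\<^sup>2 * E"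
    using True by (simp add: bump1_def bump2_def bump_poly_def poly_monom y_def[symmetric] E_def[symmetric] algebra_simps)
  have n: "0 \<le> y ^ 4 * E" "0 \<le> y ^ 3 * E" "0 \<le> y\<^sup>2 * E" using y E by auto
  have u: "0 \<le> 1 - u" "1 - u \<le> 1" using assms True by auto
  have 4: "y ^ 4 * E \<le> 81 / 16"
    using power_exp_le[of y 4] y by (simp add: E_def power_divide)
  have 3: "y ^ 3 * E \<le> 729 / 512"
    using power_exp_le[of y 3] y by (simp add: E_def power_divide)
  have 2: "y\<^sup>2 * E \<le> 9 / 16"
    using power_exp_le[of y 2] y by (simp add: E_def power_divide)
  have "(1 - u) * (y ^ 4 * E) \<le> y ^ 4 * E" "(1 - u) * (2 * (y ^ 3 * E)) \<le> 2 * (y ^ 3 * E)"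
    using u n by (auto intro: mult_left_le_one_le)
  moreover have "0 \<le> (1 - u) * (y ^ 4 * E)" "0 \<le> (1 - u) * (2 * (y ^ 3 * E))" using u n by auto
  ultimately show ?thesis unfolding eq using 2 3 4 n(3) by linarith
qed

definition laplacian :: "('a::euclidean_space \<Rightarrow> real) \<Rightarrow> 'a \<Rightarrow> real" where
  "laplacian f x = (\<Sum>b\<in>Basis. partial b (partial b f) x)"

lemma partial_norm2: "partial b (\<lambda>v. 1 - (norm (v - c))\<^sup>2 / s\<^sup>2) v = - 2 / s\<^sup>2 * ((v - c) \<bullet> b)"
proof -
  have "((\<lambda>v. 1 - k * ((v - c) \<bullet> (v - c))) has_derivative (\<lambda>h. - (k * (2 * ((v - c) \<bullet> h))))) (at v)" for k
    by (auto intro!: derivative_eq_intros simp: inner_commute)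
  from partial_eqI[OF this[of "1 / s\<^sup>2"], of b] show ?thesis by (simp add: power2_norm_eq_inner)
qed

lemma smooth_bump_arg: "smooth (\<lambda>v. 1 - (norm (v - c))\<^sup>2 / s\<^sup>2)"
  using smooth_diff[OF smooth_const[of 1] smooth_mult[OF smooth_const[of "1 / s\<^sup>2"] smooth_norm2[of c]]] by simp

text \<open>For a profile \<open>h\<close> of \<open>u = 1 - |v - c|^2 / s^2\<close> the Laplacian
  is \<open>h''(u) |\<nabla>u|^2 + h'(u) \<Delta>u\<close>. In the plane,
  \<open>|\<nabla>u|^2 = 4 (1 - u) / s^2\<close> and \<open>\<Delta>u = -4 / s^2\<close>.\<close>

lemma laplacian_ball_bump:
  fixes c :: "real ^ 2"
  assumes s: "s > 0"
  shows "\<bar>laplacian (ball_bump c s) v\<bar> \<le> 81 / (4 * s\<^sup>2)"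
proof -
  define u where "u = (\<lambda>v. 1 - (norm (v - c))\<^sup>2 / s\<^sup>2)"
  have su: "smooth u" unfolding u_def by (rule smooth_bump_arg)
  have pu: "partial b u = (\<lambda>v. - 2 / s\<^sup>2 * ((v - c) \<bullet> b))" for b
    unfolding u_def by (rule ext) (rule partial_norm2)
  have p1: "partial b (ball_bump c s) = (\<lambda>v. bump1 (u v) * partial b u v)" for b
  proof
    fix v
    have "partial b (\<lambda>v. bump_poly 1 (u v)) v = bump1 (u v) * partial b u v"
      by (rule partial_compose[OF bump_poly_derivs(1) smooth_imp_has_derivative[OF su]])
    then show "partial b (ball_bump c s) v = bump1 (u v) * partial b u v"
      by (simp add: ball_bump_def[abs_def] u_def)
  qed
  have s1: "smooth (\<lambda>v. bump1 (u v))" unfolding bump1_def by (rule smooth_bump_poly[OF su])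
  have p2: "partial b (partial b (ball_bump c s)) v
      = bump1 (u v) * (- 2 / s\<^sup>2) + bump2 (u v) * (4 / s ^ 4 * ((v - c) \<bullet> b)\<^sup>2)" if b: "b \<in> Basis" for b v
  proof -
    have "partial b (partial b u) v = - 2 / s\<^sup>2"
    proof -
      have "((\<lambda>v. k * ((v - c) \<bullet> b)) has_derivative (\<lambda>h. k * (h \<bullet> b))) (at v)" for k
        by (auto intro!: derivative_eq_intros)
      from partial_eqI[OF this[of "- 2 / s\<^sup>2"], of b] show ?thesis using b by (simp add: pu)
    qed
    moreover have "partial b (\<lambda>v. bump1 (u v)) v = bump2 (u v) * partial b u v"
      by (rule partial_compose[OF bump_poly_derivs(2) smooth_imp_has_derivative[OF su]])
    ultimately have "partial b (partial b (ball_bump c s)) v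
      = bump1 (u v) * (- 2 / s\<^sup>2) + bump2 (u v) * partial b u v * partial b u v"
      unfolding p1 by (subst smooth_partial_mult[OF s1 smoothD(2)[OF su b]]) simp
    then show ?thesis
      by (simp add: pu power2_eq_square power4_eq_xxxx field_simps)
  qed
  have n2: "(norm (v - c))\<^sup>2 = (\<Sum>b\<in>Basis. ((v - c) \<bullet> b)\<^sup>2)"
    unfolding power2_norm_eq_inner by (subst euclidean_inner) (simp add: power2_eq_square)
  have "laplacian (ball_bump c s) v = (\<Sum>b\<in>(Basis :: (real ^ 2) set). bump1 (u v) * (- 2 / s\<^sup>2)) + bump2 (u v) * (4 / s ^ 4 * (norm (v - c))\<^sup>2)"
    unfolding laplacian_def n2 by (simp add: p2 sum.distrib sum_subtractf sum_distrib_left)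
  also have "(\<Sum>b\<in>(Basis :: (real ^ 2) set). bump1 (u v) * (- 2 / s\<^sup>2)) = bump1 (u v) * (- 4 / s\<^sup>2)" by simp
  also have "(norm (v - c))\<^sup>2 = s\<^sup>2 * (1 - u v)" using s by (simp add: u_def)
  also have "4 / s ^ 4 * (s\<^sup>2 * (1 - u v)) = 4 / s\<^sup>2 * (1 - u v)"
    using s by (simp add: power2_eq_square power4_eq_xxxx)
  finally have "laplacian (ball_bump c s) v = 4 / s\<^sup>2 * ((1 - u v) * bump2 (u v) - bump1 (u v))"
    by (simp add: algebra_simps diff_divide_distrib add_divide_distrib)
  then have "\<bar>laplacian (ball_bump c s) v\<bar> = 4 / s\<^sup>2 * \<bar>(1 - u v) * bump2 (u v) - bump1 (u v)\<bar>"
    by (simp only: abs_mult) simp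
  also have "\<dots> \<le> 4 / s\<^sup>2 * (81 / 16)"
    by (intro mult_left_mono bump_combination_bound) (auto simp: u_def)
  finally show ?thesis by simp
qed

lemma cball_subset_square: "cball c s \<subseteq> square c s"
proof
  fix v assume "v \<in> cball c s"
  then have "norm (v - c) \<le> s" by (simp add: dist_norm norm_minus_commute)
  then show "v \<in> square c s"
    using component_le_norm_cart[of "v - c" 1] component_le_norm_cart[of "v - c" 2] by (simp add: square_def)
qed

lemma norm2_real2: "(norm v)\<^sup>2 = (v $ 1)\<^sup>2 + (v $ 2)\<^sup>2" for v :: "real ^ 2"
  by (simp add: norm_vec_def L2_set_def sum_2)

text \<open>On the square of half side \<open>s / 2\<close>, of area \<open>s^2\<close>, the
  argument of the profile is at least \<open>1 / 2\<close>, so the bump is at least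
  \<open>exp (-2) \<ge> 1 / 9\<close>.\<close>

lemma integral_ball_bump_ge:
  fixes c :: "real ^ 2"
  assumes s: "s > 0"
  shows "s\<^sup>2 / 9 \<le> (LINT v|lborel. ball_bump c s v)"
proof -
  have e: "1 / 9 \<le> exp (- 2 :: real)"
  proof -
    have "exp (1::real) * exp 1 \<le> 3 * 3" using exp_le by (intro mult_mono) auto
    then have "exp (2::real) \<le> 9" by (simp flip: exp_add)
    then show ?thesis by (simp add: exp_minus field_simps)
  qed
  have "4 * (s / 2)\<^sup>2 = measure lborel (square c (s / 2))"
    using emeasure_square[of "s / 2" c] s by (simp add: measure_def)
  then have "s\<^sup>2 / 9 = (LINT v|lborel. 1 / 9 * indicator (square c (s / 2)) v)"
    by (simp add: power2_eq_square)
  also have "\<dots> \<le> (LINT v|lborel. ball_bump c s v)"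
  proof (rule integral_mono)
    show "integrable lborel (\<lambda>v. 1 / 9 * indicator (square c (s / 2)) v :: real)"
      using emeasure_square[of "s / 2" c] s by (intro integrable_mult_right integrable_real_indicator) auto
    have "test_function UNIV (ball_bump c s)" by (rule test_function_ball_bump[OF s]) simp
    then show "integrable lborel (ball_bump c s)" by (rule test_function_integrable)
    fix v
    show "1 / 9 * indicator (square c (s / 2)) v \<le> ball_bump c s v"
    proof (cases "v \<in> square c (s / 2)")
      case False
      then show ?thesis by (simp add: ball_bump_nonneg)
    next
      case True
      then have "(v $ 1 - c $ 1)\<^sup>2 \<le> (s / 2)\<^sup>2" "(v $ 2 - c $ 2)\<^sup>2 \<le> (s / 2)\<^sup>2"
        using s by (auto simp: square_def abs_le_square_iff[symmetric])
      then have "(norm (v - c))\<^sup>2 \<le> s\<^sup>2 / 2" unfolding norm2_real2 by (simp add: power_divide)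
      moreover define u where "u = 1 - (norm (v - c))\<^sup>2 / s\<^sup>2"
      ultimately have u: "u \<ge> 1 / 2" using s by (simp add: divide_le_eq)
      then have "1 / u \<le> 2" by (simp add: divide_le_eq)
      then have "exp (- 2) \<le> ball_bump c s v" using u by (simp add: ball_bump_def bump_poly_def u_def[symmetric])
      with e True show ?thesis by simp
    qed
  qed
  finally show ?thesis .
qed

section \<open>The two local estimates and their combination\<close>

context planar_domain
begin

text \<open>The Laplacian of the bump has integral 0, so the pairing does not see the constant
  \<open>m\<close>, which is therefore arbitrary. Cauchy-Schwarz on the square converts the lower
  bound of the pairing into one of the deviation.\<close>

lemma torsion_deviation_on_square:
  assumes w: "torsion_solution \<Omega> w" and s: "s > 0" and sub: "square c s \<subseteq> \<Omega>"
  shows "4 * s ^ 6 / 531441 \<le> (LINT v|M. (w v - m)\<^sup>2 * indicator (square c s) v)"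
proof -
  define \<beta> where "\<beta> = ball_bump c s"
  have t: "test_function \<Omega> \<beta>"
    unfolding \<beta>_def by (rule test_function_ball_bump[OF s order_trans[OF cball_subset_square sub]])
  have tb: "test_function \<Omega> (partial b \<beta>)" "test_function \<Omega> (partial b (partial b \<beta>))" if "b \<in> Basis" for b
    using test_function_partial[OF t that] test_function_partial[OF test_function_partial[OF t that] that] by auto
  have tl: "test_function \<Omega> (laplacian \<beta>)"
    unfolding laplacian_def[abs_def] by (rule test_function_sum[OF tb(2)])
  define g where "g = weak_gradient \<Omega> w"
  have wH: "w \<in> H10 \<Omega>" using w by (simp add: torsion_solution_def)
  have hw: "has_weak_gradient \<Omega> w g" using H10E[OF wH] unfolding g_def by blast
  note L = has_weak_gradientD(1,2)[OF hw]
  have i: "integrable M (\<lambda>x. w x * laplacian \<beta> x)" "integrable M (laplacian \<beta>)"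
    using L2_integrable_inner[OF L(1) test_function_L2[OF tl]] L2_imp_integrable(1)[OF test_function_L2[OF tl]] by auto
  \<comment> \<open>As \<open>w\<close> has only weak first derivatives, one derivative is moved to
    it, tested with the partial derivatives of the bump; the equation for \<open>w\<close> does the
    rest.\<close>
  have "(LINT x|M. w x * laplacian \<beta> x) = (LINT x|M. (\<Sum>b\<in>Basis. w x * partial b (partial b \<beta>) x))"
    by (simp add: laplacian_def sum_distrib_left)
  also have "\<dots> = (\<Sum>b\<in>Basis. LINT x|M. w x * partial b (partial b \<beta>) x)"
    by (rule Bochner_Integration.integral_sum)
      (use L2_integrable_inner[OF L(1) test_function_L2[OF tb(2)]] in simp)
  also have "\<dots> = (\<Sum>b\<in>Basis. - (LINT x|M. (g x \<bullet> b) * partial b \<beta> x))"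
    by (intro sum.cong refl has_weak_gradientD(3)[OF hw] tb)
  also have "\<dots> = - (LINT x|M. (\<Sum>b\<in>Basis. (g x \<bullet> b) * partial b \<beta> x))"
    unfolding sum_negf
    by (subst Bochner_Integration.integral_sum)
      (use L2_integrable_inner[OF L2_component[OF L(2)] test_function_L2[OF tb(1)]] in simp_all)
  also have "\<dots> = - (LINT x|M. g x \<bullet> grad \<beta> x)"
    by (simp add: inner_commute[of "g _" "grad _ _"] grad_inner_sum mult.commute)
  also have "\<dots> = - (LINT x|M. \<beta> x)" unfolding g_def torsion_weak_form[OF w t] ..
  finally have "(LINT x|M. w x * laplacian \<beta> x) = - (LINT x|M. \<beta> x)" .
  moreover have "(LINT x|M. laplacian \<beta> x) = 0"
  proof -
    have "(LINT x|M. laplacian \<beta> x) = (\<Sum>b\<in>Basis. LINT x|M. partial b (partial b \<beta>) x)"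
      unfolding laplacian_def
      by (rule Bochner_Integration.integral_sum) (rule L2_imp_integrable(1)[OF test_function_L2[OF tb(2)]])
    also have "\<dots> = 0"
      by (intro sum.neutral ballI)
        (simp add: integral_test_function[OF tb(2)] integral_partial_test_function[OF tb(1)])
    finally show ?thesis .
  qed
  ultimately have lap: "(LINT x|M. (m - w x) * laplacian \<beta> x) = (LINT x|M. \<beta> x)"
    using i by (simp add: left_diff_distrib)
  have Ld: "L2 M (\<lambda>x. w x - m)" by (rule L2_diff[OF L(1) L2_const])
  define Q where "Q = (LINT v|M. (w v - m)\<^sup>2 * indicator (square c s) v)"
  define f where "f = (\<lambda>x. indicator (square c s) x *\<^sub>R (w x - m))"
  have f: "L2 M f" "(L2norm M f)\<^sup>2 = Q"
    unfolding f_def Q_def using L2norm_indicator(1,2)[OF Ld sets_square] by simp_all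
  \<comment> \<open>The indicator as a second factor confines Cauchy-Schwarz to the square and
    contributes the norm \<open>2 * s\<close>.\<close>
  define h where "h = (\<lambda>x. indicator (square c s) x *\<^sub>R (1 :: real))"
  have h: "L2 M h" "(L2norm M h)\<^sup>2 = 4 * s\<^sup>2"
  proof -
    show "L2 M h" unfolding h_def by (rule L2norm_indicator(1)[OF L2_const sets_square])
    have "(L2norm M h)\<^sup>2 = (LINT v|M. indicator (square c s) v)"
      unfolding h_def L2norm_indicator(2)[OF L2_const sets_square] by simp
    also have "\<dots> = (LINT v|lborel. indicator (square c s) v)"
      by (rule integral_M_lborel(1)) (use sub in \<open>auto simp: indicator_def\<close>)
    also have "\<dots> = 4 * s\<^sup>2" using emeasure_square[of s c] s by (simp add: measure_def)
    finally show "(L2norm M h)\<^sup>2 = 4 * s\<^sup>2" .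
  qed
  have absf: "L2 M (\<lambda>x. \<bar>f x\<bar>)" "L2norm M (\<lambda>x. \<bar>f x\<bar>) = L2norm M f"
    using f(1) by (auto simp: L2_def L2norm_def)
  have pw: "(m - w x) * laplacian \<beta> x \<le> 81 / (4 * s\<^sup>2) * (\<bar>f x\<bar> * h x)" for x
  proof (cases "x \<in> square c s")
    case True
    have "(m - w x) * laplacian \<beta> x \<le> \<bar>m - w x\<bar> * \<bar>laplacian \<beta> x\<bar>" by (metis abs_ge_self abs_mult)
    also have "\<dots> \<le> \<bar>m - w x\<bar> * (81 / (4 * s\<^sup>2))"
      unfolding \<beta>_def by (intro mult_left_mono laplacian_ball_bump[OF s]) simp
    finally show ?thesis using True by (simp add: f_def h_def abs_minus_commute mult.commute)
  next
    case False
    have "laplacian \<beta> x = 0"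
    proof -
      have "test_function (square c s) \<beta>"
        unfolding \<beta>_def by (rule test_function_ball_bump[OF s cball_subset_square])
      then have "test_function (square c s) (laplacian \<beta>)"
        unfolding laplacian_def[abs_def] by (intro test_function_sum test_function_partial)
      then show ?thesis using False by (rule test_functionD(4))
    qed
    then show ?thesis by (simp add: h_def)
  qed
  have "s\<^sup>2 / 9 \<le> (LINT x|M. \<beta> x)"
    unfolding integral_test_function[OF t] unfolding \<beta>_def by (rule integral_ball_bump_ge[OF s])
  also have "\<dots> = (LINT x|M. (m - w x) * laplacian \<beta> x)" by (rule lap[symmetric])
  also have "\<dots> \<le> (LINT x|M. 81 / (4 * s\<^sup>2) * (\<bar>f x\<bar> * h x))"
  proof (rule integral_mono[OF _ _ pw])
    show "integrable M (\<lambda>x. (m - w x) * laplacian \<beta> x)" using i by (simp add: left_diff_distrib)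
    show "integrable M (\<lambda>x. 81 / (4 * s\<^sup>2) * (\<bar>f x\<bar> * h x))"
      using L2_integrable_inner[OF absf(1) h(1)] by simp
  qed
  also have "\<dots> \<le> 81 / (4 * s\<^sup>2) * (L2norm M f * L2norm M h)"
    using L2_Cauchy_Schwarz[OF absf(1) h(1)] by (simp add: absf(2) divide_right_mono)
  finally have le: "s\<^sup>2 / 9 \<le> 81 / (4 * s\<^sup>2) * (L2norm M f * L2norm M h)" .
  \<comment> \<open>\<open>729 = 9 * 81\<close> collects the bounds for the integral of the bump and
    for its Laplacian; its square is 531441.\<close>
  have "4 * s ^ 4 \<le> 729 * (L2norm M f * L2norm M h)"
    using le s by (simp add: field_simps power2_eq_square power4_eq_xxxx)
  then have "(4 * s ^ 4)\<^sup>2 \<le> (729 * (L2norm M f * L2norm M h))\<^sup>2"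
    by (rule power_mono) simp
  also have "\<dots> = 531441 * (Q * (4 * s\<^sup>2))"
    unfolding power_mult_distrib f(2) h(2) by simp
  finally have "(4 * s\<^sup>2) * (4 * s ^ 6) \<le> (4 * s\<^sup>2) * (531441 * Q)"
    by (simp add: power_mult_distrib power_mult[symmetric] algebra_simps flip: power_add)
  then have "4 * s ^ 6 \<le> 531441 * Q" by (rule mult_left_le_imp_le) (use s in simp)
  then show ?thesis by (simp add: Q_def)
qed

lemma torsion_variance:
  assumes w: "torsion_solution \<Omega> w" and m: "m = (LINT x|M. w x) / measure lebesgue \<Omega>" and m0: "m > 0"
  shows "m\<^sup>2 * measure lebesgue \<Omega> \<le> 7 * 10 ^ 11 * (LINT x|M. (w x - m)\<^sup>2)"
proof -
  define A where "A = measure lebesgue \<Omega>"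
  have A0: "A > 0"
  proof (rule ccontr)
    assume "\<not> A > 0"
    then have "A = 0" using measure_nonneg[of lebesgue \<Omega>] by (simp add: A_def)
    with m m0 show False by (simp add: A_def)
  qed
  define g where "g = weak_gradient \<Omega> w"
  have wH: "w \<in> H10 \<Omega>" using w by (simp add: torsion_solution_def)
  have hw: "has_weak_gradient \<Omega> w g" using H10E[OF wH] unfolding g_def by blast
  note L = has_weak_gradientD(1,2)[OF hw]
  have Ld: "L2 M (\<lambda>x. w x - m)" by (rule L2_diff[OF L(1) L2_const])
  have iw: "integrable M (\<lambda>x. (w x)\<^sup>2)" "integrable M (\<lambda>x. (w x - m)\<^sup>2)" "integrable M (\<lambda>x. (norm (g x))\<^sup>2)"
    "integrable M (\<lambda>x. m\<^sup>2)"
    using L2D(2)[OF L(1)] L2D(2)[OF Ld] L2D(2)[OF L(2)] by simp_all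
  define V where "V = (LINT x|M. (w x - m)\<^sup>2)"
  have V0: "V \<ge> 0" by (simp add: V_def)
  have energy: "(LINT x|M. (norm (g x))\<^sup>2) = m * A"
    unfolding g_def torsion_energy[OF w] using A0 by (simp add: m A_def)
  \<comment> \<open>After averaging, the gradient term is
    \<open>96 * s^2 * (16 * s^2) * (m * A)\<close> against \<open>4 * s^2 * (m^2 * A)\<close>. The
    quotient \<open>384 * s^2 / m\<close> becomes \<open>1 / 2\<close>.\<close>
  define s where "s = sqrt (m / 768)"
  have s: "s > 0" "s\<^sup>2 = m / 768" using m0 by (simp_all add: s_def)
  \<comment> \<open>an upper bound of \<open>768\<^sup>2 * 531441\<close>\<close>
  define \<alpha> where "\<alpha> = (313500000000 :: real)"
  define D where "D c = (LINT v|M. (w v - m)\<^sup>2 * indicator (square c s) v)" for c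
  define E where "E c = (LINT v|M. (norm (g v))\<^sup>2 * indicator (square c (2 * s)) v)" for c
  have DE: "D c \<ge> 0" "E c \<ge> 0" for c unfolding D_def E_def by (auto intro!: integral_nonneg_AE)
  have pw: "(LINT v|M. m\<^sup>2 * indicator (square c s) v) \<le> \<alpha> * D c + 96 * s\<^sup>2 * E c" for c
  proof (cases "square c s \<subseteq> \<Omega>")
    case True
    have "(LINT v|M. m\<^sup>2 * indicator (square c s) v) = (LINT v|lborel. m\<^sup>2 * indicator (square c s) v)"
      by (rule integral_M_lborel(1)) (use True in \<open>auto simp: indicator_def\<close>)
    also have "\<dots> = m\<^sup>2 * (4 * s\<^sup>2)" using emeasure_square[of s c] s(1) by (simp add: measure_def)
    \<comment> \<open>\<open>589824 = 768^2\<close>, from \<open>m = 768 * s^2\<close>.\<close>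
    also have "\<dots> = (531441 * 589824) * (4 * s ^ 6 / 531441)"
    proof -
      have "m = 768 * s\<^sup>2" using s by simp
      then show ?thesis by (simp add: power_mult_distrib power_mult[symmetric] flip: power_add)
    qed
    also have "\<dots> \<le> (531441 * 589824) * D c"
      unfolding D_def by (intro mult_left_mono torsion_deviation_on_square[OF w s(1) True]) simp
    also have "\<dots> \<le> \<alpha> * D c" using DE(1)[of c] by (intro mult_right_mono) (simp_all add: \<alpha>_def)
    finally have "(LINT v|M. m\<^sup>2 * indicator (square c s) v) \<le> \<alpha> * D c" .
    moreover have "0 \<le> 96 * s\<^sup>2 * E c" using DE(2)[of c] by simp
    ultimately show ?thesis by linarith
  next
    case False
    \<comment> \<open>Either \<open>w\<close> is far from \<open>m\<close> on the square, or it is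
      not small there and the local Poincare inequality charges the gradient;
      \<open>m^2 \<le> 2 (w - m)^2 + 2 w^2\<close> covers both.\<close>
    have "(LINT v|M. m\<^sup>2 * indicator (square c s) v)
      \<le> (LINT v|M. 2 * ((w v - m)\<^sup>2 * indicator (square c s) v) + 2 * ((w v)\<^sup>2 * indicator (square c s) v))"
    proof (rule integral_mono)
      show "integrable M (\<lambda>v. m\<^sup>2 * indicator (square c s) v)"
        by (rule integrable_indicator_mult[OF iw(4) sets_square])
      show "integrable M (\<lambda>v. 2 * ((w v - m)\<^sup>2 * indicator (square c s) v) + 2 * ((w v)\<^sup>2 * indicator (square c s) v))"
        using integrable_indicator_mult[OF iw(1) sets_square] integrable_indicator_mult[OF iw(2) sets_square] by simp
      have "m\<^sup>2 \<le> 2 * (w v - m)\<^sup>2 + 2 * (w v)\<^sup>2" for v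
        using zero_le_power2[of "2 * w v - m"] by (simp add: power2_eq_square algebra_simps)
      then show "m\<^sup>2 * indicator (square c s) v \<le> 2 * ((w v - m)\<^sup>2 * indicator (square c s) v) + 2 * ((w v)\<^sup>2 * indicator (square c s) v)" for v
        by (simp add: indicator_def)
    qed
    also have "\<dots> = 2 * D c + 2 * (LINT v|M. (w v)\<^sup>2 * indicator (square c s) v)"
      using integrable_indicator_mult[OF iw(1) sets_square] integrable_indicator_mult[OF iw(2) sets_square]
      by (simp add: D_def)
    also have "\<dots> \<le> \<alpha> * D c + 2 * (48 * s\<^sup>2 * E c)"
      unfolding E_def g_def using DE(1)[of c]
      by (intro add_mono mult_left_mono mult_right_mono H10_local_poincare[OF wH s(1) False]) (simp_all add: \<alpha>_def)
    finally show ?thesis by simp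
  qed
  have "ennreal (4 * s\<^sup>2 * (LINT v|M. m\<^sup>2)) = (\<integral>\<^sup>+c. ennreal (LINT v|M. m\<^sup>2 * indicator (square c s) v) \<partial>lborel)"
    using square_average(2)[OF iw(4)] s by simp
  also have "\<dots> \<le> (\<integral>\<^sup>+c. ennreal \<alpha> * ennreal (D c) + ennreal (96 * s\<^sup>2) * ennreal (E c) \<partial>lborel)"
  proof (rule nn_integral_mono)
    fix c
    have "ennreal (\<alpha> * D c + 96 * s\<^sup>2 * E c) = ennreal \<alpha> * ennreal (D c) + ennreal (96 * s\<^sup>2) * ennreal (E c)"
      using DE[of c] by (simp add: ennreal_plus ennreal_mult \<alpha>_def)
    with ennreal_leI[OF pw[of c]]
    show "ennreal (LINT v|M. m\<^sup>2 * indicator (square c s) v) \<le> ennreal \<alpha> * ennreal (D c) + ennreal (96 * s\<^sup>2) * ennreal (E c)" by simp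
  qed
  also have "\<dots> = ennreal \<alpha> * ennreal (4 * s\<^sup>2 * V) + ennreal (96 * s\<^sup>2) * ennreal (4 * (2 * s)\<^sup>2 * (m * A))"
  proof -
    have "0 \<le> s" "0 \<le> 2 * s" using s by auto
    note a = square_average[OF iw(2) zero_le_power2 this(1), folded D_def V_def]
      and b = square_average[OF iw(3) zero_le_power2 this(2), folded E_def, unfolded energy]
    show ?thesis unfolding a(2)[symmetric] b(2)[symmetric]
      using a(1) b(1) by (simp add: nn_integral_add nn_integral_cmult)
  qed
  also have "\<dots> = ennreal (\<alpha> * (4 * s\<^sup>2 * V) + 96 * s\<^sup>2 * (4 * (2 * s)\<^sup>2 * (m * A)))"
  proof -
    have nn: "0 \<le> \<alpha>" "0 \<le> 4 * s\<^sup>2 * V" "0 \<le> 96 * s\<^sup>2" "0 \<le> 4 * (2 * s)\<^sup>2 * (m * A)"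
      "0 \<le> \<alpha> * (4 * s\<^sup>2 * V)" "0 \<le> 96 * s\<^sup>2 * (4 * (2 * s)\<^sup>2 * (m * A))"
      using V0 m0 A0 by (auto simp: \<alpha>_def)
    show ?thesis
      unfolding ennreal_mult[OF nn(1,2)] ennreal_mult[OF nn(3,4)] ennreal_plus[OF nn(5,6)] ..
  qed
  finally have "4 * s\<^sup>2 * (LINT v|M. m\<^sup>2) \<le> \<alpha> * (4 * s\<^sup>2 * V) + 96 * s\<^sup>2 * (4 * (2 * s)\<^sup>2 * (m * A))"
    using V0 m0 A0 by (subst (asm) ennreal_le_iff) (auto simp: \<alpha>_def)
  also have "(LINT v|M. m\<^sup>2) = m\<^sup>2 * A" by (simp add: measure_M A_def mult.commute)
  also have "96 * s\<^sup>2 * (4 * (2 * s)\<^sup>2 * (m * A)) = 4 * s\<^sup>2 * (m\<^sup>2 * A / 2)"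
  proof -
    have "m = 768 * s\<^sup>2" using s by simp
    then show ?thesis by (simp add: power2_eq_square)
  qed
  finally have "4 * s\<^sup>2 * (m\<^sup>2 * A) \<le> 4 * s\<^sup>2 * (\<alpha> * V + m\<^sup>2 * A / 2)" by (simp add: algebra_simps)
  then have "m\<^sup>2 * A \<le> \<alpha> * V + m\<^sup>2 * A / 2" by (rule mult_left_le_imp_le) (use s in simp)
  then have "m\<^sup>2 * A \<le> 2 * \<alpha> * V" by simp
  also have "\<dots> \<le> 7 * 10 ^ 11 * V" using V0 by (intro mult_right_mono) (simp_all add: \<alpha>_def)
  finally show ?thesis by (simp add: A_def V_def)
qed

end

text \<open>The crude bound \<open>pi \<ge> 2\<close>, which turns the bracket into
  \<open>11 / 8\<close>, already brings the deficit below \<open>10^(-12)\<close>.\<close>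

lemma deficit_le: "3 ^ 4 / (12801 * 2 ^ 31 * (1 + (pi + pi ^ 2) / 16) ^ 4) \<le> (1 / 10 ^ 12 :: real)"
proof -
  have "(2::real) ^ 2 \<le> pi ^ 2" using pi_ge_two by (intro power_mono) auto
  then have "11 / 8 \<le> 1 + (pi + pi ^ 2) / 16" using pi_ge_two by simp
  then have "(11 / 8) ^ 4 \<le> (1 + (pi + pi ^ 2) / 16) ^ 4" by (intro power_mono) auto
  then have "3 ^ 4 / (12801 * 2 ^ 31 * (1 + (pi + pi ^ 2) / 16) ^ 4) \<le> (3 ^ 4 / (12801 * 2 ^ 31 * (11 / 8) ^ 4) :: real)"
    by (intro frac_le mult_left_mono) auto
  also have "\<dots> \<le> 1 / 10 ^ 12" by (simp add: power_divide)
  finally show ?thesis .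
qed

section \<open>From the variance to the participation ratio\<close>

theorem proposition4:
  fixes \<Omega> :: "(real ^ 2) set"
  assumes "\<Omega> \<noteq> {}" and "open \<Omega>" and "simply_connected \<Omega>" and "\<Omega> \<in> lmeasurable"
  shows "participation_ratio_1_2 \<Omega> \<le>
    (1 - 3 ^ 4 / (12801 * 2 ^ 31 * (1 + (pi + pi ^ 2) / 16) ^ 4)) powr (1 / 2)"
proof -
  interpret planar_domain \<Omega> by unfold_locales (use assms in auto)
  define w where "w = torsion_function \<Omega>"
  have w: "torsion_solution \<Omega> w"
    unfolding w_def torsion_function_def by (rule someI_ex[OF torsion_solution_exists])
  define A where "A = measure lebesgue \<Omega>"
  have A: "A > 0"
    using open_not_negligible[OF assms(2,1)] negligible_iff_measure0[OF assms(4)] measure_nonneg[of lebesgue \<Omega>]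
    unfolding A_def by (metis less_eq_real_def)
  define m where "m = (LINT x|M. w x) / A"
  have int: "(LINT x|M. w x) = m * A" using A by (simp add: m_def)
  have "0 \<le> m * A" unfolding int[symmetric] torsion_integral_abs[OF w, symmetric] by simp
  then have m0: "m \<ge> 0" using A by (simp add: zero_le_mult_iff)
  define \<delta> where "\<delta> = (3 ^ 4 / (12801 * 2 ^ 31 * (1 + (pi + pi ^ 2) / 16) ^ 4) :: real)"
  have \<delta>: "\<delta> \<le> 1 / 10 ^ 12" unfolding \<delta>_def by (rule deficit_le)
  have L1: "Lp_norm 1 \<Omega> w = m * A"
    using \<open>0 \<le> m * A\<close> by (simp add: Lp_norm_def torsion_integral_abs[OF w] int)
  have L2: "Lp_norm 2 \<Omega> w = sqrt (LINT x|M. (w x)\<^sup>2)"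
    by (simp add: Lp_norm_def powr_half_sqrt)
  show ?thesis
  proof (cases "m = 0")
    \<comment> \<open>The numerator is 0, so the ratio is 0 even under the convention for division
      by 0, and a value of \<open>powr\<close> is never negative.\<close>
    case True
    then show ?thesis using L1 by (simp add: participation_ratio_1_2_def w_def)
  next
    case False
    with m0 have m: "m > 0" by simp
    define V where "V = (LINT x|M. (w x - m)\<^sup>2)"
    have var: "m\<^sup>2 * A \<le> 7 * 10 ^ 11 * V"
      unfolding V_def A_def by (rule torsion_variance[OF w _ m]) (simp add: m_def A_def)
    have wH: "w \<in> H10 \<Omega>" using w by (simp add: torsion_solution_def)
    have Lw: "L2 M w" using H10E[OF wH] has_weak_gradientD(1) by blast
    have N: "(LINT x|M. (w x)\<^sup>2) = V + m\<^sup>2 * A"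
    proof -
      have "V = (LINT x|M. (w x)\<^sup>2 - 2 * m * w x + m\<^sup>2)"
        unfolding V_def by (simp add: power2_diff algebra_simps)
      also have "\<dots> = (LINT x|M. (w x)\<^sup>2) - 2 * m * (m * A) + m\<^sup>2 * A"
        using L2D(2)[OF Lw] L2_imp_integrable(1)[OF Lw] by (simp add: int measure_M A_def mult.commute)
      finally show ?thesis by (simp add: power2_eq_square)
    qed
    have mA: "m\<^sup>2 * A > 0" using m A by simp
    \<comment> \<open>The variance bound gives the quotient at most
      \<open>1 - 1 / (7 * 10^11 + 1)\<close>, and \<open>7 * 10^11 + 1 \<le> 10^12\<close>.\<close>
    have "m\<^sup>2 * A \<le> (1 - 1 / 10 ^ 12) * (V + m\<^sup>2 * A)"
      using var mA by (simp add: algebra_simps)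
    also have "\<dots> \<le> (1 - \<delta>) * (V + m\<^sup>2 * A)"
      using \<delta> var mA by (intro mult_right_mono) auto
    finally have le: "m\<^sup>2 * A / (V + m\<^sup>2 * A) \<le> 1 - \<delta>"
      using var mA by (simp add: divide_le_eq)
    have "participation_ratio_1_2 \<Omega> = 1 / sqrt A * (m * A / sqrt (V + m\<^sup>2 * A))"
      unfolding participation_ratio_1_2_def w_def[symmetric] L1 L2 N A_def[symmetric]
      using A by (simp add: powr_half_sqrt)
    also have "\<dots> = sqrt (m\<^sup>2 * A / (V + m\<^sup>2 * A))"
    proof -
      have "m * A / sqrt A = m * (A / sqrt A)" by simp
      also have "A / sqrt A = sqrt A" using A by (intro real_div_sqrt) simp
      finally have "m * A / sqrt A = m * sqrt A" .
      then show ?thesis using m A by (simp add: real_sqrt_divide real_sqrt_mult)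
    qed
    also have "\<dots> \<le> sqrt (1 - \<delta>)" using le by (rule real_sqrt_le_mono)
    also have "\<dots> = (1 - \<delta>) powr (1 / 2)" using \<delta> by (simp add: powr_half_sqrt)
    finally show ?thesis by (simp add: \<delta>_def)
  qed
qed

end
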